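(* Let $A$ and $B$ be separable recursive subhomogeneous algebras, let $C$ be a C*-algebra, and let $\varphi \colon A \to C$ and $\rho \colon B \to C$ be homomorphisms with $\varphi$ unital and $\rho$ surjective. Then the pullback $A \oplus_C B = \{(a,b) \in A \oplus B : \varphi(a) = \rho(b)\}$ is a recursive subhomogeneous algebra. Moreover, $A \oplus_C B$ has a recursive subhomogeneous decomposition in which the topological dimension and maximum matrix size are each no larger than the maximum of the corresponding quantities for $A$ and $B$.
   Context: Homomorphisms of C*-algebras are *-homomorphisms, and $M_n = M_n(\mathbf{C})$. Recursive subhomogeneous algebras. The class is defined recursively: (i) if $X$ is a compact Hausdorff space and $n \geq 1$, then $C(X, M_n)$ is a recursive subhomogeneous algebra; (ii) if $A$ is a recursive subhomogeneous algebra, $X$ is compact Hausdorff, $X^{(0)} \subset X$ is closed (possibly empty), $\varphi \colon A \to C(X^{(0)}, M_n)$ is any unital homomorphism and $\rho \colon C(X, M_n) \to C(X^{(0)}, M_n)$ is restriction, then the pullback $A \oplus_{C(X^{(0)}, M_n)} C(X, M_n) = \{(a,f) \in A \oplus C(X, M_n) : \varphi(a) = \rho(f)\}$ is a recursive subhomogeneous algebra. The zero algebra is also allowed. A recursive subhomogeneous decomposition of $R$ is an expression (isomorphism) of $R$ as such an iterated pullback: compact Hausdorff spaces $X_0, \dots, X_l$, positive integers $n(0), \dots, n(l)$, closed subsets $X_k^{(0)} \subset X_k$ ($1 \leq k \leq l$), $C_k = C(X_k, M_{n(k)})$, $C_k^{(0)} = C(X_k^{(0)}, M_{n(k)})$,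 with $R^{(0)} = C_0$, $R^{(k)} = R^{(k-1)} \oplus_{C_k^{(0)}} C_k$ formed using a unital homomorphism $R^{(k-1)} \to C_k^{(0)}$ and the restriction map $C_k \to C_k^{(0)}$, and $R = R^{(l)}$. Its maximum matrix size is $\max_k n(k)$, and its topological dimension is $\max_k \dim(X_k)$, where $\dim$ is covering dimension. Decompositions are not unique; a recursive subhomogeneous algebra is always assumed to come with a given decomposition, and its topological dimension and maximum matrix size are those of the given decomposition. *)

theory Defs
  imports
    "HOL-Analysis.Analysis"
    "HOL-Library.Extended_Real"
    "HOL-Algebra.Congruence"
    "Jordan_Normal_Form.Schur_Decomposition"
begin

section \<open>C*-algebras\<close>

text \<open>A C*-algebra need not have an identity, so neither the ring record of HOL-Algebra (which
  has a designated one) nor a type class is used. Carriers are explicit because pullbacks are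
  proper subsets of products.\<close>

record 'a cstar_alg = "'a partial_object" +
  cadd :: "'a \<Rightarrow> 'a \<Rightarrow> 'a"
  czero :: 'a
  cscale :: "complex \<Rightarrow> 'a \<Rightarrow> 'a"
  cmult :: "'a \<Rightarrow> 'a \<Rightarrow> 'a"
  cstar :: "'a \<Rightarrow> 'a"
  cnorm :: "'a \<Rightarrow> real"

definition cdist :: "'a cstar_alg \<Rightarrow> 'a \<Rightarrow> 'a \<Rightarrow> real" where
  "cdist A x y = cnorm A (cadd A x (cscale A (-1) y))"

locale cstar_algebra =
  fixes A :: "'a cstar_alg"
  assumes add_closed: "x \<in> carrier A \<Longrightarrow> y \<in> carrier A \<Longrightarrow> cadd A x y \<in> carrier A"
    and zero_closed: "czero A \<in> carrier A"
    and scale_closed: "x \<in> carrier A \<Longrightarrow> cscale A c x \<in> carrier A"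
    and mult_closed: "x \<in> carrier A \<Longrightarrow> y \<in> carrier A \<Longrightarrow> cmult A x y \<in> carrier A"
    and star_closed: "x \<in> carrier A \<Longrightarrow> cstar A x \<in> carrier A"
    and add_assoc: "x \<in> carrier A \<Longrightarrow> y \<in> carrier A \<Longrightarrow> z \<in> carrier A \<Longrightarrow>
      cadd A (cadd A x y) z = cadd A x (cadd A y z)"
    and add_commute: "x \<in> carrier A \<Longrightarrow> y \<in> carrier A \<Longrightarrow> cadd A x y = cadd A y x"
    and add_zero: "x \<in> carrier A \<Longrightarrow> cadd A x (czero A) = x"
    and add_inverse: "x \<in> carrier A \<Longrightarrow> cadd A x (cscale A (-1) x) = czero A"
    and scale_one: "x \<in> carrier A \<Longrightarrow> cscale A 1 x = x"
    and scale_scale: "x \<in> carrier A \<Longrightarrow> cscale A c (cscale A d x) = cscale A (c * d) x"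
    and scale_add_left: "x \<in> carrier A \<Longrightarrow>
      cscale A (c + d) x = cadd A (cscale A c x) (cscale A d x)"
    and scale_add_right: "x \<in> carrier A \<Longrightarrow> y \<in> carrier A \<Longrightarrow>
      cscale A c (cadd A x y) = cadd A (cscale A c x) (cscale A c y)"
    and mult_assoc: "x \<in> carrier A \<Longrightarrow> y \<in> carrier A \<Longrightarrow> z \<in> carrier A \<Longrightarrow>
      cmult A (cmult A x y) z = cmult A x (cmult A y z)"
    and mult_add_left: "x \<in> carrier A \<Longrightarrow> y \<in> carrier A \<Longrightarrow> z \<in> carrier A \<Longrightarrow>
      cmult A (cadd A x y) z = cadd A (cmult A x z) (cmult A y z)"
    and mult_add_right: "x \<in> carrier A \<Longrightarrow> y \<in> carrier A \<Longrightarrow> z \<in> carrier A \<Longrightarrow>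
      cmult A x (cadd A y z) = cadd A (cmult A x y) (cmult A x z)"
    and mult_scale_left: "x \<in> carrier A \<Longrightarrow> y \<in> carrier A \<Longrightarrow>
      cmult A (cscale A c x) y = cscale A c (cmult A x y)"
    and mult_scale_right: "x \<in> carrier A \<Longrightarrow> y \<in> carrier A \<Longrightarrow>
      cmult A x (cscale A c y) = cscale A c (cmult A x y)"
    and star_star: "x \<in> carrier A \<Longrightarrow> cstar A (cstar A x) = x"
    and star_add: "x \<in> carrier A \<Longrightarrow> y \<in> carrier A \<Longrightarrow>
      cstar A (cadd A x y) = cadd A (cstar A x) (cstar A y)"
    and star_scale: "x \<in> carrier A \<Longrightarrow> cstar A (cscale A c x) = cscale A (cnj c) (cstar A x)"
    and star_mult: "x \<in> carrier A \<Longrightarrow> y \<in> carrier A \<Longrightarrow>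
      cstar A (cmult A x y) = cmult A (cstar A y) (cstar A x)"
    and norm_nonneg: "x \<in> carrier A \<Longrightarrow> 0 \<le> cnorm A x"
    and norm_eq_zero: "x \<in> carrier A \<Longrightarrow> cnorm A x = 0 \<longleftrightarrow> x = czero A"
    and norm_triangle: "x \<in> carrier A \<Longrightarrow> y \<in> carrier A \<Longrightarrow>
      cnorm A (cadd A x y) \<le> cnorm A x + cnorm A y"
    and norm_scale: "x \<in> carrier A \<Longrightarrow> cnorm A (cscale A c x) = cmod c * cnorm A x"
    and norm_mult: "x \<in> carrier A \<Longrightarrow> y \<in> carrier A \<Longrightarrow>
      cnorm A (cmult A x y) \<le> cnorm A x * cnorm A y"
    and cstar_identity: "x \<in> carrier A \<Longrightarrow> cnorm A (cmult A (cstar A x) x) = (cnorm A x)\<^sup>2"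
    and complete: "(\<And>n. s n \<in> carrier A) \<Longrightarrow>
      (\<forall>e>0. \<exists>N::nat. \<forall>m\<ge>N. \<forall>n\<ge>N. cdist A (s m) (s n) < e) \<Longrightarrow>
      \<exists>x\<in>carrier A. (\<lambda>n. cdist A (s n) x) \<longlonglongrightarrow> 0"

definition separable_cstar :: "'a cstar_alg \<Rightarrow> bool" where
  "separable_cstar A \<longleftrightarrow>
     (\<exists>S. S \<subseteq> carrier A \<and> countable S \<and> (\<forall>x\<in>carrier A. \<forall>e>0. \<exists>s\<in>S. cdist A x s < e))"

definition star_hom :: "'a cstar_alg \<Rightarrow> 'b cstar_alg \<Rightarrow> ('a \<Rightarrow> 'b) \<Rightarrow> bool" where
  "star_hom A B h \<longleftrightarrow>
     (\<forall>x\<in>carrier A. h x \<in> carrier B) \<and>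
     (\<forall>x\<in>carrier A. \<forall>y\<in>carrier A. h (cadd A x y) = cadd B (h x) (h y)) \<and>
     (\<forall>c. \<forall>x\<in>carrier A. h (cscale A c x) = cscale B c (h x)) \<and>
     (\<forall>x\<in>carrier A. \<forall>y\<in>carrier A. h (cmult A x y) = cmult B (h x) (h y)) \<and>
     (\<forall>x\<in>carrier A. h (cstar A x) = cstar B (h x))"

definition star_iso :: "'a cstar_alg \<Rightarrow> 'b cstar_alg \<Rightarrow> ('a \<Rightarrow> 'b) \<Rightarrow> bool" where
  "star_iso A B h \<longleftrightarrow> star_hom A B h \<and> bij_betw h (carrier A) (carrier B)"

definition is_identity :: "'a cstar_alg \<Rightarrow> 'a \<Rightarrow> bool" where
  "is_identity A e \<longleftrightarrow> e \<in> carrier A \<and> (\<forall>x\<in>carrier A. cmult A e x = x \<and> cmult A x e = x)"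

text \<open>Identities are unique, so the existential below says that both algebras are unital and
  that \<open>h\<close> maps the identity to the identity. In the zero algebra, \<open>0\<close> is the identity.\<close>

definition unital_star_hom :: "'a cstar_alg \<Rightarrow> 'b cstar_alg \<Rightarrow> ('a \<Rightarrow> 'b) \<Rightarrow> bool" where
  "unital_star_hom A B h \<longleftrightarrow>
     star_hom A B h \<and> (\<exists>e. is_identity A e \<and> is_identity B (h e))"

text \<open>The common codomain \<open>C\<close> of \<open>\<phi>\<close> and \<open>\<rho>\<close> only enters through equality of values, so it is not
  an argument.\<close>

definition pullback ::
  "'a cstar_alg \<Rightarrow> ('a \<Rightarrow> 'c) \<Rightarrow> 'b cstar_alg \<Rightarrow> ('b \<Rightarrow> 'c) \<Rightarrow> ('a \<times> 'b) cstar_alg" where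
  "pullback A \<phi> B \<rho> =
     \<lparr>carrier = {(a, b). a \<in> carrier A \<and> b \<in> carrier B \<and> \<phi> a = \<rho> b},
      cadd = (\<lambda>(a, b) (a', b'). (cadd A a a', cadd B b b')),
      czero = (czero A, czero B),
      cscale = (\<lambda>c (a, b). (cscale A c a, cscale B c b)),
      cmult = (\<lambda>(a, b) (a', b'). (cmult A a a', cmult B b b')),
      cstar = (\<lambda>(a, b). (cstar A a, cstar B b)),
      cnorm = (\<lambda>(a, b). max (cnorm A a) (cnorm B b))\<rparr>"

text \<open>Transport of structure along a map that is injective on the carrier.\<close>

definition transport :: "('a \<Rightarrow> 'b) \<Rightarrow> 'a cstar_alg \<Rightarrow> 'b cstar_alg" where
  "transport h A = (let g = inv_into (carrier A) h in
     \<lparr>carrier = h ` carrier A,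
      cadd = (\<lambda>x y. h (cadd A (g x) (g y))),
      czero = h (czero A),
      cscale = (\<lambda>c x. h (cscale A c (g x))),
      cmult = (\<lambda>x y. h (cmult A (g x) (g y))),
      cstar = (\<lambda>x. h (cstar A (g x))),
      cnorm = (\<lambda>x. cnorm A (g x))\<rparr>)"


section \<open>The algebras $C(X, M_n)$\<close>

definition l2_vec_norm :: "complex Matrix.vec \<Rightarrow> real" where
  "l2_vec_norm v = sqrt (\<Sum>i<dim_vec v. (cmod (vec_index v i))\<^sup>2)"

definition op_norm :: "complex Matrix.mat \<Rightarrow> real" where
  "op_norm M = Sup {l2_vec_norm (M *\<^sub>v v) | v. v \<in> carrier_vec (dim_col M) \<and> l2_vec_norm v \<le> 1}"

text \<open>Since $M_n$ is finite-dimensional, continuity into it is continuity of all entries.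
  Functions are extensional, i.e. \<open>undefined\<close> off the space, so that equality in the carrier is
  equality of functions on the space. The space may be empty, giving the zero algebra; the
  inserted \<open>0\<close> makes the supremum meaningful in this case and is otherwise harmless.\<close>

definition C_mat :: "'x topology \<Rightarrow> nat \<Rightarrow> ('x \<Rightarrow> complex Matrix.mat) cstar_alg" where
  "C_mat X n =
     \<lparr>carrier = {f \<in> extensional (topspace X).
        (\<forall>x\<in>topspace X. f x \<in> carrier_mat n n) \<and>
        (\<forall>i<n. \<forall>j<n. continuous_map X euclidean (\<lambda>x. index_mat (f x) (i, j)))},
      cadd = (\<lambda>f g. \<lambda>x\<in>topspace X. f x + g x),
      czero = (\<lambda>x\<in>topspace X. 0\<^sub>m n n),
      cscale = (\<lambda>c f. \<lambda>x\<in>topspace X. c \<cdot>\<^sub>m f x),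
      cmult = (\<lambda>f g. \<lambda>x\<in>topspace X. f x * g x),
      cstar = (\<lambda>f. \<lambda>x\<in>topspace X. mat_adjoint (f x)),
      cnorm = (\<lambda>f. Sup (insert 0 ((\<lambda>x. op_norm (f x)) ` topspace X)))\<rparr>"


section \<open>Covering dimension\<close>

definition covering_dim_le :: "'x topology \<Rightarrow> int \<Rightarrow> bool" where
  "covering_dim_le X d \<longleftrightarrow>
     (\<forall>\<U>. finite \<U> \<and> (\<forall>U\<in>\<U>. openin X U) \<and> \<Union>\<U> = topspace X \<longrightarrow>
        (\<exists>\<V>. finite \<V> \<and> (\<forall>V\<in>\<V>. openin X V) \<and> \<Union>\<V> = topspace X \<and>
             (\<forall>V\<in>\<V>. \<exists>U\<in>\<U>. V \<subseteq> U) \<and>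
             (\<forall>x\<in>topspace X. int (card {V\<in>\<V>. x \<in> V}) \<le> d + 1)))"

text \<open>The value is $-1$ for the empty space and $\infty$ if no bound holds.\<close>

definition covering_dim :: "'x topology \<Rightarrow> ereal" where
  "covering_dim X = Inf {ereal (real_of_int d) | d. -1 \<le> d \<and> covering_dim_le X d}"


section \<open>Recursive subhomogeneous decompositions\<close>

text \<open>For \<open>k \<le> top_index\<close>, \<open>rsh_space k\<close> is $X_k$ and \<open>msize k\<close> is $n(k)$. For
  \<open>1 \<le> k \<le> top_index\<close>, \<open>bdry k\<close> is $X_k^{(0)}$ and \<open>glue k\<close> is the homomorphism
  $R^{(k-1)} \to C_k^{(0)}$; these two fields are not used for \<open>k = 0\<close>. Having all spaces live in
  one type \<open>'x\<close> is no restriction, as finitely many spaces embed in a sum type.\<close>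

record 'x rsh_decomp =
  top_index :: nat
  rsh_space :: "nat \<Rightarrow> 'x topology"
  msize :: "nat \<Rightarrow> nat"
  bdry :: "nat \<Rightarrow> 'x set"
  glue :: "nat \<Rightarrow> ('x \<Rightarrow> complex Matrix.mat) list \<Rightarrow> 'x \<Rightarrow> complex Matrix.mat"

text \<open>\<open>rsh_stage D k\<close> is $R^{(k)}$. In order that all stages have the same type, an element
  $(\dots((f_0, f_1), f_2), \dots, f_k)$ of the iterated pullback is represented by the list
  $[f_0, \dots, f_k]$.\<close>

primrec rsh_stage :: "'x rsh_decomp \<Rightarrow> nat \<Rightarrow> ('x \<Rightarrow> complex Matrix.mat) list cstar_alg" where
  "rsh_stage D 0 = transport (\<lambda>f. [f]) (C_mat (rsh_space D 0) (msize D 0))"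
| "rsh_stage D (Suc k) =
     transport (\<lambda>(a, f). a @ [f])
       (pullback (rsh_stage D k) (glue D (Suc k))
          (C_mat (rsh_space D (Suc k)) (msize D (Suc k))) (\<lambda>f. restrict f (bdry D (Suc k))))"

definition valid_rsh_decomp :: "'x rsh_decomp \<Rightarrow> bool" where
  "valid_rsh_decomp D \<longleftrightarrow>
     (\<forall>k\<le>top_index D. compact_space (rsh_space D k) \<and> Hausdorff_space (rsh_space D k) \<and> 1 \<le> msize D k) \<and>
     (\<forall>k. 1 \<le> k \<and> k \<le> top_index D \<longrightarrow>
        closedin (rsh_space D k) (bdry D k) \<and>
        unital_star_hom (rsh_stage D (k - 1))
          (C_mat (subtopology (rsh_space D k) (bdry D k)) (msize D k)) (glue D k))"

definition rsh_decomposition_of :: "'a cstar_alg \<Rightarrow> 'x rsh_decomp \<Rightarrow> bool" where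
  "rsh_decomposition_of A D \<longleftrightarrow>
     cstar_algebra A \<and> valid_rsh_decomp D \<and> (\<exists>h. star_iso A (rsh_stage D (top_index D)) h)"

definition max_matrix_size :: "'x rsh_decomp \<Rightarrow> nat" where
  "max_matrix_size D = Max (msize D ` {..top_index D})"

definition topological_dim :: "'x rsh_decomp \<Rightarrow> ereal" where
  "topological_dim D = Max ((\<lambda>k. covering_dim (rsh_space D k)) ` {..top_index D})"

end

theory Submission
  imports Defs
begin

text \<open>Let \<open>R\<close> be the algebra that the decomposition of \<open>B\<close> describes, with spaces \<open>X\<^sub>0, \<dots>, X\<^sub>l\<close>, and
let \<open>I\<close> be the kernel of \<open>\<rho>\<close>, viewed as an ideal of \<open>R\<close>. The decomposition of the pullback is that of
\<open>A\<close> followed by that of \<open>B\<close>, with the same spaces and matrix sizes, so that the two bounds hold by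
construction; only the closed subsets of the \<open>X\<^sub>k\<close> grow and the gluing maps change. After all of
\<open>A\<close> and the first \<open>m\<close> components of \<open>B\<close>, the stage consists of the pairs \<open>(p, (r\<^sub>0, \<dots>, r\<^sub>m\<^sub>-\<^sub>1))\<close> for
which some completion \<open>r\<close> in \<open>R\<close> has \<open>\<phi>(p) = \<rho>(r)\<close>. For \<open>m = 0\<close> this is \<open>A\<close>, because \<open>\<rho>\<close> is
surjective. The next components \<open>r\<^sub>m\<close> compatible with a given pair form a coset of
\<open>K\<^sub>m = {q\<^sub>m | q \<in> I, q\<^sub>0 = \<dots> = q\<^sub>m\<^sub>-\<^sub>1 = 0}\<close>. Hence this step is a pullback along the restriction to a
closed set \<open>Y\<^sub>m\<close> precisely if \<open>K\<^sub>m\<close> consists of all functions that vanish on \<open>Y\<^sub>m\<close>, and then the gluing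
map sends the pair to the restriction of \<open>r\<^sub>m\<close> to \<open>Y\<^sub>m\<close>.

Let \<open>Z\<^sub>k\<close> be the set of common zeros in \<open>X\<^sub>k\<close> of the \<open>k\<close>-th components of \<open>I\<close>. The set
\<open>Y\<^sub>k = X\<^sub>k\<^sup>(\<^sup>0\<^sup>) \<union> Z\<^sub>k\<close> has the required property (theorems \<open>ideal_extension\<close> and \<open>ideal_vanishes\<close>). The
difficulty is that an approximation of \<open>f\<close> by elements of \<open>K\<^sub>k\<close> says nothing about the components
after the \<open>k\<close>-th, so that \<open>K\<^sub>k\<close> is not visibly closed. The way around it is a description of the whole
ideal. First, any element of an intermediate stage whose components vanish on the \<open>Z\<^sub>i\<close> is a limit of
truncations of elements of \<open>I\<close> (\<open>hull_kernel_approximation\<close>). In the last stage, where \<open>I\<close> is closed,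
this says that \<open>I\<close> is the set of all elements that vanish on the \<open>Z\<^sub>i\<close>. Secondly, a function \<open>f\<close>
that vanishes on \<open>Y\<^sub>k\<close> can be completed to an element of this kind, by the Tietze extension theorem
applied to one component after another: what the gluing map prescribes on \<open>X\<^sub>j\<^sup>(\<^sup>0\<^sup>)\<close> vanishes on \<open>Z\<^sub>j\<close>,
because it is a limit of restrictions of components of elements of \<open>I\<close>.

The argument uses continuity of homomorphisms in three places: the kernel is closed, the gluing
maps are continuous, and the pullback is complete. All of this is the contractivity of unital
homomorphisms (\<open>unital_star_hom_contractive\<close>), which follows from the fact that a self-adjoint element
of norm less than \<open>1\<close> is the real part of an isometry. Finally, the two decompositions have
different types of points, and both are carried over to the sum type.\<close>

section \<open>Unital homomorphisms of C*-algebras are contractive\<close>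

context cstar_algebra
begin

abbreviation (input) add (infixl "+." 65) where "x +. y \<equiv> cadd A x y"
abbreviation (input) mul (infixl "*." 70) where "x *. y \<equiv> cmult A x y"
abbreviation (input) scale (infixr "%." 75) where "c %. x \<equiv> cscale A c x"

lemmas closed = add_closed zero_closed scale_closed mult_closed star_closed

lemma zero_add: "x \<in> carrier A \<Longrightarrow> czero A +. x = x"
  by (metis add_commute add_zero zero_closed)

lemma add_left_commute:
  "x \<in> carrier A \<Longrightarrow> y \<in> carrier A \<Longrightarrow> z \<in> carrier A \<Longrightarrow> x +. (y +. z) = y +. (x +. z)"
  by (metis add_assoc add_commute)

lemma scale_0: "x \<in> carrier A \<Longrightarrow> 0 %. x = czero A"
  using scale_add_left[of x 1 "-1"] by (simp add: scale_one add_inverse)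

lemma scale_zero: "c %. czero A = czero A"
  using scale_scale[of "czero A" c 0] by (simp add: scale_0 zero_closed)

lemma mult_zero: "x \<in> carrier A \<Longrightarrow> x *. czero A = czero A"
  by (metis mult_closed mult_scale_right scale_0 zero_closed)

lemma zero_mult: "x \<in> carrier A \<Longrightarrow> czero A *. x = czero A"
  by (metis mult_closed mult_scale_left scale_0 zero_closed)

lemma star_zero: "cstar A (czero A) = czero A"
  using star_scale[of "czero A" 0] by (simp add: scale_0 zero_closed star_closed)

lemma norm_zero: "cnorm A (czero A) = 0"
  by (simp add: norm_eq_zero zero_closed)

lemma add_right_cancel:
  assumes "x \<in> carrier A" "y \<in> carrier A" "z \<in> carrier A" "x +. z = y +. z"
  shows "x = y"
  by (metis add_assoc add_inverse add_zero assms scale_closed)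

lemma add_neg_cancel:
  assumes "x \<in> carrier A" "w \<in> carrier A"
  shows "x +. ((-1) %. x +. w) = w" "(-1) %. x +. (x +. w) = w"
    "(x +. w) +. (-1) %. w = x" "(x +. (-1) %. w) +. w = x"
  using assms
  by (metis add_assoc add_inverse zero_add scale_closed add_commute)+

lemma diff_add_diff:
  assumes "x \<in> carrier A" "y \<in> carrier A" "z \<in> carrier A"
  shows "x +. (-1) %. z = (x +. (-1) %. y) +. (y +. (-1) %. z)"
  using assms by (simp add: add_assoc scale_closed add_closed add_neg_cancel)

lemma norm_star:
  assumes "x \<in> carrier A"
  shows "cnorm A (cstar A x) = cnorm A x"
proof -
  have le: "cnorm A y \<le> cnorm A (cstar A y)" if y: "y \<in> carrier A" for y
  proof (cases "cnorm A y = 0")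
    case False
    have "(cnorm A y)\<^sup>2 \<le> cnorm A (cstar A y) * cnorm A y"
      using norm_mult[OF star_closed[OF y] y] by (simp add: cstar_identity y)
    then show ?thesis
      using False norm_nonneg[OF y] by (simp add: power2_eq_square)
  qed (use norm_nonneg star_closed y in auto)
  show ?thesis
    using le[OF assms] le[OF star_closed[OF assms]] by (simp add: star_star assms)
qed

lemma cdist_commute:
  assumes "x \<in> carrier A" "y \<in> carrier A"
  shows "cdist A x y = cdist A y x"
proof -
  have "y +. (-1) %. x = (-1) %. (x +. (-1) %. y)"
    using assms by (simp add: scale_add_right closed scale_scale scale_one add_commute)
  then show ?thesis
    unfolding cdist_def using assms by (simp add: norm_scale closed)
qed

lemma cdist_eq_0_iff:
  assumes "x \<in> carrier A" "y \<in> carrier A"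
  shows "cdist A x y = 0 \<longleftrightarrow> x = y"
  unfolding cdist_def using assms
  by (metis add_closed add_inverse add_right_cancel norm_eq_zero scale_closed)

lemma cdist_triangle:
  assumes "x \<in> carrier A" "y \<in> carrier A" "z \<in> carrier A"
  shows "cdist A x z \<le> cdist A x y + cdist A y z"
  unfolding cdist_def using assms diff_add_diff[OF assms]
  by (metis add_closed norm_triangle scale_closed)

lemma cdist_nonneg: "x \<in> carrier A \<Longrightarrow> y \<in> carrier A \<Longrightarrow> 0 \<le> cdist A x y"
  by (simp add: cdist_def norm_nonneg closed)

lemma norm_diff_le:
  assumes "x \<in> carrier A" "y \<in> carrier A"
  shows "cnorm A x \<le> cdist A x y + cnorm A y"
  unfolding cdist_def using assms norm_triangle[of "x +. (-1) %. y" y]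
  by (simp add: closed add_neg_cancel)

lemma limit_unique:
  assumes "\<And>n. s n \<in> carrier A" "x \<in> carrier A" "y \<in> carrier A"
    and "(\<lambda>n::nat. cdist A (s n) x) \<longlonglongrightarrow> 0" "(\<lambda>n. cdist A (s n) y) \<longlonglongrightarrow> 0"
  shows "x = y"
proof -
  have "(\<lambda>n. cdist A (s n) x + cdist A (s n) y) \<longlonglongrightarrow> 0 + 0"
    by (intro tendsto_add assms)
  moreover have "cdist A x y \<le> cdist A (s n) x + cdist A (s n) y" for n
    using cdist_triangle[of x "s n" y] cdist_commute[of x "s n"] assms by simp
  ultimately have "cdist A x y \<le> 0 + 0"
    by (intro LIMSEQ_le_const) auto
  then show ?thesis
    using cdist_eq_0_iff[of x y] cdist_nonneg[of x y] assms by simp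
qed

lemma geometric_sequence_converges:
  assumes s: "\<And>n. s n \<in> carrier A" and q: "0 \<le> q" "q < 1"
    and step: "\<And>n. cdist A (s (Suc n)) (s n) \<le> q ^ n"
  shows "\<exists>x\<in>carrier A. (\<lambda>n. cdist A (s n) x) \<longlonglongrightarrow> 0"
proof (rule complete[OF s])
  have bound: "cdist A (s (n + k)) (s n) \<le> (q ^ n - q ^ (n + k)) / (1 - q)" for n k
  proof (induction k)
    case 0
    have "cdist A (s n) (s n) = 0" using s by (simp add: cdist_eq_0_iff)
    then show ?case by simp
  next
    case (Suc k)
    have "cdist A (s (n + Suc k)) (s n) \<le> q ^ (n + k) + (q ^ n - q ^ (n + k)) / (1 - q)"
      using cdist_triangle[of "s (n + Suc k)" "s (n + k)" "s n"] s step[of "n + k"] Suc by simp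
    also have "\<dots> = (q ^ n - q ^ (n + Suc k)) / (1 - q)"
      using q by (simp add: field_simps)
    finally show ?case .
  qed
  have bound': "cdist A (s m) (s n) \<le> q ^ N / (1 - q)" if "N \<le> n" "n \<le> m" for N m n
  proof -
    have "cdist A (s m) (s n) \<le> (q ^ n - q ^ m) / (1 - q)"
      using bound[of n "m - n"] that by simp
    also have "\<dots> \<le> q ^ N / (1 - q)"
      using q that power_decreasing[of N n q] by (intro divide_right_mono) (auto simp: add_increasing2 diff_le_eq)
    finally show ?thesis .
  qed
  have lim: "(\<lambda>N. q ^ N / (1 - q)) \<longlonglongrightarrow> 0 / (1 - q)"
    by (intro tendsto_divide LIMSEQ_power_zero tendsto_const) (use q in auto)
  show "\<forall>e>0. \<exists>N. \<forall>m\<ge>N. \<forall>n\<ge>N. cdist A (s m) (s n) < e"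
  proof (intro allI impI)
    fix e :: real assume "e > 0"
    then obtain N where N: "q ^ N / (1 - q) < e"
      using order_tendstoD(2)[OF lim, of e] eventually_happens'[OF sequentially_bot] by force
    show "\<exists>N. \<forall>m\<ge>N. \<forall>n\<ge>N. cdist A (s m) (s n) < e"
    proof (intro exI[of _ N] allI impI)
      fix m n assume "m \<ge> N" "n \<ge> N"
      then show "cdist A (s m) (s n) < e"
        using bound'[of N n m] bound'[of N m n] N cdist_commute[OF s s, of m n]
        by (cases "n \<le> m") auto
    qed
  qed
qed

lemma cdist_squares:
  assumes "x \<in> carrier A" "z \<in> carrier A"
  shows "cdist A (x *. x) (z *. z) \<le> (cnorm A x + cnorm A z) * cdist A x z"
proof -
  let ?d = "x +. (-1) %. z"
  have d: "?d \<in> carrier A" using assms by (simp add: closed)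
  have "x *. x +. (-1) %. (z *. z) = x *. ?d +. ?d *. z"
    using assms
    by (simp add: mult_add_right mult_add_left closed mult_scale_right mult_scale_left
        add_assoc add_neg_cancel)
  then have "cdist A (x *. x) (z *. z) \<le> cnorm A (x *. ?d) + cnorm A (?d *. z)"
    unfolding cdist_def using norm_triangle[of "x *. ?d" "?d *. z"] assms d by (simp add: closed)
  also have "\<dots> \<le> cnorm A x * cnorm A ?d + cnorm A ?d * cnorm A z"
    using assms d by (intro add_mono norm_mult)
  finally show ?thesis by (simp add: cdist_def algebra_simps)
qed

text \<open>The equation says that \<open>1 - y\<close> is a square root of \<open>1 - a\<^sup>2\<close>, without mention of an identity. It makes
\<open>y\<close> a fixed point of \<open>y \<mapsto> (a\<^sup>2 + y\<^sup>2) / 2\<close>. This map sends the ball of radius \<open>\<parallel>a\<parallel>\<close> to itself, since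
\<open>\<parallel>a\<parallel>\<^sup>2 \<le> \<parallel>a\<parallel>\<close>, and contracts it by the factor \<open>\<parallel>a\<parallel> < 1\<close>. The iterates that start at \<open>0\<close> are
self-adjoint and commute with \<open>a\<close>, and so does their limit.\<close>

lemma self_adjoint_sqrt_complement:
  assumes a: "a \<in> carrier A" "cstar A a = a" and lt: "cnorm A a < 1"
  shows "\<exists>y\<in>carrier A. cstar A y = y \<and> y *. a = a *. y \<and> y +. y = a *. a +. y *. y"
proof -
  define q where "q = cnorm A a"
  have q: "0 \<le> q" "q < 1" using lt norm_nonneg a by (auto simp: q_def)
  define F where "F y = (1/2) %. (a *. a +. y *. y)" for y
  have F: "F y \<in> carrier A" if "y \<in> carrier A" for y
    using that a by (simp add: F_def closed)
  have F_norm: "cnorm A (F y) \<le> q" if y: "y \<in> carrier A" "cnorm A y \<le> q" for y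
  proof -
    have "cnorm A (a *. a +. y *. y) \<le> q * q + cnorm A y * cnorm A y"
      using norm_triangle[of "a *. a" "y *. y"] norm_mult[of a a] norm_mult[of y y] a y
      by (simp add: closed q_def)
    also have "\<dots> \<le> q * 1 + q * 1"
      using q y norm_nonneg[of y] by (intro add_mono mult_mono) auto
    finally show ?thesis using a y by (simp add: F_def norm_scale closed norm_divide)
  qed
  have F_contr: "cdist A (F x) (F z) \<le> q * cdist A x z"
    if x: "x \<in> carrier A" "cnorm A x \<le> q" and z: "z \<in> carrier A" "cnorm A z \<le> q" for x z
  proof -
    have "F x +. (-1) %. F z = (1/2) %. (x *. x +. (-1) %. (z *. z))"
    proof -
      have "F x +. (-1) %. F z
          = (1/2) %. (a *. a +. x *. x) +. (1/2) %. ((-1) %. (a *. a +. z *. z))"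
        using a x z by (simp add: F_def closed scale_scale)
      also have "\<dots> = (1/2) %. ((a *. a +. x *. x) +. (-1) %. (a *. a +. z *. z))"
        using a x z by (simp add: scale_add_right[symmetric] closed)
      also have "(a *. a +. x *. x) +. (-1) %. (a *. a +. z *. z) = x *. x +. (-1) %. (z *. z)"
        using a x z
        by (simp add: scale_add_right closed add_assoc add_left_commute[of "x *. x" "(-1) %. (a *. a)"]
            add_neg_cancel)
      finally show ?thesis .
    qed
    then have "cdist A (F x) (F z) = cdist A (x *. x) (z *. z) / 2"
      using x z by (simp add: cdist_def norm_scale closed norm_divide)
    also have "\<dots> \<le> (q + q) * cdist A x z / 2"
      using cdist_squares[of x z] x z cdist_nonneg[of x z]
      by (smt (verit, best) divide_right_mono mult_right_mono)
    finally show ?thesis by simp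
  qed
  have F_star: "cstar A (F y) = F y" if "y \<in> carrier A" "cstar A y = y" for y
    using that a by (simp add: F_def star_scale closed star_add star_mult)
  have F_comm: "F y *. a = a *. F y" if y: "y \<in> carrier A" "y *. a = a *. y" for y
  proof -
    have "(y *. y) *. a = a *. (y *. y)"
      using y a by (metis mult_assoc)
    then show ?thesis
      using y a by (simp add: F_def mult_scale_left mult_scale_right closed mult_add_left
          mult_add_right mult_assoc)
  qed
  define s where "s n = (F ^^ n) (czero A)" for n
  have s0: "s 0 = czero A" and sSuc: "s (Suc n) = F (s n)" for n
    by (simp_all add: s_def)
  have inv: "s n \<in> carrier A \<and> cnorm A (s n) \<le> q \<and> cstar A (s n) = s n \<and> s n *. a = a *. s n" for n
    by (induction n)
       (use F F_norm F_star F_comm q a in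
         \<open>auto simp: s0 sSuc zero_closed norm_zero star_zero zero_mult mult_zero\<close>)
  have step: "cdist A (s (Suc n)) (s n) \<le> q ^ n" for n
  proof (induction n)
    case 0
    have "cdist A (s (Suc 0)) (s 0) = cnorm A (s (Suc 0))"
      using inv[of "Suc 0"] by (simp add: cdist_def s0 scale_zero add_zero)
    then show ?case using inv[of "Suc 0"] q by simp
  next
    case (Suc n)
    have "cdist A (s (Suc (Suc n))) (s (Suc n)) \<le> q * cdist A (s (Suc n)) (s n)"
      using F_contr[of "s (Suc n)" "s n"] inv[of n] inv[of "Suc n"] by (simp only: sSuc)
    also have "\<dots> \<le> q * q ^ n" using Suc q by (intro mult_left_mono) auto
    finally show ?case by simp
  qed
  obtain y where y: "y \<in> carrier A" and lim: "(\<lambda>n. cdist A (s n) y) \<longlonglongrightarrow> 0"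
    using geometric_sequence_converges[OF _ q step] inv by blast
  have y_norm: "cnorm A y \<le> q"
  proof -
    have "cnorm A y \<le> cdist A (s n) y + q" for n
      using norm_diff_le[of y "s n"] inv[of n] y cdist_commute[of y "s n"] by simp
    moreover have "(\<lambda>n. cdist A (s n) y + q) \<longlonglongrightarrow> 0 + q"
      by (intro tendsto_add lim tendsto_const)
    ultimately show ?thesis using LIMSEQ_le_const[of _ "0 + q" "cnorm A y"] by simp
  qed
  have "cstar A y = y"
  proof (rule limit_unique[of s])
    have "cdist A (s n) (cstar A y) = cdist A (s n) y" for n
    proof -
      have "cstar A (s n +. (-1) %. y) = s n +. (-1) %. cstar A y"
        using inv[of n] y by (simp add: star_add star_scale closed)
      then show ?thesis
        using norm_star[of "s n +. (-1) %. y"] inv[of n] y by (simp add: cdist_def closed)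
    qed
    then show "(\<lambda>n. cdist A (s n) (cstar A y)) \<longlonglongrightarrow> 0" using lim by simp
  qed (use inv y lim closed in auto)
  moreover have "y *. a = a *. y"
  proof (rule limit_unique[of "\<lambda>n. s n *. a"])
    have right: "cdist A (s n *. a) (y *. a) \<le> cnorm A a * cdist A (s n) y" for n
    proof -
      have "s n *. a +. (-1) %. (y *. a) = (s n +. (-1) %. y) *. a"
        using inv[of n] y a by (simp add: mult_add_left mult_scale_left closed)
      then show ?thesis
        using norm_mult[of "s n +. (-1) %. y" a] inv[of n] y a
        by (simp add: cdist_def closed mult.commute)
    qed
    have left: "cdist A (s n *. a) (a *. y) \<le> cnorm A a * cdist A (s n) y" for n
    proof -
      have "s n *. a +. (-1) %. (a *. y) = a *. (s n +. (-1) %. y)"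
        using inv[of n] y a by (simp add: mult_add_right mult_scale_right closed)
      then show ?thesis
        using norm_mult[of a "s n +. (-1) %. y"] inv[of n] y a
        by (simp add: cdist_def closed)
    qed
    have up: "(\<lambda>n. cnorm A a * cdist A (s n) y) \<longlonglongrightarrow> 0"
      using tendsto_mult_left[OF lim, of "cnorm A a"] by simp
    show "(\<lambda>n. cdist A (s n *. a) (y *. a)) \<longlonglongrightarrow> 0"
      by (rule tendsto_sandwich[OF _ _ tendsto_const up])
         (use right inv y a closed cdist_nonneg in auto)
    show "(\<lambda>n. cdist A (s n *. a) (a *. y)) \<longlonglongrightarrow> 0"
      by (rule tendsto_sandwich[OF _ _ tendsto_const up])
         (use left inv y a closed cdist_nonneg in auto)
  qed (use inv y a closed in auto)
  moreover have "F y = y"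
  proof (rule limit_unique[of "\<lambda>n. s (Suc n)"])
    have up: "(\<lambda>n. q * cdist A (s n) y) \<longlonglongrightarrow> 0"
      using tendsto_mult_left[OF lim, of q] by simp
    have "cdist A (s (Suc n)) (F y) \<le> q * cdist A (s n) y" for n
      using F_contr[of "s n" y] inv[of n] y y_norm by (simp add: sSuc)
    then show "(\<lambda>n. cdist A (s (Suc n)) (F y)) \<longlonglongrightarrow> 0"
      by (intro tendsto_sandwich[OF _ _ tendsto_const up])
         (use inv y F cdist_nonneg in auto)
    show "(\<lambda>n. cdist A (s (Suc n)) y) \<longlonglongrightarrow> 0"
      using lim by (rule LIMSEQ_Suc)
  qed (use inv y F in auto)
  then have "y +. y = a *. a +. y *. y"
  proof -
    have "F y +. F y = a *. a +. y *. y"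
      using a y by (simp add: F_def scale_add_left[symmetric] closed scale_one)
    then show ?thesis using \<open>F y = y\<close> by simp
  qed
  ultimately show ?thesis using y by blast
qed

lemma identity_norm_le_1:
  assumes "is_identity A e"
  shows "cstar A e = e" "cnorm A e \<le> 1"
proof -
  have e: "e \<in> carrier A" and id: "\<And>x. x \<in> carrier A \<Longrightarrow> e *. x = x \<and> x *. e = x"
    using assms by (auto simp: is_identity_def)
  show st: "cstar A e = e"
    by (metis e id star_closed star_mult star_star)
  have "(cnorm A e)\<^sup>2 = cnorm A e"
    using cstar_identity[OF e] st id[OF e] by simp
  then show "cnorm A e \<le> 1"
    by (metis mult_cancel_right1 power2_eq_square order_refl zero_le_one)
qed

text \<open>The isometry is \<open>u = a + i d\<close>, where \<open>d\<close> is a self-adjoint square root of \<open>1 - a\<^sup>2\<close> that commutes with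
\<open>a\<close>; then \<open>u* u = a\<^sup>2 + d\<^sup>2 = 1\<close>.\<close>

lemma self_adjoint_real_part_of_isometry:
  assumes e: "is_identity A e" and a: "a \<in> carrier A" "cstar A a = a" and lt: "cnorm A a < 1"
  shows "\<exists>u\<in>carrier A. cstar A u *. u = e \<and> u +. cstar A u = 2 %. a"
proof -
  have ec: "e \<in> carrier A" and id: "\<And>x. x \<in> carrier A \<Longrightarrow> e *. x = x \<and> x *. e = x"
    using e by (auto simp: is_identity_def)
  obtain y where y: "y \<in> carrier A" "cstar A y = y" "y *. a = a *. y"
    and sq: "y +. y = a *. a +. y *. y"
    using self_adjoint_sqrt_complement[OF a lt] by blast
  define d where "d = e +. (-1) %. y"
  have d: "d \<in> carrier A" "cstar A d = d" "d *. a = a *. d"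
    using ec y a id identity_norm_le_1(1)[OF e]
    by (simp_all add: d_def closed star_add star_scale mult_add_left mult_add_right
        mult_scale_left mult_scale_right)
  have dd: "a *. a +. d *. d = e"
  proof -
    have "d *. d = (e +. (-1) %. y) +. ((-1) %. y +. y *. y)"
      using ec y id by (simp add: d_def mult_add_left mult_add_right closed mult_scale_left
          mult_scale_right scale_scale scale_one scale_add_right)
    also have "\<dots> = e +. ((-1) %. (y +. y) +. y *. y)"
      using ec y by (simp add: scale_add_right closed add_assoc)
    also have "\<dots> = e +. (-1) %. (a *. a)"
      unfolding sq using ec y a
      by (simp add: scale_add_right closed add_assoc
          add_commute[of "(-1) %. (y *. y)"] add_inverse add_zero)
    finally show ?thesis
      using ec a by (simp add: closed add_commute[of "a *. a"] add_neg_cancel)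
  qed
  define u where "u = a +. \<i> %. d"
  have u: "u \<in> carrier A" using a d by (simp add: u_def closed)
  have ustar: "cstar A u = a +. (- \<i>) %. d"
    using a d by (simp add: u_def star_add star_scale closed)
  have "cstar A u *. u = (a +. (- \<i>) %. d) *. (a +. \<i> %. d)"
    unfolding ustar by (simp only: u_def)
  also have "\<dots> = (a *. a +. (- \<i>) %. (a *. d)) +. (\<i> %. (a *. d) +. d *. d)"
    using a d
    by (simp add: mult_add_left mult_add_right closed mult_scale_left mult_scale_right
        scale_scale scale_one scale_add_right)
  also have "\<dots> = a *. a +. (((- \<i>) %. (a *. d) +. \<i> %. (a *. d)) +. d *. d)"
    using a d by (simp add: closed add_assoc)
  also have "(- \<i>) %. (a *. d) +. \<i> %. (a *. d) = czero A"
    using a d by (simp add: scale_add_left[symmetric] closed scale_0)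
  finally have "cstar A u *. u = e"
    using a d dd by (simp add: zero_add closed)
  moreover have "u +. cstar A u = 2 %. a"
  proof -
    have "u +. cstar A u = (a +. \<i> %. d) +. (a +. (- \<i>) %. d)"
      unfolding ustar by (simp only: u_def)
    also have "\<dots> = (a +. a) +. (\<i> %. d +. (- \<i>) %. d)"
      using a d
      by (simp add: add_assoc closed add_left_commute[of "\<i> %. d" a])
    also have "\<i> %. d +. (- \<i>) %. d = czero A"
      using d by (simp add: scale_add_left[symmetric] scale_0)
    also have "a +. a = 2 %. a"
      using a scale_add_left[of a 1 1] by (simp add: scale_one)
    finally show ?thesis using a by (simp add: closed add_zero)
  qed
  ultimately show ?thesis using u by blast
qed

lemma isometry_norm_le_1:
  assumes e: "is_identity A e" and u: "u \<in> carrier A" "cstar A u *. u = e"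
  shows "cnorm A u \<le> 1"
proof -
  have "(cnorm A u)\<^sup>2 \<le> 1"
    using cstar_identity[OF u(1)] identity_norm_le_1(2)[OF e] u by simp
  then show ?thesis by (simp add: power_le_one_iff abs_square_le_1 abs_le_iff)
qed

end

lemma star_homD:
  assumes "star_hom A B h"
  shows "x \<in> carrier A \<Longrightarrow> h x \<in> carrier B"
    "x \<in> carrier A \<Longrightarrow> y \<in> carrier A \<Longrightarrow> h (cadd A x y) = cadd B (h x) (h y)"
    "x \<in> carrier A \<Longrightarrow> h (cscale A c x) = cscale B c (h x)"
    "x \<in> carrier A \<Longrightarrow> y \<in> carrier A \<Longrightarrow> h (cmult A x y) = cmult B (h x) (h y)"
    "x \<in> carrier A \<Longrightarrow> h (cstar A x) = cstar B (h x)"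
  using assms by (auto simp: star_hom_def)

lemma star_hom_zero:
  assumes "cstar_algebra A" "cstar_algebra B" "star_hom A B h"
  shows "h (czero A) = czero B"
  using star_homD(1,3)[OF assms(3)] cstar_algebra.scale_0[OF assms(1)]
    cstar_algebra.scale_0[OF assms(2)] cstar_algebra.zero_closed[OF assms(1)]
  by metis

text \<open>A unital homomorphism maps isometries to isometries, which have norm at most \<open>1\<close> by the
C*-identity. So it maps real parts of isometries, and with them all self-adjoint elements of norm less than
\<open>1\<close>, into the unit ball. Scaling gives the claim for self-adjoint elements, and the C*-identity
reduces \<open>x\<close> to the self-adjoint element \<open>x* x\<close>.\<close>

theorem unital_star_hom_contractive:
  assumes A: "cstar_algebra A" and B: "cstar_algebra B" and h: "unital_star_hom A B h"
    and x: "x \<in> carrier A"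
  shows "cnorm B (h x) \<le> cnorm A x"
proof -
  interpret A: cstar_algebra A by (rule A)
  interpret B: cstar_algebra B by (rule B)
  obtain e where e: "is_identity A e" "is_identity B (h e)" and hom: "star_hom A B h"
    using h by (auto simp: unital_star_hom_def)
  note hom = star_homD[OF hom]
  have ball: "cnorm B (h a) \<le> 1" if a: "a \<in> carrier A" "cstar A a = a" "cnorm A a < 1" for a
  proof -
    obtain u where u: "u \<in> carrier A" "cmult A (cstar A u) u = e"
      "cadd A u (cstar A u) = cscale A 2 a"
      using A.self_adjoint_real_part_of_isometry[OF e(1) a] by blast
    have "cmult B (cstar B (h u)) (h u) = h e"
      using u hom(4)[of "cstar A u" u] hom(5)[of u] A.star_closed by simp
    then have le: "cnorm B (h u) \<le> 1"
      using B.isometry_norm_le_1[OF e(2)] hom(1) u by blast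
    have "cscale B 2 (h a) = cadd B (h u) (cstar B (h u))"
      using u a hom(2)[of u "cstar A u"] hom(5)[of u] hom(3)[of a 2] A.star_closed by simp
    then have "2 * cnorm B (h a) \<le> cnorm B (h u) + cnorm B (cstar B (h u))"
      using B.norm_triangle[of "h u" "cstar B (h u)"] B.norm_scale[of "h a" 2] hom(1) u a B.star_closed
      by simp
    then show ?thesis using le B.norm_star[of "h u"] hom(1) u by simp
  qed
  have sa: "cnorm B (h a) \<le> cnorm A a" if a: "a \<in> carrier A" "cstar A a = a" for a
  proof (rule field_le_epsilon)
    fix \<epsilon> :: real assume "\<epsilon> > 0"
    \<comment> \<open>Dividing by the norm itself would give norm \<open>1\<close>, which is not covered by \<open>ball\<close>.\<close>
    define r where "r = cnorm A a + \<epsilon>"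
    have r: "r > 0" "cnorm A a < r" using A.norm_nonneg[OF a(1)] \<open>\<epsilon> > 0\<close> by (auto simp: r_def)
    let ?b = "cscale A (complex_of_real (1 / r)) a"
    have "cnorm B (h ?b) \<le> 1"
      by (rule ball) (use a r in \<open>auto simp: A.scale_closed A.star_scale A.norm_scale norm_divide\<close>)
    moreover have "cnorm B (h ?b) = cnorm B (h a) / r"
      using r a by (simp add: hom B.norm_scale norm_divide)
    ultimately show "cnorm B (h a) \<le> cnorm A a + \<epsilon>"
      using r by (simp add: divide_le_eq r_def)
  qed
  have "(cnorm B (h x))\<^sup>2 = cnorm B (h (cmult A (cstar A x) x))"
    using x by (simp add: hom A.star_closed B.cstar_identity)
  also have "\<dots> \<le> cnorm A (cmult A (cstar A x) x)"
    using x by (intro sa) (simp_all add: A.closed A.star_mult A.star_star)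
  also have "\<dots> = (cnorm A x)\<^sup>2"
    using x by (rule A.cstar_identity)
  finally show ?thesis
    using A.norm_nonneg[OF x] by (rule power2_le_imp_le)
qed

lemma star_hom_diff:
  assumes "cstar_algebra A" "star_hom A B h" "x \<in> carrier A" "y \<in> carrier A"
  shows "h (cadd A x (cscale A (-1) y)) = cadd B (h x) (cscale B (-1) (h y))"
  using assms by (simp add: star_homD[OF assms(2)] cstar_algebra.scale_closed)

lemma unital_star_hom_cdist_le:
  assumes A: "cstar_algebra A" and B: "cstar_algebra B" and h: "unital_star_hom A B h"
    and x: "x \<in> carrier A" and y: "y \<in> carrier A"
  shows "cdist B (h x) (h y) \<le> cdist A x y"
proof -
  have hom: "star_hom A B h" using h by (simp add: unital_star_hom_def)
  have "cadd A x (cscale A (-1) y) \<in> carrier A"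
    using A x y by (simp add: cstar_algebra.closed)
  from unital_star_hom_contractive[OF A B h this] show ?thesis
    by (simp add: cdist_def star_hom_diff[OF A hom x y])
qed

lemma identity_unique:
  assumes "is_identity A e" "is_identity A e'"
  shows "e = e'"
  using assms unfolding is_identity_def by metis

lemma unital_star_hom_identity:
  assumes "unital_star_hom A B h" "is_identity A e"
  shows "is_identity B (h e)"
  using assms identity_unique unfolding unital_star_hom_def by metis

lemma surjective_star_hom_identity:
  assumes h: "star_hom A B h" and surj: "h ` carrier A = carrier B" and e: "is_identity A e"
  shows "is_identity B (h e)"
  unfolding is_identity_def
proof (intro conjI ballI)
  show "h e \<in> carrier B" using e star_homD(1)[OF h] by (simp add: is_identity_def)
  fix y assume "y \<in> carrier B"
  then obtain x where x: "x \<in> carrier A" "y = h x" using surj by blast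
  then show "cmult B (h e) y = y" "cmult B y (h e) = y"
    using e star_homD(4)[OF h, symmetric] by (auto simp: is_identity_def)
qed

lemma star_hom_compose:
  assumes f: "star_hom A B f" and g: "star_hom B C g"
  shows "star_hom A C (\<lambda>x. g (f x))"
  using assms by (simp add: star_hom_def)

lemma star_iso_inverse:
  assumes A: "cstar_algebra A" and h: "star_iso A B h"
  shows "star_hom B A (inv_into (carrier A) h)" "inv_into (carrier A) h ` carrier B = carrier A"
proof -
  let ?k = "inv_into (carrier A) h"
  have hom: "star_hom A B h" and bij: "bij_betw h (carrier A) (carrier B)"
    using h by (auto simp: star_iso_def)
  interpret cstar_algebra A by (rule A)
  have k: "?k y \<in> carrier A" "h (?k y) = y" if "y \<in> carrier B" for y
    using that bij by (auto simp: bij_betw_def f_inv_into_f inv_into_into)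
  have kh: "?k (h x) = x" if "x \<in> carrier A" for x
    using that bij by (simp add: bij_betw_def inv_into_f_f)
  show "?k ` carrier B = carrier A"
    using bij by (simp add: bij_betw_inv_into bij_betw_imp_surj_on)
  show "star_hom B A ?k"
    unfolding star_hom_def
  proof (intro conjI ballI allI)
    fix x y assume "x \<in> carrier B" "y \<in> carrier B"
    then obtain a b where ab: "a \<in> carrier A" "b \<in> carrier A" "x = h a" "y = h b"
      using k by metis
    show "?k (cadd B x y) = cadd A (?k x) (?k y)"
      using ab by (simp add: kh star_homD(2)[OF hom, symmetric] closed)
    show "?k (cmult B x y) = cmult A (?k x) (?k y)"
      using ab by (simp add: kh star_homD(4)[OF hom, symmetric] closed)
  next
    fix x assume "x \<in> carrier B"
    then obtain a where a: "a \<in> carrier A" "x = h a" using k by metis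
    show "?k (cscale B c x) = cscale A c (?k x)" for c
      using a by (simp add: kh star_homD(3)[OF hom, symmetric] closed)
    show "?k (cstar B x) = cstar A (?k x)"
      using a by (simp add: kh star_homD(5)[OF hom, symmetric] closed)
  qed (rule k)
qed

section \<open>The operator norm on $M_n$\<close>

lemma l2_vec_norm_L2_set: "l2_vec_norm v = L2_set (\<lambda>i. cmod (vec_index v i)) {..<dim_vec v}"
  by (simp add: l2_vec_norm_def L2_set_def)

lemma l2_vec_norm_nonneg: "0 \<le> l2_vec_norm v"
  by (simp add: l2_vec_norm_L2_set)

lemma l2_vec_norm_eq_0:
  assumes "v \<in> carrier_vec n" "l2_vec_norm v = 0"
  shows "v = 0\<^sub>v n"
  using assms by (auto simp: l2_vec_norm_L2_set L2_set_eq_0_iff)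

lemma l2_vec_norm_zero: "l2_vec_norm (0\<^sub>v n) = 0"
  by (simp add: l2_vec_norm_def)

lemma l2_vec_norm_smult: "l2_vec_norm (c \<cdot>\<^sub>v v) = cmod c * l2_vec_norm v"
  by (auto simp: l2_vec_norm_L2_set L2_set_right_distrib norm_mult intro!: L2_set_cong)

lemma l2_vec_norm_add:
  assumes "v \<in> carrier_vec n" "w \<in> carrier_vec n"
  shows "l2_vec_norm (v + w) \<le> l2_vec_norm v + l2_vec_norm w"
proof -
  have "l2_vec_norm (v + w) \<le> L2_set (\<lambda>i. cmod (vec_index v i) + cmod (vec_index w i)) {..<n}"
    using assms by (auto simp: l2_vec_norm_L2_set norm_triangle_ineq intro!: L2_set_mono)
  also have "\<dots> \<le> l2_vec_norm v + l2_vec_norm w"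
    using assms L2_set_triangle_ineq by (auto simp: l2_vec_norm_L2_set)
  finally show ?thesis .
qed

lemma l2_vec_norm_square:
  assumes "v \<in> carrier_vec n"
  shows "complex_of_real ((l2_vec_norm v)\<^sup>2) = (\<Sum>i<n. cnj (vec_index v i) * vec_index v i)"
proof -
  have "(l2_vec_norm v)\<^sup>2 = (\<Sum>i<n. (cmod (vec_index v i))\<^sup>2)"
    using assms by (simp add: l2_vec_norm_def sum_nonneg)
  then show ?thesis
    by (simp only: of_real_sum complex_norm_square mult.commute)
qed

lemma entry_le_l2_vec_norm:
  assumes "v \<in> carrier_vec n" "i < n"
  shows "cmod (vec_index v i) \<le> l2_vec_norm v"
  using assms member_le_L2_set[of "{..<n}" i "\<lambda>i. cmod (vec_index v i)"]
  by (simp add: l2_vec_norm_L2_set)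

lemma l2_vec_norm_le_sum:
  assumes "v \<in> carrier_vec n"
  shows "l2_vec_norm v \<le> (\<Sum>i<n. cmod (vec_index v i))"
  using assms L2_set_le_sum[of "{..<n}" "\<lambda>i. cmod (vec_index v i)"]
  by (simp add: l2_vec_norm_L2_set)

lemma index_mult_mat_vec_sum:
  assumes "M \<in> carrier_mat n n" "v \<in> carrier_vec n" "i < n"
  shows "vec_index (M *\<^sub>v v) i = (\<Sum>j<n. index_mat M (i, j) * vec_index v j)"
  using assms by (simp add: scalar_prod_def lessThan_atLeast0)

lemma index_mult_mat_sum:
  assumes "M \<in> carrier_mat n n" "N \<in> carrier_mat n n" "i < n" "j < n"
  shows "index_mat (M * N) (i, j) = (\<Sum>k<n. index_mat M (i, k) * index_mat N (k, j))"
  using assms by (simp add: scalar_prod_def lessThan_atLeast0)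

lemma mat_adjoint_carrier: "M \<in> carrier_mat n n \<Longrightarrow> mat_adjoint M \<in> carrier_mat n n"
  by (auto simp: mat_adjoint_def mat_of_rows_def)

lemma index_mat_adjoint:
  assumes "M \<in> carrier_mat n n" "i < n" "j < n"
  shows "index_mat (mat_adjoint M) (i, j) = cnj (index_mat M (j, i))"
  using assms by (auto simp: mat_adjoint_def mat_of_rows_def)

text \<open>This norm is equivalent to the operator norm, and evidently continuous in the entries. It
replaces the operator norm wherever a norm has to depend continuously on a point of a space.\<close>

definition entry_sum :: "complex Matrix.mat \<Rightarrow> real" where
  "entry_sum M = (\<Sum>i<dim_row M. \<Sum>j<dim_col M. cmod (index_mat M (i, j)))"

lemma entry_sum_nonneg: "0 \<le> entry_sum M"
  by (simp add: entry_sum_def sum_nonneg)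

lemma l2_mult_le_entry_sum:
  assumes M: "M \<in> carrier_mat n n" and v: "v \<in> carrier_vec n"
  shows "l2_vec_norm (M *\<^sub>v v) \<le> entry_sum M * l2_vec_norm v"
proof -
  have "l2_vec_norm (M *\<^sub>v v) \<le> (\<Sum>i<n. cmod (vec_index (M *\<^sub>v v) i))"
    using M v by (intro l2_vec_norm_le_sum) auto
  also have "\<dots> \<le> (\<Sum>i<n. \<Sum>j<n. cmod (index_mat M (i, j)) * l2_vec_norm v)"
  proof (intro sum_mono)
    fix i assume i: "i \<in> {..<n}"
    have "cmod (vec_index (M *\<^sub>v v) i) \<le> (\<Sum>j<n. cmod (index_mat M (i, j) * vec_index v j))"
      using M v i by (simp only: index_mult_mat_vec_sum lessThan_iff norm_sum)
    also have "\<dots> \<le> (\<Sum>j<n. cmod (index_mat M (i, j)) * l2_vec_norm v)"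
      using v by (intro sum_mono) (auto simp: norm_mult intro!: mult_left_mono entry_le_l2_vec_norm)
    finally show "cmod (vec_index (M *\<^sub>v v) i) \<le> (\<Sum>j<n. cmod (index_mat M (i, j)) * l2_vec_norm v)" .
  qed
  also have "\<dots> = entry_sum M * l2_vec_norm v"
    using M by (simp add: entry_sum_def sum_distrib_right)
  finally show ?thesis .
qed

lemma op_norm_set_bdd:
  assumes M: "M \<in> carrier_mat n n"
  shows "bdd_above {l2_vec_norm (M *\<^sub>v v) | v. v \<in> carrier_vec (dim_col M) \<and> l2_vec_norm v \<le> 1}"
proof (rule bdd_aboveI, clarify)
  fix v :: "complex Matrix.vec" assume v: "v \<in> carrier_vec (dim_col M)" "l2_vec_norm v \<le> 1"
  then have "l2_vec_norm (M *\<^sub>v v) \<le> entry_sum M * l2_vec_norm v"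
    using M by (intro l2_mult_le_entry_sum) auto
  also have "\<dots> \<le> entry_sum M * 1"
    using v entry_sum_nonneg by (intro mult_left_mono) auto
  finally show "l2_vec_norm (M *\<^sub>v v) \<le> entry_sum M" by simp
qed

lemma l2_mult_le_op_norm_unit:
  assumes M: "M \<in> carrier_mat n n" and v: "v \<in> carrier_vec n" "l2_vec_norm v \<le> 1"
  shows "l2_vec_norm (M *\<^sub>v v) \<le> op_norm M"
  unfolding op_norm_def using assms
  by (intro cSup_upper op_norm_set_bdd[OF M]) auto

lemma op_norm_nonneg: "M \<in> carrier_mat n n \<Longrightarrow> 0 \<le> op_norm M"
  using l2_mult_le_op_norm_unit[of M n "0\<^sub>v n"] l2_vec_norm_nonneg[of "M *\<^sub>v 0\<^sub>v n"]
  by (simp add: l2_vec_norm_zero)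

lemma op_norm_leI:
  assumes M: "M \<in> carrier_mat n n"
    and le: "\<And>v. v \<in> carrier_vec n \<Longrightarrow> l2_vec_norm v \<le> 1 \<Longrightarrow> l2_vec_norm (M *\<^sub>v v) \<le> c"
  shows "op_norm M \<le> c"
  unfolding op_norm_def
proof (rule cSup_least)
  have "0\<^sub>v n \<in> carrier_vec (dim_col M)" "l2_vec_norm (0\<^sub>v n) \<le> 1"
    using M by (auto simp: l2_vec_norm_zero)
  then show "{l2_vec_norm (M *\<^sub>v v) | v. v \<in> carrier_vec (dim_col M) \<and> l2_vec_norm v \<le> 1} \<noteq> {}"
    by blast
qed (use M le in auto)

lemma l2_mult_le_op_norm:
  assumes M: "M \<in> carrier_mat n n" and v: "v \<in> carrier_vec n"
  shows "l2_vec_norm (M *\<^sub>v v) \<le> op_norm M * l2_vec_norm v"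
proof (cases "l2_vec_norm v = 0")
  case True
  then have "v = 0\<^sub>v n" using v l2_vec_norm_eq_0 by blast
  moreover have "M *\<^sub>v 0\<^sub>v n = 0\<^sub>v n" using M by auto
  ultimately show ?thesis using True by simp
next
  case False
  define r where "r = l2_vec_norm v"
  have r: "r > 0" using False l2_vec_norm_nonneg[of v] by (simp add: r_def)
  have "l2_vec_norm (M *\<^sub>v (complex_of_real (1 / r) \<cdot>\<^sub>v v)) \<le> op_norm M"
    using M v r by (intro l2_mult_le_op_norm_unit) (auto simp: l2_vec_norm_smult norm_divide r_def)
  moreover have "M *\<^sub>v (complex_of_real (1 / r) \<cdot>\<^sub>v v) = complex_of_real (1 / r) \<cdot>\<^sub>v (M *\<^sub>v v)"
    using M v by (simp add: mult_mat_vec)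
  ultimately show ?thesis
    using r by (simp add: l2_vec_norm_smult norm_divide r_def divide_le_eq)
qed

lemma entry_le_op_norm:
  assumes M: "M \<in> carrier_mat n n" and ij: "i < n" "j < n"
  shows "cmod (index_mat M (i, j)) \<le> op_norm M"
proof -
  have u: "unit_vec n j \<in> carrier_vec n" by simp
  have "l2_vec_norm (unit_vec n j) = 1"
  proof -
    have "(\<Sum>k<n. (cmod (vec_index (unit_vec n j) k))\<^sup>2) = (\<Sum>k<n. if k = j then 1 else 0)"
      by (intro sum.cong) (auto simp: unit_vec_def)
    then show ?thesis using ij by (simp add: l2_vec_norm_def)
  qed
  then have "l2_vec_norm (M *\<^sub>v unit_vec n j) \<le> op_norm M"
    using l2_mult_le_op_norm_unit[OF M u] by simp
  moreover have "vec_index (M *\<^sub>v unit_vec n j) i = index_mat M (i, j)"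
    using M ij by (simp add: index_mult_mat_vec)
  moreover have "cmod (vec_index (M *\<^sub>v unit_vec n j) i) \<le> l2_vec_norm (M *\<^sub>v unit_vec n j)"
    using M ij by (intro entry_le_l2_vec_norm) auto
  ultimately show ?thesis by simp
qed

lemma op_norm_le_entry_sum: "M \<in> carrier_mat n n \<Longrightarrow> op_norm M \<le> entry_sum M"
proof (rule op_norm_leI)
  fix v assume M: "M \<in> carrier_mat n n" and v: "v \<in> carrier_vec n" "l2_vec_norm v \<le> 1"
  show "l2_vec_norm (M *\<^sub>v v) \<le> entry_sum M"
    using l2_mult_le_entry_sum[OF M v(1)] mult_left_mono[OF v(2) entry_sum_nonneg[of M]] by simp
qed

lemma entry_sum_le_op_norm:
  assumes "M \<in> carrier_mat n n"
  shows "entry_sum M \<le> real (n * n) * op_norm M"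
proof -
  have "entry_sum M \<le> (\<Sum>i<n. \<Sum>j<n. op_norm M)"
    using assms unfolding entry_sum_def
    by (simp only: carrier_matD) (intro sum_mono entry_le_op_norm, auto)
  then show ?thesis by simp
qed

lemma op_norm_eq_0:
  assumes M: "M \<in> carrier_mat n n"
  shows "op_norm M = 0 \<longleftrightarrow> M = 0\<^sub>m n n"
proof
  assume "op_norm M = 0"
  then have "cmod (index_mat M (i, j)) \<le> 0" if "i < n" "j < n" for i j
    using entry_le_op_norm[OF M that] by simp
  then show "M = 0\<^sub>m n n" using M by (intro eq_matI) auto
next
  assume "M = 0\<^sub>m n n"
  then have "entry_sum M = 0" by (simp add: entry_sum_def)
  then show "op_norm M = 0" using op_norm_le_entry_sum[OF M] op_norm_nonneg[OF M] by simp
qed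

lemma op_norm_add:
  assumes M: "M \<in> carrier_mat n n" and N: "N \<in> carrier_mat n n"
  shows "op_norm (M + N) \<le> op_norm M + op_norm N"
proof (rule op_norm_leI)
  fix v assume v: "v \<in> carrier_vec n" "l2_vec_norm v \<le> 1"
  have "l2_vec_norm ((M + N) *\<^sub>v v) \<le> l2_vec_norm (M *\<^sub>v v) + l2_vec_norm (N *\<^sub>v v)"
    using M N v by (subst add_mult_distrib_mat_vec[of _ n n]) (auto intro!: l2_vec_norm_add[of _ n])
  also have "\<dots> \<le> op_norm M + op_norm N"
    using M N v by (intro add_mono l2_mult_le_op_norm_unit)
  finally show "l2_vec_norm ((M + N) *\<^sub>v v) \<le> op_norm M + op_norm N" .
qed (use M N in auto)

lemma op_norm_smult_le:
  assumes M: "M \<in> carrier_mat n n"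
  shows "op_norm (c \<cdot>\<^sub>m M) \<le> cmod c * op_norm M"
proof (rule op_norm_leI)
  fix v assume v: "v \<in> carrier_vec n" "l2_vec_norm v \<le> 1"
  have "(c \<cdot>\<^sub>m M) *\<^sub>v v = c \<cdot>\<^sub>v (M *\<^sub>v v)"
    using M v by (intro eq_vecI) auto
  then show "l2_vec_norm ((c \<cdot>\<^sub>m M) *\<^sub>v v) \<le> cmod c * op_norm M"
    using l2_mult_le_op_norm_unit[OF M v] by (simp add: l2_vec_norm_smult mult_left_mono)
qed (use M in auto)

lemma op_norm_mult:
  assumes M: "M \<in> carrier_mat n n" and N: "N \<in> carrier_mat n n"
  shows "op_norm (M * N) \<le> op_norm M * op_norm N"
proof (rule op_norm_leI)
  fix v assume v: "v \<in> carrier_vec n" "l2_vec_norm v \<le> 1"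
  have "l2_vec_norm ((M * N) *\<^sub>v v) \<le> op_norm M * l2_vec_norm (N *\<^sub>v v)"
    using M N v by (subst assoc_mult_mat_vec[of _ n n]) (auto intro!: l2_mult_le_op_norm)
  also have "\<dots> \<le> op_norm M * op_norm N"
    using M N v op_norm_nonneg by (intro mult_left_mono l2_mult_le_op_norm_unit)
  finally show "l2_vec_norm ((M * N) *\<^sub>v v) \<le> op_norm M * op_norm N" .
qed (use M N in auto)

text \<open>This is the Cauchy-Schwarz inequality for \<open>\<langle>M v, M v\<rangle> = \<langle>v, M* M v\<rangle>\<close>.\<close>

lemma l2_mult_square_le:
  assumes M: "M \<in> carrier_mat n n" and v: "v \<in> carrier_vec n"
  shows "(l2_vec_norm (M *\<^sub>v v))\<^sup>2 \<le> l2_vec_norm v * l2_vec_norm ((mat_adjoint M * M) *\<^sub>v v)"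
proof -
  let ?w = "M *\<^sub>v v" and ?z = "(mat_adjoint M * M) *\<^sub>v v"
  have w: "?w \<in> carrier_vec n" using M v by auto
  note Ma = mat_adjoint_carrier[OF M]
  have z: "vec_index ?z j = (\<Sum>i<n. cnj (index_mat M (i, j)) * vec_index ?w i)" if "j < n" for j
  proof -
    have "?z = mat_adjoint M *\<^sub>v ?w"
      using Ma M v by (rule assoc_mult_mat_vec)
    then have "vec_index ?z j = (\<Sum>i<n. index_mat (mat_adjoint M) (j, i) * vec_index ?w i)"
      using index_mult_mat_vec_sum[OF Ma w that] by simp
    then show ?thesis using M that by (simp add: index_mat_adjoint)
  qed
  have "complex_of_real ((l2_vec_norm ?w)\<^sup>2) = (\<Sum>i<n. cnj (vec_index ?w i) * vec_index ?w i)"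
    by (rule l2_vec_norm_square[OF w])
  also have "\<dots> = (\<Sum>i<n. (\<Sum>j<n. cnj (index_mat M (i, j)) * cnj (vec_index v j)) * vec_index ?w i)"
    using index_mult_mat_vec_sum[OF M v] by simp
  also have "\<dots> = (\<Sum>j<n. cnj (vec_index v j) * (\<Sum>i<n. cnj (index_mat M (i, j)) * vec_index ?w i))"
    by (simp add: sum_distrib_left sum_distrib_right mult_ac, subst sum.swap, simp)
  also have "\<dots> = (\<Sum>j<n. cnj (vec_index v j) * vec_index ?z j)"
    by (intro sum.cong) (simp_all add: z)
  finally have "(l2_vec_norm ?w)\<^sup>2 = cmod (\<Sum>j<n. cnj (vec_index v j) * vec_index ?z j)"
    by (metis norm_of_real abs_of_nonneg zero_le_power2)
  also have "\<dots> \<le> (\<Sum>j<n. \<bar>cmod (vec_index v j)\<bar> * \<bar>cmod (vec_index ?z j)\<bar>)"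
    by (rule order_trans[OF norm_sum]) (simp add: norm_mult)
  also have "\<dots> \<le> l2_vec_norm v * l2_vec_norm ?z"
    using v M Ma
      L2_set_mult_ineq[of "\<lambda>j. cmod (vec_index v j)" "\<lambda>j. cmod (vec_index ?z j)" "{..<n}"]
    by (simp add: l2_vec_norm_L2_set)
  finally show ?thesis .
qed

lemma op_norm_square_le:
  assumes M: "M \<in> carrier_mat n n"
  shows "(op_norm M)\<^sup>2 \<le> op_norm (mat_adjoint M * M)"
proof -
  let ?P = "mat_adjoint M * M"
  have P: "?P \<in> carrier_mat n n" using M mat_adjoint_carrier[OF M] by auto
  have "op_norm M \<le> sqrt (op_norm ?P)"
  proof (rule op_norm_leI[OF M])
    fix v assume v: "v \<in> carrier_vec n" "l2_vec_norm v \<le> 1"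
    have "(l2_vec_norm (M *\<^sub>v v))\<^sup>2 \<le> l2_vec_norm v * l2_vec_norm (?P *\<^sub>v v)"
      by (rule l2_mult_square_le[OF M v(1)])
    also have "\<dots> \<le> 1 * op_norm ?P"
      using v l2_vec_norm_nonneg by (intro mult_mono l2_mult_le_op_norm_unit[OF P]) auto
    finally show "l2_vec_norm (M *\<^sub>v v) \<le> sqrt (op_norm ?P)"
      by (simp add: real_le_rsqrt)
  qed
  then have "(op_norm M)\<^sup>2 \<le> (sqrt (op_norm ?P))\<^sup>2"
    using op_norm_nonneg[OF M] by (intro power_mono)
  then show ?thesis using op_norm_nonneg[OF P] by simp
qed

lemma mat_adjoint_adjoint:
  fixes M :: "complex Matrix.mat"
  assumes M: "M \<in> carrier_mat n n"
  shows "mat_adjoint (mat_adjoint M) = M"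
proof (rule eq_matI)
  fix i j assume "i < dim_row M" "j < dim_col M"
  then show "index_mat (mat_adjoint (mat_adjoint M)) (i, j) = index_mat M (i, j)"
    using M by (simp add: index_mat_adjoint[OF mat_adjoint_carrier[OF M]] index_mat_adjoint[OF M])
qed (use M carrier_matD[OF mat_adjoint_carrier[OF mat_adjoint_carrier[OF M]]] in auto)

text \<open>From \<open>\<parallel>N\<parallel>\<^sup>2 \<le> \<parallel>N* N\<parallel> \<le> \<parallel>N*\<parallel> \<parallel>N\<parallel>\<close> one gets \<open>\<parallel>N\<parallel> \<le> \<parallel>N*\<parallel>\<close>. For \<open>N = M*\<close> this is the
estimate that is needed to bound \<open>\<parallel>M* M\<parallel>\<close> by \<open>\<parallel>M\<parallel>\<^sup>2\<close>.\<close>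

lemma op_norm_cstar:
  assumes M: "M \<in> carrier_mat n n"
  shows "op_norm (mat_adjoint M * M) = (op_norm M)\<^sup>2"
proof -
  have le: "op_norm N \<le> op_norm (mat_adjoint N)" if N: "N \<in> carrier_mat n n" for N
  proof (cases "op_norm N = 0")
    case False
    have "(op_norm N)\<^sup>2 \<le> op_norm (mat_adjoint N) * op_norm N"
      using op_norm_square_le[OF N] op_norm_mult[OF mat_adjoint_carrier[OF N] N] by simp
    then show ?thesis
      using False op_norm_nonneg[OF N] by (simp add: power2_eq_square)
  qed (use op_norm_nonneg mat_adjoint_carrier N in auto)
  have "op_norm (mat_adjoint M) \<le> op_norm M"
    using le[OF mat_adjoint_carrier[OF M]] M by (simp add: mat_adjoint_adjoint)
  then have "op_norm (mat_adjoint M * M) \<le> op_norm M * op_norm M"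
    using op_norm_mult[OF mat_adjoint_carrier[OF M] M] op_norm_nonneg[OF M]
    by (meson mult_right_mono order_trans)
  then show ?thesis
    using op_norm_square_le[OF M] by (simp add: power2_eq_square)
qed

section \<open>$C(X, M_n)$ is a C*-algebra\<close>

lemma continuous_map_mult_complex:
  fixes f g :: "'x \<Rightarrow> complex"
  shows "continuous_map X euclidean f \<Longrightarrow> continuous_map X euclidean g \<Longrightarrow>
    continuous_map X euclidean (\<lambda>x. f x * g x)"
  by (simp add: continuous_map_atin tendsto_mult)

lemma continuous_map_cnj:
  "continuous_map X euclidean f \<Longrightarrow> continuous_map X euclidean (\<lambda>x. cnj (f x))"
  by (simp add: continuous_map_atin tendsto_cnj)

lemma C_mat_simps:
  "cadd (C_mat X n) f g = (\<lambda>x\<in>topspace X. f x + g x)"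
  "czero (C_mat X n) = (\<lambda>x\<in>topspace X. 0\<^sub>m n n)"
  "cscale (C_mat X n) c f = (\<lambda>x\<in>topspace X. c \<cdot>\<^sub>m f x)"
  "cmult (C_mat X n) f g = (\<lambda>x\<in>topspace X. f x * g x)"
  "cstar (C_mat X n) f = (\<lambda>x\<in>topspace X. mat_adjoint (f x))"
  by (simp_all add: C_mat_def)

lemma C_mat_apply:
  assumes "x \<in> topspace X"
  shows "cadd (C_mat X n) f g x = f x + g x"
    "czero (C_mat X n) x = 0\<^sub>m n n"
    "cscale (C_mat X n) c f x = c \<cdot>\<^sub>m f x"
    "cmult (C_mat X n) f g x = f x * g x"
    "cstar (C_mat X n) f x = mat_adjoint (f x)"
  using assms by (simp_all add: C_mat_simps)

lemma C_mat_carrierD: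
  assumes "f \<in> carrier (C_mat X n)"
  shows "f \<in> extensional (topspace X)" "x \<in> topspace X \<Longrightarrow> f x \<in> carrier_mat n n"
    "i < n \<Longrightarrow> j < n \<Longrightarrow> continuous_map X euclidean (\<lambda>x. index_mat (f x) (i, j))"
  using assms by (auto simp: C_mat_def)

lemma C_mat_carrier_restrict:
  "restrict f (topspace X) \<in> carrier (C_mat X n) \<longleftrightarrow>
    (\<forall>x\<in>topspace X. f x \<in> carrier_mat n n) \<and>
    (\<forall>i<n. \<forall>j<n. continuous_map X euclidean (\<lambda>x. index_mat (f x) (i, j)))"
proof -
  have "continuous_map X euclidean (\<lambda>x. index_mat (restrict f (topspace X) x) (i, j)) =
        continuous_map X euclidean (\<lambda>x. index_mat (f x) (i, j))" for i j
    by (auto intro: continuous_map_eq)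
  then show ?thesis by (simp add: C_mat_def)
qed

lemma C_mat_eqI:
  assumes "f \<in> carrier (C_mat X n)" "g \<in> carrier (C_mat X n)"
    and "\<And>x. x \<in> topspace X \<Longrightarrow> f x = g x"
  shows "f = g"
  by (rule extensionalityI[OF C_mat_carrierD(1)[OF assms(1)] C_mat_carrierD(1)[OF assms(2)] assms(3)])

lemma continuous_map_index_mult:
  fixes f g :: "'x \<Rightarrow> complex Matrix.mat"
  assumes f: "\<And>x. x \<in> topspace X \<Longrightarrow> f x \<in> carrier_mat n n" "\<And>x. x \<in> topspace X \<Longrightarrow> g x \<in> carrier_mat n n"
    and c: "\<And>i j. i < n \<Longrightarrow> j < n \<Longrightarrow> continuous_map X euclidean (\<lambda>x. index_mat (f x) (i, j))"
      "\<And>i j. i < n \<Longrightarrow> j < n \<Longrightarrow> continuous_map X euclidean (\<lambda>x. index_mat (g x) (i, j))"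
    and ij: "i < n" "j < n"
  shows "continuous_map X euclidean (\<lambda>x. index_mat (f x * g x) (i, j))"
proof (rule continuous_map_eq)
  show "continuous_map X euclidean (\<lambda>x. \<Sum>k<n. index_mat (f x) (i, k) * index_mat (g x) (k, j))"
    using c ij by (intro continuous_map_sum continuous_map_mult_complex) auto
qed (simp only: index_mult_mat_sum[OF f(1) f(2) ij])

lemma C_mat_zero_closed: "czero (C_mat X n) \<in> carrier (C_mat X n)"
  unfolding C_mat_simps C_mat_carrier_restrict by auto

lemma C_mat_closed:
  assumes f: "f \<in> carrier (C_mat X n)" and g: "g \<in> carrier (C_mat X n)"
  shows "cadd (C_mat X n) f g \<in> carrier (C_mat X n)"
    "cscale (C_mat X n) c f \<in> carrier (C_mat X n)"
    "cmult (C_mat X n) f g \<in> carrier (C_mat X n)"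
    "cstar (C_mat X n) f \<in> carrier (C_mat X n)"
proof -
  note fD = C_mat_carrierD(2,3)[OF f] and gD = C_mat_carrierD(2,3)[OF g]
  have cc: "continuous_map X euclidean (\<lambda>x. index_mat (F x) (i, j))"
    if "continuous_map X euclidean G" "\<And>x. x \<in> topspace X \<Longrightarrow> index_mat (F x) (i, j) = G x"
    for F G i j
    using continuous_map_eq[OF that(1)] that(2) by metis
  show "cadd (C_mat X n) f g \<in> carrier (C_mat X n)"
    unfolding C_mat_simps C_mat_carrier_restrict
  proof (intro conjI ballI allI impI)
    fix i j assume ij: "i < n" "j < n"
    show "continuous_map X euclidean (\<lambda>x. index_mat (f x + g x) (i, j))"
      by (rule cc[OF continuous_map_add[OF fD(2)[OF ij] gD(2)[OF ij]]])
         (use ij carrier_matD[OF fD(1)] carrier_matD[OF gD(1)] in simp)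
  qed (use fD gD in auto)
  show "cscale (C_mat X n) c f \<in> carrier (C_mat X n)"
    unfolding C_mat_simps C_mat_carrier_restrict
  proof (intro conjI ballI allI impI)
    fix i j assume ij: "i < n" "j < n"
    have "continuous_map X euclidean (\<lambda>x. c * index_mat (f x) (i, j))"
      by (intro continuous_map_mult_complex fD(2) ij) simp
    then show "continuous_map X euclidean (\<lambda>x. index_mat (c \<cdot>\<^sub>m f x) (i, j))"
      by (rule cc) (use ij carrier_matD[OF fD(1)] in simp)
  qed (use fD in auto)
  show "cmult (C_mat X n) f g \<in> carrier (C_mat X n)"
    unfolding C_mat_simps C_mat_carrier_restrict
  proof (intro conjI ballI allI impI)
    fix i j assume ij: "i < n" "j < n"
    show "continuous_map X euclidean (\<lambda>x. index_mat (f x * g x) (i, j))"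
      by (rule continuous_map_index_mult[OF fD(1) gD(1) fD(2) gD(2) ij])
  qed (use mult_carrier_mat[OF fD(1) gD(1)] in auto)
  show "cstar (C_mat X n) f \<in> carrier (C_mat X n)"
    unfolding C_mat_simps C_mat_carrier_restrict
  proof (intro conjI ballI allI impI)
    fix i j assume ij: "i < n" "j < n"
    show "continuous_map X euclidean (\<lambda>x. index_mat (mat_adjoint (f x)) (i, j))"
      by (rule cc[OF continuous_map_cnj[OF fD(2)[OF ij(2,1)]]])
         (use ij index_mat_adjoint[OF fD(1)] in simp)
  qed (use mat_adjoint_carrier[OF fD(1)] in auto)
qed

lemma cnorm_C_mat_bdd:
  assumes X: "compact_space X" and f: "f \<in> carrier (C_mat X n)"
  shows "bdd_above (insert 0 ((\<lambda>x. op_norm (f x)) ` topspace X))"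
proof -
  note fD = C_mat_carrierD(2,3)[OF f]
  have "continuous_map X euclidean (\<lambda>x. \<Sum>i<n. \<Sum>j<n. cmod (index_mat (f x) (i, j)))"
    using fD by (intro continuous_map_sum continuous_map_norm) auto
  then have "compact ((\<lambda>x. \<Sum>i<n. \<Sum>j<n. cmod (index_mat (f x) (i, j))) ` topspace X)"
    using X image_compactin[of X "topspace X" euclidean] by (simp add: compact_space_def)
  then obtain b where b: "\<And>x. x \<in> topspace X \<Longrightarrow> (\<Sum>i<n. \<Sum>j<n. cmod (index_mat (f x) (i, j))) \<le> b"
    using compact_imp_bounded bounded_imp_bdd_above by (fastforce simp: bdd_above_def)
  have "op_norm (f x) \<le> b" if "x \<in> topspace X" for x
    using op_norm_le_entry_sum[OF fD(1)[OF that]] fD(1)[OF that] b[OF that]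
    by (auto simp: entry_sum_def)
  then show ?thesis by (intro bdd_aboveI[of _ "max b 0"]) (auto simp: le_max_iff_disj)
qed

lemma op_norm_le_cnorm_C_mat:
  assumes X: "compact_space X" and f: "f \<in> carrier (C_mat X n)" and x: "x \<in> topspace X"
  shows "op_norm (f x) \<le> cnorm (C_mat X n) f"
  using cSup_upper[OF _ cnorm_C_mat_bdd[OF X f], of "op_norm (f x)"] x by (simp add: C_mat_def)

lemma cnorm_C_mat_nonneg:
  assumes X: "compact_space X" and f: "f \<in> carrier (C_mat X n)"
  shows "0 \<le> cnorm (C_mat X n) f"
  using cSup_upper[OF _ cnorm_C_mat_bdd[OF X f], of 0] by (simp add: C_mat_def)

lemma cnorm_C_mat_le:
  assumes "0 \<le> c" "\<And>x. x \<in> topspace X \<Longrightarrow> op_norm (f x) \<le> c"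
  shows "cnorm (C_mat X n) f \<le> c"
  unfolding C_mat_def using assms by (auto intro!: cSup_least)


lemma C_mat_norm_scale:
  assumes X: "compact_space X" and f: "f \<in> carrier (C_mat X n)"
  shows "cnorm (C_mat X n) (cscale (C_mat X n) c f) = cmod c * cnorm (C_mat X n) f"
proof -
  let ?C = "C_mat X n"
  have le: "cnorm ?C (cscale ?C c g) \<le> cmod c * cnorm ?C g" if g: "g \<in> carrier ?C" for c g
  proof (rule cnorm_C_mat_le)
    fix x assume x: "x \<in> topspace X"
    have "op_norm (cscale ?C c g x) \<le> cmod c * op_norm (g x)"
      using x op_norm_smult_le[OF C_mat_carrierD(2)[OF g x]] by (simp add: C_mat_simps)
    also have "\<dots> \<le> cmod c * cnorm ?C g"
      using op_norm_le_cnorm_C_mat[OF X g x] by (simp add: mult_left_mono)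
    finally show "op_norm (cscale ?C c g x) \<le> cmod c * cnorm ?C g" .
  qed (simp add: cnorm_C_mat_nonneg[OF X g])
  show ?thesis
  proof (cases "c = 0")
    case True
    then show ?thesis
      using le[OF f, of c] cnorm_C_mat_nonneg[OF X C_mat_closed(2)[OF f f, of c]] by simp
  next
    case False
    have "cscale ?C (1 / c) (cscale ?C c f) = f"
    proof (rule C_mat_eqI[OF C_mat_closed(2)[OF C_mat_closed(2)[OF f f] f] f])
      fix x assume x: "x \<in> topspace X"
      have "(1 / c) \<cdot>\<^sub>m (c \<cdot>\<^sub>m f x) = f x"
        using False C_mat_carrierD(2)[OF f x] by (intro eq_matI) auto
      then show "cscale ?C (1 / c) (cscale ?C c f) x = f x"
        using x by (simp add: C_mat_simps)
    qed
    then have "cnorm ?C f \<le> cmod (1 / c) * cnorm ?C (cscale ?C c f)"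
      using le[OF C_mat_closed(2)[OF f f, of c], of "1 / c"] by simp
    then show ?thesis
      using False le[OF f, of c] by (simp add: norm_divide field_simps)
  qed
qed

lemma C_mat_cstar_identity:
  assumes X: "compact_space X" and f: "f \<in> carrier (C_mat X n)"
  shows "cnorm (C_mat X n) (cmult (C_mat X n) (cstar (C_mat X n) f) f) = (cnorm (C_mat X n) f)\<^sup>2"
proof -
  let ?C = "C_mat X n"
  let ?g = "cmult ?C (cstar ?C f) f"
  have g: "?g \<in> carrier ?C" by (intro C_mat_closed(3,4)[OF _ f] f C_mat_closed(4)[OF f f])
  have pt: "op_norm (?g x) = (op_norm (f x))\<^sup>2" if x: "x \<in> topspace X" for x
    using x op_norm_cstar[OF C_mat_carrierD(2)[OF f x]] by (simp add: C_mat_simps)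
  have "cnorm ?C ?g \<le> (cnorm ?C f)\<^sup>2"
  proof (rule cnorm_C_mat_le)
    fix x assume x: "x \<in> topspace X"
    show "op_norm (?g x) \<le> (cnorm ?C f)\<^sup>2"
      unfolding pt[OF x]
      by (intro power_mono op_norm_le_cnorm_C_mat[OF X f x] op_norm_nonneg[OF C_mat_carrierD(2)[OF f x]])
  qed simp
  moreover have "cnorm ?C f \<le> sqrt (cnorm ?C ?g)"
  proof (rule cnorm_C_mat_le)
    fix x assume x: "x \<in> topspace X"
    show "op_norm (f x) \<le> sqrt (cnorm ?C ?g)"
      using op_norm_le_cnorm_C_mat[OF X g x] pt[OF x] by (simp add: real_le_rsqrt)
  qed (simp add: cnorm_C_mat_nonneg[OF X g])
  then have "(cnorm ?C f)\<^sup>2 \<le> (sqrt (cnorm ?C ?g))\<^sup>2"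
    by (intro power_mono cnorm_C_mat_nonneg[OF X f])
  ultimately show ?thesis
    using cnorm_C_mat_nonneg[OF X g] by simp
qed

text \<open>Operator norms dominate entries, so all entries converge uniformly, and the limits are
continuous. Conversely, uniformly small entries make the operator norm uniformly small.\<close>

lemma C_mat_complete:
  assumes X: "compact_space X" and s: "\<And>k. s k \<in> carrier (C_mat X n)"
    and cauchy: "\<forall>e>0. \<exists>N::nat. \<forall>l\<ge>N. \<forall>m\<ge>N. cdist (C_mat X n) (s l) (s m) < e"
  shows "\<exists>f\<in>carrier (C_mat X n). (\<lambda>k. cdist (C_mat X n) (s k) f) \<longlonglongrightarrow> 0"
proof -
  let ?C = "C_mat X n"
  have diff: "cadd ?C f (cscale ?C (-1) g) \<in> carrier ?C"
    if "f \<in> carrier ?C" "g \<in> carrier ?C" for f g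
    using that by (meson C_mat_closed)
  have diff_entry: "index_mat (cadd ?C f (cscale ?C (-1) g) x) (i, j)
      = index_mat (f x) (i, j) - index_mat (g x) (i, j)"
    if "f \<in> carrier ?C" "g \<in> carrier ?C" "x \<in> topspace X" "i < n" "j < n" for f g x i j
    using that C_mat_carrierD(2)[of f X n x] C_mat_carrierD(2)[of g X n x] by (simp add: C_mat_simps)
  have entry: "cmod (index_mat (s l x) (i, j) - index_mat (s m x) (i, j)) \<le> cdist ?C (s l) (s m)"
    if x: "x \<in> topspace X" and ij: "i < n" "j < n" for l m x i j
    using entry_le_op_norm[OF C_mat_carrierD(2)[OF diff[OF s s] x] ij, of l m]
      op_norm_le_cnorm_C_mat[OF X diff[OF s s] x, of l m] diff_entry[OF s s x ij, of l m]
    by (simp add: cdist_def)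
  define L where "L x i j = lim (\<lambda>k. index_mat (s k x) (i, j))" for x i j
  have L: "(\<lambda>k. index_mat (s k x) (i, j)) \<longlonglongrightarrow> L x i j"
    if x: "x \<in> topspace X" and ij: "i < n" "j < n" for x i j
  proof -
    have "Cauchy (\<lambda>k. index_mat (s k x) (i, j))"
      unfolding Cauchy_def dist_norm using cauchy entry[OF x ij] by (meson order_le_less_trans)
    then show ?thesis
      unfolding L_def by (simp add: Cauchy_convergent_iff convergent_LIMSEQ_iff)
  qed
  have unif: "\<exists>N. \<forall>k\<ge>N. \<forall>x\<in>topspace X. \<forall>i<n. \<forall>j<n. cmod (index_mat (s k x) (i, j) - L x i j) \<le> e"
    if "e > 0" for e :: real
  proof -
    obtain N where N: "\<And>l m. l \<ge> N \<Longrightarrow> m \<ge> N \<Longrightarrow> cdist ?C (s l) (s m) < e"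
      using cauchy \<open>e > 0\<close> by blast
    have "cmod (index_mat (s k x) (i, j) - L x i j) \<le> e"
      if k: "k \<ge> N" and x: "x \<in> topspace X" and ij: "i < n" "j < n" for k x i j
    proof (rule LIMSEQ_le_const2)
      show "(\<lambda>m. cmod (index_mat (s k x) (i, j) - index_mat (s m x) (i, j)))
          \<longlonglongrightarrow> cmod (index_mat (s k x) (i, j) - L x i j)"
        by (intro tendsto_intros L[OF x ij])
      show "\<exists>N. \<forall>m\<ge>N. cmod (index_mat (s k x) (i, j) - index_mat (s m x) (i, j)) \<le> e"
        using N[OF k] entry[OF x ij, of k] by (meson less_imp_le order_trans)
    qed
    then show ?thesis by blast
  qed
  define f where "f = (\<lambda>x\<in>topspace X. Matrix.mat n n (\<lambda>(i, j). L x i j))"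
  have f: "f \<in> carrier ?C"
    unfolding f_def C_mat_carrier_restrict
  proof (intro conjI ballI allI impI)
    fix i j assume ij: "i < n" "j < n"
    have "continuous_map X Met_TC.mtopology (\<lambda>x. L x i j)"
    proof (rule Met_TC.continuous_map_uniform_limit[of X "\<lambda>k x. index_mat (s k x) (i, j)" sequentially])
      show "\<forall>\<^sub>F k in sequentially. continuous_map X Met_TC.mtopology (\<lambda>x. index_mat (s k x) (i, j))"
        using C_mat_carrierD(3)[OF s ij] by simp
      fix e :: real assume "e > 0"
      then obtain N where "\<forall>k\<ge>N. \<forall>x\<in>topspace X. \<forall>i<n. \<forall>j<n. cmod (index_mat (s k x) (i, j) - L x i j) \<le> e / 2"
        using unif[of "e / 2"] by auto
      then have "\<forall>k\<ge>N. \<forall>x\<in>topspace X. L x i j \<in> UNIV \<and> dist (index_mat (s k x) (i, j)) (L x i j) < e"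
        using ij \<open>e > 0\<close> by (fastforce simp: dist_norm)
      then show "\<forall>\<^sub>F k in sequentially. \<forall>x\<in>topspace X. L x i j \<in> UNIV \<and> dist (index_mat (s k x) (i, j)) (L x i j) < e"
        unfolding eventually_sequentially by blast
    qed simp
    then show "continuous_map X euclidean (\<lambda>x. index_mat (Matrix.mat n n (\<lambda>(i, j). L x i j)) (i, j))"
      using ij by simp
  qed auto
  have "(\<lambda>k. cdist ?C (s k) f) \<longlonglongrightarrow> 0"
  proof (rule LIMSEQ_I)
    fix e :: real assume e: "e > 0"
    define e' where "e' = e / (2 * (real (n * n) + 1))"
    have e': "e' > 0" using e by (simp add: e'_def add_nonneg_pos)
    obtain N where N: "\<forall>k\<ge>N. \<forall>x\<in>topspace X. \<forall>i<n. \<forall>j<n. cmod (index_mat (s k x) (i, j) - L x i j) \<le> e'"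
      using unif[OF e'] by blast
    have "norm (cdist ?C (s k) f - 0) < e" if k: "k \<ge> N" for k
    proof -
      have "cnorm ?C (cadd ?C (s k) (cscale ?C (-1) f)) \<le> real (n * n) * e'"
      proof (rule cnorm_C_mat_le)
        fix x assume x: "x \<in> topspace X"
        let ?d = "cadd ?C (s k) (cscale ?C (-1) f) x"
        have d: "?d \<in> carrier_mat n n" by (rule C_mat_carrierD(2)[OF diff[OF s f] x])
        have "entry_sum ?d \<le> (\<Sum>i<n. \<Sum>j<n. e')"
          unfolding entry_sum_def carrier_matD[OF d]
        proof (intro sum_mono)
          fix i j assume ij: "i \<in> {..<n}" "j \<in> {..<n}"
          then show "cmod (index_mat ?d (i, j)) \<le> e'"
            using N k x diff_entry[OF s f x, of i j] by (simp add: f_def)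
        qed
        then show "op_norm ?d \<le> real (n * n) * e'"
          using op_norm_le_entry_sum[OF d] by simp
      qed (use e' in simp)
      also have "\<dots> < e"
        using e by (simp add: e'_def field_simps add_pos_nonneg)
      finally show ?thesis
        using cnorm_C_mat_nonneg[OF X diff[OF s f], of k] by (simp add: cdist_def)
    qed
    then show "\<exists>N. \<forall>k\<ge>N. norm (cdist ?C (s k) f - 0) < e" by blast
  qed
  then show ?thesis using f by blast
qed

theorem cstar_algebra_C_mat:
  assumes X: "compact_space X"
  shows "cstar_algebra (C_mat X n)"
proof -
  let ?C = "C_mat X n"
  note fD = C_mat_carrierD(2)[of _ X n]
  have adj: "mat_adjoint (M + N) = mat_adjoint M + mat_adjoint N"
    "mat_adjoint (M * N) = mat_adjoint N * mat_adjoint M"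
    if M: "M \<in> carrier_mat n n" and N: "N \<in> carrier_mat n n" for M N :: "complex Matrix.mat"
  proof -
    note MN = M N mat_adjoint_carrier[OF M] mat_adjoint_carrier[OF N]
    have P: "M + N \<in> carrier_mat n n" "M * N \<in> carrier_mat n n"
      using M N by auto
    note MN = MN P P[THEN mat_adjoint_carrier]
    note dims = MN[THEN carrier_matD(1)] MN[THEN carrier_matD(2)]
    note idx = index_mat_adjoint[OF M] index_mat_adjoint[OF N] P[THEN index_mat_adjoint]
    show "mat_adjoint (M + N) = mat_adjoint M + mat_adjoint N"
      by (rule eq_matI) (auto simp: dims idx)
    show "mat_adjoint (M * N) = mat_adjoint N * mat_adjoint M"
      by (rule eq_matI)
         (auto simp: dims idx index_mult_mat_sum[OF M N] mult.commute
            index_mult_mat_sum[OF MN(4,3)] simp del: index_mult_mat(1))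
  qed
  have adj_smult: "mat_adjoint (c \<cdot>\<^sub>m M) = cnj c \<cdot>\<^sub>m mat_adjoint M"
    if M: "M \<in> carrier_mat n n" for M :: "complex Matrix.mat" and c
  proof -
    have cM: "c \<cdot>\<^sub>m M \<in> carrier_mat n n" using M by auto
    show ?thesis
      using M mat_adjoint_carrier[OF M, THEN carrier_matD(1)] mat_adjoint_carrier[OF M, THEN carrier_matD(2)]
        mat_adjoint_carrier[OF cM, THEN carrier_matD(1)] mat_adjoint_carrier[OF cM, THEN carrier_matD(2)]
      by (intro eq_matI) (auto simp: index_mat_adjoint[OF M] index_mat_adjoint[OF cM])
  qed
  have scal: "1 \<cdot>\<^sub>m M = M" "c \<cdot>\<^sub>m (d \<cdot>\<^sub>m M) = (c * d) \<cdot>\<^sub>m M"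
    "(c + d) \<cdot>\<^sub>m M = c \<cdot>\<^sub>m M + d \<cdot>\<^sub>m M" for M :: "complex Matrix.mat" and c d
    by (rule eq_matI; auto simp: algebra_simps)+
  have neg: "M + (-1) \<cdot>\<^sub>m M = 0\<^sub>m n n" if "M \<in> carrier_mat n n" for M :: "complex Matrix.mat"
    using that by (intro eq_matI) auto
  note alg = adj adj_smult scal neg assoc_add_mat[of _ n n] right_add_zero_mat[of _ n n]
    add_smult_distrib_left_mat[of _ n n] assoc_mult_mat[of _ n n _ n _ n]
    add_mult_distrib_mat[of _ n n _ _ n] mult_add_distrib_mat[of _ n n _ n]
    mult_smult_distrib[of _ n n _ n] mult_smult_assoc_mat[of _ n n _ n] mat_adjoint_adjoint[of _ n]
  show ?thesis
  proof (unfold_locales)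
    fix s :: "nat \<Rightarrow> 'a \<Rightarrow> complex Matrix.mat"
    assume "\<And>n. s n \<in> carrier ?C" "\<forall>e>0. \<exists>N. \<forall>m\<ge>N. \<forall>n\<ge>N. cdist ?C (s m) (s n) < e"
    then show "\<exists>x\<in>carrier ?C. (\<lambda>n. cdist ?C (s n) x) \<longlonglongrightarrow> 0"
      by (rule C_mat_complete[OF X])
  next
    fix f g assume f: "f \<in> carrier ?C" and g: "g \<in> carrier ?C"
    show "cnorm ?C (cadd ?C f g) \<le> cnorm ?C f + cnorm ?C g"
    proof (rule cnorm_C_mat_le)
      fix x assume x: "x \<in> topspace X"
      show "op_norm (cadd ?C f g x) \<le> cnorm ?C f + cnorm ?C g"
        using op_norm_add[OF fD[OF f x] fD[OF g x]] op_norm_le_cnorm_C_mat[OF X f x]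
          op_norm_le_cnorm_C_mat[OF X g x] x by (simp add: C_mat_simps)
    qed (simp add: cnorm_C_mat_nonneg[OF X] f g)
    show "cnorm ?C (cmult ?C f g) \<le> cnorm ?C f * cnorm ?C g"
    proof (rule cnorm_C_mat_le)
      fix x assume x: "x \<in> topspace X"
      have "op_norm (f x * g x) \<le> op_norm (f x) * op_norm (g x)"
        by (rule op_norm_mult[OF fD[OF f x] fD[OF g x]])
      also have "\<dots> \<le> cnorm ?C f * cnorm ?C g"
        by (intro mult_mono op_norm_le_cnorm_C_mat[OF X _ x] f g op_norm_nonneg[OF fD[OF g x]]
            cnorm_C_mat_nonneg[OF X])
      finally show "op_norm (cmult ?C f g x) \<le> cnorm ?C f * cnorm ?C g"
        using x by (simp add: C_mat_simps)
    qed (simp add: cnorm_C_mat_nonneg[OF X] f g)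
    show "cadd ?C f g = cadd ?C g f"
      by (rule C_mat_eqI[OF C_mat_closed(1)[OF f g] C_mat_closed(1)[OF g f]])
         (simp add: C_mat_simps comm_add_mat[OF fD[OF f] fD[OF g]])
  next
    fix f assume f: "f \<in> carrier ?C"
    show "cnorm ?C f = 0 \<longleftrightarrow> f = czero ?C"
    proof
      assume z: "cnorm ?C f = 0"
      show "f = czero ?C"
      proof (rule C_mat_eqI[OF f C_mat_zero_closed])
        fix x assume x: "x \<in> topspace X"
        then show "f x = czero ?C x"
          using op_norm_le_cnorm_C_mat[OF X f x] op_norm_nonneg[OF fD[OF f x]] z op_norm_eq_0[OF fD[OF f x]]
          by (simp add: C_mat_simps)
      qed
    next
      assume z: "f = czero ?C"
      have "cnorm ?C f \<le> 0"
        using z op_norm_eq_0[of "0\<^sub>m n n" n] by (intro cnorm_C_mat_le) (auto simp: C_mat_simps)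
      then show "cnorm ?C f = 0" using cnorm_C_mat_nonneg[OF X f] by simp
    qed
  qed (auto simp: C_mat_closed C_mat_zero_closed C_mat_norm_scale[OF X] C_mat_cstar_identity[OF X]
         cnorm_C_mat_nonneg[OF X] C_mat_apply alg fD mat_adjoint_carrier
        intro!: C_mat_eqI[of _ X n] C_mat_closed C_mat_zero_closed)
qed

section \<open>Pullbacks and transport of C*-algebras\<close>

lemma pullback_simps:
  "(a, b) \<in> carrier (pullback A \<phi> B \<rho>) \<longleftrightarrow> a \<in> carrier A \<and> b \<in> carrier B \<and> \<phi> a = \<rho> b"
  "cadd (pullback A \<phi> B \<rho>) (a, b) (a', b') = (cadd A a a', cadd B b b')"
  "czero (pullback A \<phi> B \<rho>) = (czero A, czero B)"
  "cscale (pullback A \<phi> B \<rho>) c (a, b) = (cscale A c a, cscale B c b)"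
  "cmult (pullback A \<phi> B \<rho>) (a, b) (a', b') = (cmult A a a', cmult B b b')"
  "cstar (pullback A \<phi> B \<rho>) (a, b) = (cstar A a, cstar B b)"
  "cnorm (pullback A \<phi> B \<rho>) (a, b) = max (cnorm A a) (cnorm B b)"
  by (simp_all add: pullback_def)

text \<open>Only completeness involves the homomorphisms: the limit of a Cauchy sequence satisfies the
defining equation of the pullback because both homomorphisms are continuous.\<close>

theorem cstar_algebra_pullback:
  assumes A: "cstar_algebra A" and B: "cstar_algebra B" and C: "cstar_algebra C"
    and \<phi>: "unital_star_hom A C \<phi>" and \<rho>: "unital_star_hom B C \<rho>"
  shows "cstar_algebra (pullback A \<phi> B \<rho>)"
proof -
  interpret A: cstar_algebra A by (rule A)
  interpret B: cstar_algebra B by (rule B)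
  interpret C: cstar_algebra C by (rule C)
  have hom: "star_hom A C \<phi>" "star_hom B C \<rho>"
    using \<phi> \<rho> by (auto simp: unital_star_hom_def)
  note h = star_homD[OF hom(1)] star_homD[OF hom(2)]
  note z = star_hom_zero[OF A C hom(1)] star_hom_zero[OF B C hom(2)]
  let ?P = "pullback A \<phi> B \<rho>"
  have square: "max (x\<^sup>2) (y\<^sup>2) = (max x y)\<^sup>2" if "0 \<le> x" "0 \<le> y" for x y :: real
    using that by (simp add: max_def)
  have dist: "cdist ?P (a, b) (a', b') = max (cdist A a a') (cdist B b b')" for a b a' b'
    by (simp add: cdist_def pullback_simps)
  show ?thesis
  proof unfold_locales
    fix s :: "nat \<Rightarrow> 'a \<times> 'b"
    assume s: "\<And>n. s n \<in> carrier ?P"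
      and cauchy: "\<forall>e>0. \<exists>N. \<forall>m\<ge>N. \<forall>n\<ge>N. cdist ?P (s m) (s n) < e"
    define u v where "u n = fst (s n)" and "v n = snd (s n)" for n
    have s_eq: "s n = (u n, v n)" for n by (simp add: u_def v_def)
    have uv: "u n \<in> carrier A" "v n \<in> carrier B" "\<phi> (u n) = \<rho> (v n)" for n
      using s[of n] by (auto simp: s_eq pullback_simps)
    have "\<exists>a\<in>carrier A. (\<lambda>n. cdist A (u n) a) \<longlonglongrightarrow> 0"
      using cauchy by (intro A.complete uv) (simp add: s_eq dist, meson)
    then obtain a where a: "a \<in> carrier A" "(\<lambda>n. cdist A (u n) a) \<longlonglongrightarrow> 0" by blast
    have "\<exists>b\<in>carrier B. (\<lambda>n. cdist B (v n) b) \<longlonglongrightarrow> 0"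
      using cauchy by (intro B.complete uv) (simp add: s_eq dist, meson)
    then obtain b where b: "b \<in> carrier B" "(\<lambda>n. cdist B (v n) b) \<longlonglongrightarrow> 0" by blast
    have "\<phi> a = \<rho> b"
    proof (rule C.limit_unique[of "\<lambda>n. \<phi> (u n)"])
      show "(\<lambda>n. cdist C (\<phi> (u n)) (\<phi> a)) \<longlonglongrightarrow> 0"
        by (rule tendsto_sandwich[OF _ _ tendsto_const a(2)])
           (auto intro!: always_eventually C.cdist_nonneg unital_star_hom_cdist_le[OF A C \<phi>] h uv a)
      show "(\<lambda>n. cdist C (\<phi> (u n)) (\<rho> b)) \<longlonglongrightarrow> 0"
        unfolding uv(3)
        by (rule tendsto_sandwich[OF _ _ tendsto_const b(2)])
           (auto intro!: always_eventually C.cdist_nonneg unital_star_hom_cdist_le[OF B C \<rho>] h uv b)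
    qed (use h uv a b in auto)
    moreover have "(\<lambda>n. cdist ?P (s n) (a, b)) \<longlonglongrightarrow> 0"
      using tendsto_max[OF a(2) b(2)] by (simp add: s_eq dist)
    ultimately show "\<exists>x\<in>carrier ?P. (\<lambda>n. cdist ?P (s n) x) \<longlonglongrightarrow> 0"
      using a b by (intro bexI[of _ "(a, b)"]) (auto simp: pullback_simps)
  next
    fix x y assume "x \<in> carrier ?P" "y \<in> carrier ?P"
    then obtain a b a' b' where xy: "x = (a, b)" "y = (a', b')"
      and c: "a \<in> carrier A" "b \<in> carrier B" "a' \<in> carrier A" "b' \<in> carrier B"
      by (cases x; cases y) (auto simp: pullback_simps)
    show "cnorm ?P (cadd ?P x y) \<le> cnorm ?P x + cnorm ?P y"
      using A.norm_triangle[of a a'] B.norm_triangle[of b b'] c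
      by (auto simp: xy pullback_simps max_def)
    have "cnorm A a * cnorm A a' \<le> max (cnorm A a) (cnorm B b) * max (cnorm A a') (cnorm B b')"
      "cnorm B b * cnorm B b' \<le> max (cnorm A a) (cnorm B b) * max (cnorm A a') (cnorm B b')"
      using c by (intro mult_mono; simp add: A.norm_nonneg B.norm_nonneg le_max_iff_disj)+
    then show "cnorm ?P (cmult ?P x y) \<le> cnorm ?P x * cnorm ?P y"
      using A.norm_mult[of a a'] B.norm_mult[of b b'] c
      by (simp add: xy pullback_simps)
  next
    fix x assume "x \<in> carrier ?P"
    then obtain a b where x: "x = (a, b)" and c: "a \<in> carrier A" "b \<in> carrier B"
      by (cases x) (auto simp: pullback_simps)
    show "cnorm ?P (cmult ?P (cstar ?P x) x) = (cnorm ?P x)\<^sup>2"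
      using c by (simp add: x pullback_simps A.cstar_identity B.cstar_identity square
          A.norm_nonneg B.norm_nonneg)
    show "cnorm ?P x = 0 \<longleftrightarrow> x = czero ?P"
      using A.norm_eq_zero[of a] B.norm_eq_zero[of b] A.norm_nonneg[of a] B.norm_nonneg[of b] c
      by (auto simp: x pullback_simps max_def)
    show "0 \<le> cnorm ?P x"
      using A.norm_nonneg[of a] c by (simp add: x pullback_simps le_max_iff_disj)
    show "cnorm ?P (cscale ?P c x) = cmod c * cnorm ?P x" for c
      using c by (simp add: x pullback_simps A.norm_scale B.norm_scale max_mult_distrib_left)
  qed (auto simp: pullback_simps h z A.closed B.closed A.add_assoc B.add_assoc
      A.add_zero B.add_zero A.add_inverse B.add_inverse A.scale_one B.scale_one
      A.scale_scale B.scale_scale A.scale_add_left B.scale_add_left A.scale_add_right B.scale_add_right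
      A.mult_assoc B.mult_assoc A.mult_add_left B.mult_add_left A.mult_add_right B.mult_add_right
      A.mult_scale_left B.mult_scale_left A.mult_scale_right B.mult_scale_right
      A.star_star B.star_star A.star_add B.star_add A.star_scale B.star_scale
      A.star_mult B.star_mult intro: A.add_commute B.add_commute)
qed

lemma transport_simps:
  assumes "inj_on h (carrier A)"
  shows "carrier (transport h A) = h ` carrier A"
    "x \<in> carrier A \<Longrightarrow> y \<in> carrier A \<Longrightarrow> cadd (transport h A) (h x) (h y) = h (cadd A x y)"
    "czero (transport h A) = h (czero A)"
    "x \<in> carrier A \<Longrightarrow> cscale (transport h A) c (h x) = h (cscale A c x)"
    "x \<in> carrier A \<Longrightarrow> y \<in> carrier A \<Longrightarrow> cmult (transport h A) (h x) (h y) = h (cmult A x y)"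
    "x \<in> carrier A \<Longrightarrow> cstar (transport h A) (h x) = h (cstar A x)"
    "x \<in> carrier A \<Longrightarrow> cnorm (transport h A) (h x) = cnorm A x"
  using assms by (simp_all add: transport_def Let_def inv_into_f_f)

lemma cstar_algebra_transport:
  assumes A: "cstar_algebra A" and h: "inj_on h (carrier A)"
  shows "cstar_algebra (transport h A)"
proof -
  interpret A: cstar_algebra A by (rule A)
  let ?T = "transport h A"
  note t = transport_simps[OF h]
  have dist: "cdist ?T (h x) (h y) = cdist A x y" if "x \<in> carrier A" "y \<in> carrier A" for x y
    using that by (simp add: cdist_def t A.closed)
  show ?thesis
  proof unfold_locales
    fix s :: "nat \<Rightarrow> 'b"
    assume s: "\<And>n. s n \<in> carrier ?T"
      and cauchy: "\<forall>e>0. \<exists>N. \<forall>m\<ge>N. \<forall>n\<ge>N. cdist ?T (s m) (s n) < e"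
    have "\<exists>u. \<forall>n. u n \<in> carrier A \<and> s n = h (u n)"
      using s by (intro choice) (auto simp: t)
    then obtain u where u: "\<And>n. u n \<in> carrier A" and s_eq: "\<And>n. s n = h (u n)" by blast
    have "\<exists>a\<in>carrier A. (\<lambda>n. cdist A (u n) a) \<longlonglongrightarrow> 0"
      using cauchy by (intro A.complete u) (simp add: s_eq dist u)
    then obtain a where a: "a \<in> carrier A" "(\<lambda>n. cdist A (u n) a) \<longlonglongrightarrow> 0" by blast
    then show "\<exists>x\<in>carrier ?T. (\<lambda>n. cdist ?T (s n) x) \<longlonglongrightarrow> 0"
      by (intro bexI[of _ "h a"]) (simp_all add: s_eq dist u t)
  next
    fix x assume "x \<in> carrier ?T"
    then obtain a where x: "x = h a" "a \<in> carrier A" by (auto simp: t)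
    show "cnorm ?T x = 0 \<longleftrightarrow> x = czero ?T"
      using x h by (simp add: t A.norm_eq_zero inj_on_eq_iff A.zero_closed)
  qed (auto simp: t A.closed A.add_assoc A.add_zero A.add_inverse A.scale_one A.scale_scale
      A.scale_add_left A.scale_add_right A.mult_assoc A.mult_add_left A.mult_add_right
      A.mult_scale_left A.mult_scale_right A.star_star A.star_add A.star_scale A.star_mult
      A.norm_nonneg A.norm_scale A.norm_mult A.norm_triangle A.cstar_identity
      A.add_commute A.add_left_commute)
qed

section \<open>The stages of a decomposition\<close>

abbreviation block :: "'x rsh_decomp \<Rightarrow> nat \<Rightarrow> ('x \<Rightarrow> complex Matrix.mat) cstar_alg" where
  "block D k \<equiv> C_mat (rsh_space D k) (msize D k)"

abbreviation bdry_block :: "'x rsh_decomp \<Rightarrow> nat \<Rightarrow> ('x \<Rightarrow> complex Matrix.mat) cstar_alg" where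
  "bdry_block D k \<equiv> C_mat (subtopology (rsh_space D k) (bdry D k)) (msize D k)"

lemma inj_append_singleton: "inj_on (\<lambda>(a, f). a @ [f]) S"
  by (auto simp: inj_on_def)

lemma inj_singleton: "inj_on (\<lambda>f. [f]) S"
  by (auto simp: inj_on_def)

lemma mem_carrier_stage_Suc:
  "r @ [f] \<in> carrier (rsh_stage D (Suc k)) \<longleftrightarrow>
    r \<in> carrier (rsh_stage D k) \<and> f \<in> carrier (block D (Suc k)) \<and>
    glue D (Suc k) r = restrict f (bdry D (Suc k))"
  by (auto simp: transport_simps[OF inj_append_singleton] pullback_simps image_iff
      intro!: bexI[of _ "(r, f)"])

lemma carrier_stage_length: "r \<in> carrier (rsh_stage D k) \<Longrightarrow> length r = Suc k"
  by (induction k arbitrary: r)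
     (auto simp: transport_simps[OF inj_append_singleton] transport_simps[OF inj_singleton]
        pullback_simps)

text \<open>The iterated pullback in explicit form, as the set of all lists of functions that satisfy every gluing
condition.\<close>

lemma carrier_stage_iff:
  "r \<in> carrier (rsh_stage D k) \<longleftrightarrow> length r = Suc k \<and> (\<forall>i\<le>k. r ! i \<in> carrier (block D i)) \<and>
    (\<forall>i. 1 \<le> i \<and> i \<le> k \<longrightarrow> glue D i (take i r) = restrict (r ! i) (bdry D i))"
proof (induction k arbitrary: r)
  case 0
  show ?case
    by (auto simp: transport_simps[OF inj_singleton] length_Suc_conv)
next
  case (Suc k)
  show ?case
  proof (cases "length r = Suc (Suc k)")
    case True
    define a f where "a = take (Suc k) r" and "f = r ! Suc k"
    have r: "r = a @ [f]" and len: "length a = Suc k"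
      using True by (simp_all add: a_def f_def take_Suc_conv_app_nth[symmetric])
    have le: "(\<forall>i\<le>Suc k. P i) \<longleftrightarrow> (\<forall>i\<le>k. P i) \<and> P (Suc k)" for P
      by (auto simp: le_Suc_eq)
    have le': "(\<forall>i. 1 \<le> i \<and> i \<le> Suc k \<longrightarrow> P i) \<longleftrightarrow> (\<forall>i. 1 \<le> i \<and> i \<le> k \<longrightarrow> P i) \<and> P (Suc k)" for P
      by (auto simp: le_Suc_eq)
    show ?thesis
      unfolding r mem_carrier_stage_Suc Suc le le' using len by (auto simp: nth_append)
  qed (use carrier_stage_length in blast)
qed

lemma carrier_stage_cases:
  assumes "r \<in> carrier (rsh_stage D (Suc k))"
  obtains a f where "r = a @ [f]" "a \<in> carrier (rsh_stage D k)" "f \<in> carrier (block D (Suc k))"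
    "glue D (Suc k) a = restrict f (bdry D (Suc k))"
  using assms by (auto simp: transport_simps[OF inj_append_singleton] pullback_simps)

lemma stage_Suc_ops:
  assumes r: "r @ [f] \<in> carrier (rsh_stage D (Suc k))" and s: "s @ [g] \<in> carrier (rsh_stage D (Suc k))"
  shows "cadd (rsh_stage D (Suc k)) (r @ [f]) (s @ [g])
      = cadd (rsh_stage D k) r s @ [cadd (block D (Suc k)) f g]"
    "cmult (rsh_stage D (Suc k)) (r @ [f]) (s @ [g])
      = cmult (rsh_stage D k) r s @ [cmult (block D (Suc k)) f g]"
    "cscale (rsh_stage D (Suc k)) c (r @ [f])
      = cscale (rsh_stage D k) c r @ [cscale (block D (Suc k)) c f]"
    "cstar (rsh_stage D (Suc k)) (r @ [f]) = cstar (rsh_stage D k) r @ [cstar (block D (Suc k)) f]"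
    "cnorm (rsh_stage D (Suc k)) (r @ [f]) = max (cnorm (rsh_stage D k) r) (cnorm (block D (Suc k)) f)"
proof -
  let ?P = "pullback (rsh_stage D k) (glue D (Suc k)) (block D (Suc k)) (\<lambda>f. restrict f (bdry D (Suc k)))"
  have c: "(r, f) \<in> carrier ?P" "(s, g) \<in> carrier ?P"
    using r s unfolding mem_carrier_stage_Suc by (simp_all add: pullback_simps)
  note t = transport_simps[OF inj_append_singleton[of "carrier ?P"]]
  show "cadd (rsh_stage D (Suc k)) (r @ [f]) (s @ [g])
      = cadd (rsh_stage D k) r s @ [cadd (block D (Suc k)) f g]"
    using t(2)[OF c] by (simp add: pullback_simps)
  show "cmult (rsh_stage D (Suc k)) (r @ [f]) (s @ [g])
      = cmult (rsh_stage D k) r s @ [cmult (block D (Suc k)) f g]"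
    using t(5)[OF c] by (simp add: pullback_simps)
  show "cscale (rsh_stage D (Suc k)) c (r @ [f])
      = cscale (rsh_stage D k) c r @ [cscale (block D (Suc k)) c f]"
    using t(4)[OF c(1), of c] by (simp add: pullback_simps)
  show "cstar (rsh_stage D (Suc k)) (r @ [f]) = cstar (rsh_stage D k) r @ [cstar (block D (Suc k)) f]"
    using t(6)[OF c(1)] by (simp add: pullback_simps)
  show "cnorm (rsh_stage D (Suc k)) (r @ [f]) = max (cnorm (rsh_stage D k) r) (cnorm (block D (Suc k)) f)"
    using t(7)[OF c(1)] by (simp add: pullback_simps)
qed

lemma stage_ops:
  assumes "r \<in> carrier (rsh_stage D k)" "s \<in> carrier (rsh_stage D k)"
  shows "cadd (rsh_stage D k) r s = map (\<lambda>i. cadd (block D i) (r ! i) (s ! i)) [0..<Suc k]"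
    "cmult (rsh_stage D k) r s = map (\<lambda>i. cmult (block D i) (r ! i) (s ! i)) [0..<Suc k]"
    "cscale (rsh_stage D k) c r = map (\<lambda>i. cscale (block D i) c (r ! i)) [0..<Suc k]"
    "cstar (rsh_stage D k) r = map (\<lambda>i. cstar (block D i) (r ! i)) [0..<Suc k]"
    "cnorm (rsh_stage D k) r \<le> b \<longleftrightarrow> (\<forall>i\<le>k. cnorm (block D i) (r ! i) \<le> b)"
proof -
  have "cadd (rsh_stage D k) r s = map (\<lambda>i. cadd (block D i) (r ! i) (s ! i)) [0..<Suc k] \<and>
    cmult (rsh_stage D k) r s = map (\<lambda>i. cmult (block D i) (r ! i) (s ! i)) [0..<Suc k] \<and>
    cscale (rsh_stage D k) c r = map (\<lambda>i. cscale (block D i) c (r ! i)) [0..<Suc k] \<and>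
    cstar (rsh_stage D k) r = map (\<lambda>i. cstar (block D i) (r ! i)) [0..<Suc k] \<and>
    (cnorm (rsh_stage D k) r \<le> b \<longleftrightarrow> (\<forall>i\<le>k. cnorm (block D i) (r ! i) \<le> b))"
    using assms
  proof (induction k arbitrary: r s)
    case 0
    then obtain f g where "r = [f]" "s = [g]" "f \<in> carrier (block D 0)" "g \<in> carrier (block D 0)"
      by (auto simp: transport_simps[OF inj_singleton])
    then show ?case
      by (simp add: transport_simps[OF inj_singleton])
  next
    case (Suc k)
    obtain a f where r: "r = a @ [f]" "a \<in> carrier (rsh_stage D k)"
      using Suc.prems(1) by (rule carrier_stage_cases)
    obtain b' g where s: "s = b' @ [g]" "b' \<in> carrier (rsh_stage D k)"
      using Suc.prems(2) by (rule carrier_stage_cases)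
    have len: "length a = Suc k" "length b' = Suc k"
      using r s carrier_stage_length by blast+
    note ops = stage_Suc_ops[OF Suc.prems[unfolded r(1) s(1)]]
    note IH = Suc.IH[OF r(2) s(2)]
    have le: "(\<forall>i\<le>Suc k. P i) \<longleftrightarrow> (\<forall>i\<le>k. P i) \<and> P (Suc k)" for P
      by (auto simp: le_Suc_eq)
    show ?case
      unfolding r(1) s(1) ops using IH len
      by (simp del: upt_Suc add: upt_Suc_append[of 0 "Suc k"] nth_append le)
  qed
  then show "cadd (rsh_stage D k) r s = map (\<lambda>i. cadd (block D i) (r ! i) (s ! i)) [0..<Suc k]"
    "cmult (rsh_stage D k) r s = map (\<lambda>i. cmult (block D i) (r ! i) (s ! i)) [0..<Suc k]"
    "cscale (rsh_stage D k) c r = map (\<lambda>i. cscale (block D i) c (r ! i)) [0..<Suc k]"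
    "cstar (rsh_stage D k) r = map (\<lambda>i. cstar (block D i) (r ! i)) [0..<Suc k]"
    "cnorm (rsh_stage D k) r \<le> b \<longleftrightarrow> (\<forall>i\<le>k. cnorm (block D i) (r ! i) \<le> b)"
    by blast+
qed

lemma stage_zero: "czero (rsh_stage D k) = map (\<lambda>i. czero (block D i)) [0..<Suc k]"
proof (induction k)
  case (Suc k)
  then show ?case by (simp add: transport_simps[OF inj_append_singleton] pullback_simps)
qed (simp add: transport_simps[OF inj_singleton])

definition C_one :: "'x topology \<Rightarrow> nat \<Rightarrow> 'x \<Rightarrow> complex Matrix.mat" where
  "C_one X n = (\<lambda>x\<in>topspace X. 1\<^sub>m n)"

lemma C_one_identity: "is_identity (C_mat X n) (C_one X n)"
proof -
  have c: "C_one X n \<in> carrier (C_mat X n)"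
    unfolding C_one_def C_mat_carrier_restrict by auto
  moreover have "cmult (C_mat X n) (C_one X n) f = f \<and> cmult (C_mat X n) f (C_one X n) = f"
    if f: "f \<in> carrier (C_mat X n)" for f
  proof (intro conjI C_mat_eqI[OF _ f] C_mat_closed c f)
    fix x assume x: "x \<in> topspace X"
    show "cmult (C_mat X n) (C_one X n) f x = f x" "cmult (C_mat X n) f (C_one X n) x = f x"
      using x C_mat_carrierD(2)[OF f x] by (simp_all add: C_mat_apply C_one_def)
  qed
  ultimately show ?thesis by (auto simp: is_identity_def)
qed

lemma C_mat_subtopology_restrict:
  assumes f: "f \<in> carrier (C_mat X n)"  and T: "T \<subseteq> topspace X"
  shows "restrict f T \<in> carrier (C_mat (subtopology X T) n)"
proof -
  have "topspace (subtopology X T) = T" using T by auto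
  then show ?thesis
    using C_mat_carrier_restrict[of f "subtopology X T" n] C_mat_carrierD(2,3)[OF f] T
    by (auto intro: continuous_map_from_subtopology)
qed

lemma unital_star_hom_restrict:
  assumes T: "T \<subseteq> topspace X"
  shows "unital_star_hom (C_mat X n) (C_mat (subtopology X T) n) (\<lambda>f. restrict f T)"
proof -
  have TT: "topspace X \<inter> T = T" using T by auto
  have "star_hom (C_mat X n) (C_mat (subtopology X T) n) (\<lambda>f. restrict f T)"
    unfolding star_hom_def
  proof (intro conjI ballI allI)
    fix f assume "f \<in> carrier (C_mat X n)"
    then show "restrict f T \<in> carrier (C_mat (subtopology X T) n)"
      by (rule C_mat_subtopology_restrict[OF _ T])
  qed (use T in \<open>auto simp: C_mat_simps TT intro!: restrict_ext\<close>)
  moreover have "restrict (C_one X n) T = C_one (subtopology X T) n"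
    using T by (auto simp: C_one_def TT fun_eq_iff)
  then have "is_identity (C_mat (subtopology X T) n) (restrict (C_one X n) T)"
    by (simp add: C_one_identity)
  ultimately show ?thesis
    unfolding unital_star_hom_def using C_one_identity by blast
qed

definition stage_one :: "'x rsh_decomp \<Rightarrow> nat \<Rightarrow> ('x \<Rightarrow> complex Matrix.mat) list" where
  "stage_one D k = map (\<lambda>i. C_one (rsh_space D i) (msize D i)) [0..<Suc k]"

lemma valid_rsh_decompD:
  assumes "valid_rsh_decomp D" "k \<le> top_index D"
  shows "compact_space (rsh_space D k)" "Hausdorff_space (rsh_space D k)" "1 \<le> msize D k"
    "1 \<le> k \<Longrightarrow> closedin (rsh_space D k) (bdry D k)"
    "1 \<le> k \<Longrightarrow> unital_star_hom (rsh_stage D (k - 1))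
          (bdry_block D k) (glue D k)"
  using assms by (auto simp: valid_rsh_decomp_def)

text \<open>Since gluing maps are unital, the constant functions \<open>1\<close> satisfy the gluing conditions.\<close>

lemma stage_one_identity:
  assumes D: "valid_rsh_decomp D" and k: "k \<le> top_index D"
  shows "is_identity (rsh_stage D k) (stage_one D k)"
proof -
  have one: "C_one (rsh_space D i) (msize D i) \<in> carrier (block D i)" for i
    using C_one_identity by (auto simp: is_identity_def)
  have carrier: "stage_one D k \<in> carrier (rsh_stage D k) \<Longrightarrow> is_identity (rsh_stage D k) (stage_one D k)" for k
  proof -
    assume c: "stage_one D k \<in> carrier (rsh_stage D k)"
    have "cmult (rsh_stage D k) (stage_one D k) r = r \<and> cmult (rsh_stage D k) r (stage_one D k) = r"
      if r: "r \<in> carrier (rsh_stage D k)" for r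
      unfolding stage_ops(2)[OF c r] stage_ops(2)[OF r c]
    proof -
      have "cmult (block D i) (C_one (rsh_space D i) (msize D i)) (r ! i) = r ! i"
        "cmult (block D i) (r ! i) (C_one (rsh_space D i) (msize D i)) = r ! i" if "i < Suc k" for i
        using r that C_one_identity[of "rsh_space D i" "msize D i"] carrier_stage_iff[of r D k]
        by (auto simp: is_identity_def)
      then show "map (\<lambda>i. cmult (block D i) (stage_one D k ! i) (r ! i)) [0..<Suc k] = r \<and>
          map (\<lambda>i. cmult (block D i) (r ! i) (stage_one D k ! i)) [0..<Suc k] = r"
        using carrier_stage_length[OF r]
        by (auto simp: stage_one_def intro!: nth_equalityI simp del: upt_Suc)
    qed
    then show ?thesis using c by (auto simp: is_identity_def)
  qed
  from k show ?thesis
  proof (induction k)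
    case 0
    show ?case
      by (rule carrier) (use one[of 0] in \<open>simp add: stage_one_def transport_simps[OF inj_singleton]\<close>)
  next
    case (Suc k)
    let ?X = "rsh_space D (Suc k)" and ?T = "bdry D (Suc k)" and ?n = "msize D (Suc k)"
    have T: "?T \<subseteq> topspace ?X"
      using valid_rsh_decompD(4)[OF D Suc.prems] closedin_subset by auto
    have "is_identity (C_mat (subtopology ?X ?T) ?n) (glue D (Suc k) (stage_one D k))"
      using valid_rsh_decompD(5)[OF D Suc.prems] Suc unital_star_hom_identity by fastforce
    moreover have "is_identity (C_mat (subtopology ?X ?T) ?n) (restrict (C_one ?X ?n) ?T)"
      using unital_star_hom_identity[OF unital_star_hom_restrict[OF T] C_one_identity] .
    ultimately have "glue D (Suc k) (stage_one D k) = restrict (C_one ?X ?n) ?T"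
      by (rule identity_unique)
    moreover have "stage_one D (Suc k) = stage_one D k @ [C_one ?X ?n]"
      by (simp add: stage_one_def)
    moreover have "stage_one D k \<in> carrier (rsh_stage D k)"
      using Suc by (simp add: is_identity_def)
    ultimately show ?case
      using one by (intro carrier) (simp only: mem_carrier_stage_Suc)
  qed
qed

lemma cstar_algebra_stage:
  assumes D: "valid_rsh_decomp D" and k: "k \<le> top_index D"
  shows "cstar_algebra (rsh_stage D k)"
  using k
proof (induction k)
  case 0
  then show ?case
    using valid_rsh_decompD(1)[OF D, of 0]
    by (simp add: cstar_algebra_transport cstar_algebra_C_mat inj_singleton)
next
  case (Suc k)
  let ?X = "rsh_space D (Suc k)" and ?T = "bdry D (Suc k)" and ?n = "msize D (Suc k)"
  note v = valid_rsh_decompD[OF D Suc.prems]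
  have T: "closedin ?X ?T" using v(4) by simp
  have "compact_space (subtopology ?X ?T)"
    using T v(1) closedin_compact_space compact_space_subtopology by blast
  then have "cstar_algebra (pullback (rsh_stage D k) (glue D (Suc k)) (block D (Suc k)) (\<lambda>f. restrict f ?T))"
    using v(5) Suc unital_star_hom_restrict[OF closedin_subset[OF T]]
    by (intro cstar_algebra_pullback[of _ _ "C_mat (subtopology ?X ?T) ?n"] cstar_algebra_C_mat v) auto
  then show ?case
    by (simp add: cstar_algebra_transport inj_append_singleton)
qed

section \<open>Extension of matrix-valued functions\<close>

lemma Tietze_extension_complex:
  fixes g :: "'x \<Rightarrow> complex"
  assumes X: "normal_space X" and T: "closedin X T"
    and g: "continuous_map (subtopology X T) euclidean g"
  obtains f where "continuous_map X euclidean f" "\<And>x. x \<in> T \<Longrightarrow> f x = g x"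
proof -
  have "continuous_map (subtopology X T) euclideanreal (\<lambda>x. Re (g x))"
    "continuous_map (subtopology X T) euclideanreal (\<lambda>x. Im (g x))"
    using g by (simp_all add: continuous_map_atin tendsto_Re tendsto_Im)
  then obtain u v where "continuous_map X euclideanreal u" "continuous_map X euclideanreal v"
    and uv: "\<And>x. x \<in> T \<Longrightarrow> u x = Re (g x)" "\<And>x. x \<in> T \<Longrightarrow> v x = Im (g x)"
    using X T unfolding normal_space_iff_Tietze by metis
  then have "continuous_map X euclidean (\<lambda>x. Complex (u x) (v x))"
    by (simp add: continuous_map_atin tendsto_Complex)
  then show thesis
    using uv by (intro that[of "\<lambda>x. Complex (u x) (v x)"]) auto
qed

lemma compact_Hausdorff_normal: "compact_space X \<Longrightarrow> Hausdorff_space X \<Longrightarrow> normal_space X"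
  using compact_Hausdorff_or_regular_imp_normal_space by blast

text \<open>The Tietze theorem is applied to the entries of the function on \<open>T \<union> Z\<close> that is \<open>g\<close> on \<open>T\<close> and \<open>0\<close> on
\<open>Z\<close>.\<close>

lemma C_mat_extend_vanishing:
  assumes X: "compact_space X" "Hausdorff_space X" and T: "closedin X T" and Z: "closedin X Z"
    and g: "g \<in> carrier (C_mat (subtopology X T) n)"
    and gZ: "\<And>x. x \<in> T \<inter> Z \<Longrightarrow> g x = 0\<^sub>m n n"
  obtains f where "f \<in> carrier (C_mat X n)" "restrict f T = g" "\<And>x. x \<in> Z \<Longrightarrow> f x = 0\<^sub>m n n"
proof -
  have Tt: "topspace (subtopology X T) = T" and TZ: "closedin X (T \<union> Z)" and sub: "T \<union> Z \<subseteq> topspace X"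
    using T Z closedin_subset by fastforce+
  define h where "h i j x = (if x \<in> T then index_mat (g x) (i, j) else 0)" for i j x
  have h: "continuous_map (subtopology X (T \<union> Z)) euclidean (h i j)" if ij: "i < n" "j < n" for i j
  proof (rule pasting_lemma_closed[of UNIV "subtopology X (T \<union> Z)" "\<lambda>b::bool. if b then T else Z" _
        "\<lambda>b. if b then (\<lambda>x. index_mat (g x) (i, j)) else (\<lambda>x. 0)"])
    fix b :: bool
    have "(T \<union> Z) \<inter> (if b then T else Z) = (if b then T else Z)" by auto
    then show "closedin (subtopology X (T \<union> Z)) (if b then T else Z)"
      using T Z by (auto intro!: closedin_subset_topspace)
    show "continuous_map (subtopology (subtopology X (T \<union> Z)) (if b then T else Z)) euclidean
        (if b then (\<lambda>x. index_mat (g x) (i, j)) else (\<lambda>x. 0))"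
      using C_mat_carrierD(3)[OF g ij] \<open>(T \<union> Z) \<inter> (if b then T else Z) = (if b then T else Z)\<close>
      by (auto simp: subtopology_subtopology)
  next
    fix x assume "x \<in> topspace (subtopology X (T \<union> Z))"
    then show "\<exists>b. b \<in> UNIV \<and> x \<in> (if b then T else Z) \<and>
        h i j x = (if b then (\<lambda>x. index_mat (g x) (i, j)) else (\<lambda>x. 0)) x"
      by (cases "x \<in> T") (auto simp: h_def intro: exI[of _ True] exI[of _ False])
  qed (use gZ ij in \<open>auto split: if_splits\<close>)
  have "\<exists>F. continuous_map X euclidean F \<and> (\<forall>x\<in>T \<union> Z. F x = h i j x)" if "i < n" "j < n" for i j
    using Tietze_extension_complex[OF compact_Hausdorff_normal[OF X] TZ h[OF that]] by metis
  then obtain F where F: "\<And>i j. i < n \<Longrightarrow> j < n \<Longrightarrow> continuous_map X euclidean (F i j)"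
    "\<And>i j x. i < n \<Longrightarrow> j < n \<Longrightarrow> x \<in> T \<union> Z \<Longrightarrow> F i j x = h i j x"
    by metis
  define f where "f = (\<lambda>x\<in>topspace X. Matrix.mat n n (\<lambda>(i, j). F i j x))"
  show thesis
  proof
    show "f \<in> carrier (C_mat X n)"
      unfolding f_def C_mat_carrier_restrict using F(1) by auto
    show "restrict f T = g"
    proof
      fix x show "restrict f T x = g x"
      proof (cases "x \<in> T")
        case True
        then have gx: "g x \<in> carrier_mat n n" using C_mat_carrierD(2)[OF g, of x] unfolding Tt by simp
        then show ?thesis
          using True sub F(2) by (intro eq_matI) (auto simp: f_def h_def)
      next
        case False
        then show ?thesis using C_mat_carrierD(1)[OF g] Tt by (simp add: extensional_def)
      qed
    qed
    show "f x = 0\<^sub>m n n" if x: "x \<in> Z" for x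
    proof -
      have "h i j x = 0" if "i < n" "j < n" for i j
        using gZ[of x] x that by (auto simp: h_def)
      then show ?thesis
        using x sub F(2) by (intro eq_matI) (auto simp: f_def)
    qed
  qed
qed

section \<open>Ideals of $C(X, M_n)$\<close>

lemma continuous_map_entry_sum:
  assumes "f \<in> carrier (C_mat X n)"
  shows "continuous_map X euclideanreal (\<lambda>x. entry_sum (f x))"
proof (rule continuous_map_eq)
  show "continuous_map X euclideanreal (\<lambda>x. \<Sum>i<n. \<Sum>j<n. cmod (index_mat (f x) (i, j)))"
    using C_mat_carrierD(3)[OF assms] by (intro continuous_map_sum continuous_map_norm) auto
qed (use carrier_matD[OF C_mat_carrierD(2)[OF assms]] in \<open>simp add: entry_sum_def\<close>)

lemma entry_sum_eq_0:
  assumes "M \<in> carrier_mat n n"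
  shows "entry_sum M = 0 \<longleftrightarrow> M = 0\<^sub>m n n"
proof
  assume "entry_sum M = 0"
  then show "M = 0\<^sub>m n n"
    using op_norm_le_entry_sum[OF assms] op_norm_nonneg[OF assms] op_norm_eq_0[OF assms] by simp
qed (simp add: entry_sum_def)

lemma closedin_C_mat_zero_set:
  assumes "f \<in> carrier (C_mat X n)"
  shows "closedin X {x \<in> topspace X. f x = 0\<^sub>m n n}"
proof -
  have "{x \<in> topspace X. f x = 0\<^sub>m n n} = {x \<in> topspace X. entry_sum (f x) \<in> {0}}"
    using entry_sum_eq_0[OF C_mat_carrierD(2)[OF assms]] by auto
  then show ?thesis
    using closedin_continuous_map_preimage[OF continuous_map_entry_sum[OF assms], of "{0}"] by simp
qed

definition entry_mat :: "nat \<Rightarrow> nat \<Rightarrow> nat \<Rightarrow> complex \<Rightarrow> complex Matrix.mat" where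
  "entry_mat n i j w = Matrix.mat n n (\<lambda>(a, b). if a = i \<and> b = j then w else 0)"

lemma entry_mat_carrier: "entry_mat n i j w \<in> carrier_mat n n"
  by (simp add: entry_mat_def)

lemma entry_mat_mult_left:
  assumes M: "M \<in> carrier_mat n n" and pq: "p < n" "i < n"
  shows "entry_mat n i p w * M = Matrix.mat n n (\<lambda>(a, b). if a = i then w * index_mat M (p, b) else 0)"
proof (rule eq_matI)
  fix a b assume "a < dim_row (Matrix.mat n n (\<lambda>(a, b). if a = i then w * index_mat M (p, b) else 0))"
    "b < dim_col (Matrix.mat n n (\<lambda>(a, b). if a = i then w * index_mat M (p, b) else 0))"
  then have ab: "a < n" "b < n" by auto
  have "index_mat (entry_mat n i p w * M) (a, b)
      = (\<Sum>k<n. index_mat (entry_mat n i p w) (a, k) * index_mat M (k, b))"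
    by (rule index_mult_mat_sum[OF entry_mat_carrier M ab])
  also have "\<dots> = (\<Sum>k<n. if k = p then (if a = i then w * index_mat M (p, b) else 0) else 0)"
    using ab by (intro sum.cong) (auto simp: entry_mat_def)
  finally show "index_mat (entry_mat n i p w * M) (a, b)
      = index_mat (Matrix.mat n n (\<lambda>(a, b). if a = i then w * index_mat M (p, b) else 0)) (a, b)"
    using ab pq by simp
qed (use M in \<open>auto simp: entry_mat_def\<close>)

lemma entry_mat_sandwich:
  assumes M: "M \<in> carrier_mat n n" and pq: "p < n" "q < n" "i < n"
  shows "entry_mat n i p w * M * entry_mat n q i w' = entry_mat n i i (w * index_mat M (p, q) * w')"
proof (rule eq_matI)
  have E: "entry_mat n i p w * M \<in> carrier_mat n n"
    using M entry_mat_carrier by (rule mult_carrier_mat[rotated])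
  fix a b assume "a < dim_row (entry_mat n i i (w * index_mat M (p, q) * w'))"
    "b < dim_col (entry_mat n i i (w * index_mat M (p, q) * w'))"
  then have ab: "a < n" "b < n" by (auto simp: entry_mat_def)
  have "index_mat (entry_mat n i p w * M * entry_mat n q i w') (a, b)
      = (\<Sum>k<n. index_mat (entry_mat n i p w * M) (a, k) * index_mat (entry_mat n q i w') (k, b))"
    by (rule index_mult_mat_sum[OF E entry_mat_carrier ab])
  also have "\<dots> = (\<Sum>k<n. if k = q then (if a = i \<and> b = i then w * index_mat M (p, q) * w' else 0) else 0)"
  proof (intro sum.cong refl)
    fix k assume "k \<in> {..<n}"
    then have k: "k < n" by simp
    have "index_mat (entry_mat n i p w * M) (a, k) = (if a = i then w * index_mat M (p, k) else 0)"
      using ab k by (simp add: entry_mat_mult_left[OF M pq(1,3)])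
    moreover have "index_mat (entry_mat n q i w') (k, b) = (if k = q \<and> b = i then w' else 0)"
      using ab k by (simp add: entry_mat_def)
    ultimately show "index_mat (entry_mat n i p w * M) (a, k) * index_mat (entry_mat n q i w') (k, b)
        = (if k = q then (if a = i \<and> b = i then w * index_mat M (p, q) * w' else 0) else 0)"
      by simp
  qed
  finally show "index_mat (entry_mat n i p w * M * entry_mat n q i w') (a, b)
      = index_mat (entry_mat n i i (w * index_mat M (p, q) * w')) (a, b)"
    using ab pq by (simp add: entry_mat_def)
qed (use M in \<open>auto simp: entry_mat_def\<close>)

lemma C_mat_entry_fun:
  assumes "continuous_map X euclidean w"
  shows "(\<lambda>x\<in>topspace X. entry_mat n i j (w x)) \<in> carrier (C_mat X n)"
  unfolding C_mat_carrier_restrict using assms by (auto simp: entry_mat_def)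

lemma C_mat_smult_fun:
  assumes w: "continuous_map X euclidean w" and f: "f \<in> carrier (C_mat X n)"
  shows "(\<lambda>x\<in>topspace X. w x \<cdot>\<^sub>m f x) \<in> carrier (C_mat X n)"
  unfolding C_mat_carrier_restrict
proof (intro conjI ballI allI impI)
  fix i j assume ij: "i < n" "j < n"
  have "continuous_map X euclidean (\<lambda>x. w x * index_mat (f x) (i, j))"
    by (intro continuous_map_mult_complex w C_mat_carrierD(3)[OF f ij])
  then show "continuous_map X euclidean (\<lambda>x. index_mat (w x \<cdot>\<^sub>m f x) (i, j))"
    by (rule continuous_map_eq) (use ij carrier_matD[OF C_mat_carrierD(2)[OF f]] in simp)
qed (use C_mat_carrierD(2)[OF f] in auto)

lemma continuous_map_of_real:
  "continuous_map X euclideanreal s \<Longrightarrow> continuous_map X euclidean (\<lambda>x. complex_of_real (s x))"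
  by (simp add: continuous_map_atin tendsto_of_real)

text \<open>With \<open>F\<close> the entry sum of \<open>w\<close>, the function \<open>g\<close> is \<open>(1 - c / F) w\<close> where \<open>F > c\<close>, and \<open>0\<close> elsewhere.\<close>

lemma cutoff:
  assumes X: "compact_space X" and w: "w \<in> carrier (C_mat X n)" and c: "0 < c"
  obtains g where "g \<in> carrier (C_mat X n)" "cdist (C_mat X n) w g \<le> c"
    "\<And>x. x \<in> topspace X \<Longrightarrow> entry_sum (w x) \<le> c \<Longrightarrow> g x = 0\<^sub>m n n"
proof -
  define F where "F x = entry_sum (w x)" for x
  \<comment> \<open>This is \<open>1 - c / F x\<close> where \<open>F x > c\<close>, written so that the denominator is positive everywhere.\<close>
  define t where "t x = max 0 (F x - c) / max (F x) c" for x
  have Fc: "continuous_map X euclideanreal F"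
    unfolding F_def by (rule continuous_map_entry_sum[OF w])
  have "continuous_map X euclideanreal t"
    unfolding t_def using c
    by (intro continuous_map_real_divide continuous_map_real_max continuous_map_diff Fc) auto
  then have g: "(\<lambda>x\<in>topspace X. complex_of_real (t x) \<cdot>\<^sub>m w x) \<in> carrier (C_mat X n)" (is "?g \<in> _")
    by (intro C_mat_smult_fun continuous_map_of_real w)
  show thesis
  proof (rule that[OF g])
    show "cdist (C_mat X n) w ?g \<le> c"
      unfolding cdist_def
    proof (rule cnorm_C_mat_le)
      fix x assume x: "x \<in> topspace X"
      note wx = C_mat_carrierD(2)[OF w x]
      have t: "0 \<le> 1 - t x" "(1 - t x) * F x \<le> c"
        using c by (auto simp: t_def max_def field_simps)
      have "cadd (C_mat X n) w (cscale (C_mat X n) (-1) ?g) x = complex_of_real (1 - t x) \<cdot>\<^sub>m w x"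
        using x wx by (intro eq_matI) (auto simp: C_mat_apply algebra_simps)
      then have "op_norm (cadd (C_mat X n) w (cscale (C_mat X n) (-1) ?g) x) \<le> (1 - t x) * op_norm (w x)"
        using op_norm_smult_le[OF wx, of "complex_of_real (1 - t x)"] t(1) by (simp del: of_real_diff)
      also have "\<dots> \<le> (1 - t x) * F x"
        using op_norm_le_entry_sum[OF wx] t(1) by (intro mult_left_mono) (auto simp: F_def)
      finally show "op_norm (cadd (C_mat X n) w (cscale (C_mat X n) (-1) ?g) x) \<le> c"
        using t(2) by linarith
    qed (use c in simp)
    fix x assume x: "x \<in> topspace X" "entry_sum (w x) \<le> c"
    then have "t x = 0" by (simp add: t_def F_def)
    then show "?g x = 0\<^sub>m n n"
      using x C_mat_carrierD(2)[OF w x(1)] by (auto intro!: eq_matI)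
  qed
qed

text \<open>The set \<open>K\<close> is an ideal of the algebra of functions that vanish on \<open>T\<close>. This algebra need not have
an identity, so elements of \<open>K\<close> can only be multiplied by functions that vanish on \<open>T\<close>. It
will be applied to the functions that occur as \<open>k\<close>-th component, after zeros, in an ideal of a
recursive subhomogeneous algebra.\<close>

locale ideal_of_C_mat =
  fixes X :: "'x topology" and n :: nat and T :: "'x set"
    and K :: "('x \<Rightarrow> complex Matrix.mat) set"
  assumes X: "compact_space X" "Hausdorff_space X" and T: "closedin X T"
    and K_carrier: "K \<subseteq> carrier (C_mat X n)"
    and K_zero: "czero (C_mat X n) \<in> K"
    and K_add: "f \<in> K \<Longrightarrow> g \<in> K \<Longrightarrow> cadd (C_mat X n) f g \<in> K"
    and K_left: "f \<in> carrier (C_mat X n) \<Longrightarrow> (\<And>x. x \<in> T \<Longrightarrow> f x = 0\<^sub>m n n) \<Longrightarrow> g \<in> K \<Longrightarrow>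
      cmult (C_mat X n) f g \<in> K"
    and K_right: "f \<in> carrier (C_mat X n) \<Longrightarrow> (\<And>x. x \<in> T \<Longrightarrow> f x = 0\<^sub>m n n) \<Longrightarrow> g \<in> K \<Longrightarrow>
      cmult (C_mat X n) g f \<in> K"
begin

definition scalar :: "('x \<Rightarrow> real) \<Rightarrow> 'x \<Rightarrow> complex Matrix.mat" where
  "scalar s = (\<lambda>x\<in>topspace X. complex_of_real (s x) \<cdot>\<^sub>m 1\<^sub>m n)"

text \<open>Multiplication by matrix units from both sides turns the entry \<open>g\<^sub>p\<^sub>q\<close> of \<open>g\<close> into a multiple of
\<open>E\<^sub>i\<^sub>i\<close>, and the sum over \<open>i\<close> is a scalar function in \<open>K\<close>. The factors contain a Urysohn
function \<open>u\<close> that vanishes on \<open>T\<close>, as multipliers of \<open>K\<close> must, and the conjugate of \<open>g\<^sub>p\<^sub>q\<close>, so that the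
result \<open>c u\<^sup>2 |g\<^sub>p\<^sub>q|\<^sup>2\<close> is nonnegative.\<close>

lemma scalar_of_nonzero_entry:
  assumes g: "g \<in> K" and x: "x \<in> topspace X" "x \<notin> T" and pq: "p < n" "q < n"
    and nz: "index_mat (g x) (p, q) \<noteq> 0"
  shows "\<exists>s. continuous_map X euclideanreal s \<and> (\<forall>y\<in>topspace X. 0 \<le> s y) \<and> 1 < s x \<and> scalar s \<in> K"
proof -
  have gc: "g \<in> carrier (C_mat X n)" using g K_carrier by auto
  have "closedin X {x}"
    using X x by (simp add: closedin_Hausdorff_singleton)
  moreover have "disjnt T {x}" using x by (simp add: disjnt_def)
  ultimately obtain u where u: "continuous_map X euclideanreal u" and u': "u ` T \<subseteq> {0}" "u ` {x} \<subseteq> {1}"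
    using Urysohn_lemma_alt[OF compact_Hausdorff_normal[OF X] T] by metis
  then have u: "continuous_map X euclideanreal u" "\<And>y. y \<in> T \<Longrightarrow> u y = 0" "u x = 1"
    by auto
  \<comment> \<open>This factor makes the value of \<open>s\<close> at \<open>x\<close> equal to \<open>2\<close>.\<close>
  define c where "c = 2 / (cmod (index_mat (g x) (p, q)))\<^sup>2"
  have c: "c > 0" using nz by (simp add: c_def)
  define s where "s y = c * (u y)\<^sup>2 * (cmod (index_mat (g y) (p, q)))\<^sup>2" for y
  define w where "w y = complex_of_real (u y) * cnj (index_mat (g y) (p, q))" for y
  define w' where "w' y = complex_of_real (c * u y)" for y
  have uc: "continuous_map X euclidean (\<lambda>y. complex_of_real (u y))"
    by (rule continuous_map_of_real[OF u(1)])
  have wc: "continuous_map X euclidean w"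
    unfolding w_def by (intro continuous_map_mult_complex continuous_map_cnj uc C_mat_carrierD(3)[OF gc pq])
  have w'c: "continuous_map X euclidean w'"
    unfolding w'_def of_real_mult by (intro continuous_map_mult_complex uc) simp
  have prod: "w y * index_mat (g y) (p, q) * w' y = complex_of_real (s y)" for y
    using complex_norm_square[of "index_mat (g y) (p, q)"]
    by (simp add: w_def w'_def s_def power2_eq_square mult_ac)
  let ?C = "C_mat X n"
  \<comment> \<open>The sum of the first \<open>m\<close> of the \<open>n\<close> products of the form \<open>s E\<^sub>i\<^sub>i\<close>.\<close>
  define part where "part m = (\<lambda>y\<in>topspace X. Matrix.mat n n
      (\<lambda>(a, b). if a = b \<and> a < m then complex_of_real (s y) else 0))" for m
  have part: "m \<le> n \<Longrightarrow> part m \<in> K" for m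
  proof (induction m)
    case 0
    have "part 0 = czero ?C" by (auto simp: part_def C_mat_simps intro!: restrict_ext eq_matI)
    then show ?case using K_zero by simp
  next
    case (Suc m)
    then have m: "m < n" by simp
    define l r where "l = (\<lambda>y\<in>topspace X. entry_mat n m p (w y))"
      and "r = (\<lambda>y\<in>topspace X. entry_mat n q m (w' y))"
    have zero: "entry_mat n i j 0 = 0\<^sub>m n n" for i j
      by (rule eq_matI) (auto simp: entry_mat_def)
    have l: "l \<in> carrier ?C" "\<And>y. y \<in> T \<Longrightarrow> l y = 0\<^sub>m n n"
      using C_mat_entry_fun[OF wc] closedin_subset[OF T] u(2) by (auto simp: l_def w_def zero)
    have r: "r \<in> carrier ?C" "\<And>y. y \<in> T \<Longrightarrow> r y = 0\<^sub>m n n"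
      using C_mat_entry_fun[OF w'c] closedin_subset[OF T] u(2) by (auto simp: r_def w'_def zero)
    have K1: "cmult ?C (cmult ?C l g) r \<in> K"
      using l r g by (intro K_left K_right)
    have "part (Suc m) = cadd ?C (part m) (cmult ?C (cmult ?C l g) r)"
      unfolding part_def C_mat_simps
    proof (rule restrict_ext)
      fix y assume y: "y \<in> topspace X"
      have "l y * g y * r y = entry_mat n m m (complex_of_real (s y))"
        using entry_mat_sandwich[OF C_mat_carrierD(2)[OF gc y] pq m] y prod by (simp add: l_def r_def)
      then show "Matrix.mat n n (\<lambda>(a, b). if a = b \<and> a < Suc m then complex_of_real (s y) else 0) =
          (\<lambda>y\<in>topspace X. Matrix.mat n n (\<lambda>(a, b). if a = b \<and> a < m then complex_of_real (s y) else 0)) y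
          + (\<lambda>y\<in>topspace X. (\<lambda>y\<in>topspace X. l y * g y) y * r y) y"
        using y by (auto simp: entry_mat_def intro!: eq_matI)
    qed
    then show ?case using K_add[OF Suc.IH K1] m by simp
  qed
  have "part n = scalar s"
    by (auto simp: part_def scalar_def intro!: restrict_ext eq_matI)
  then have "scalar s \<in> K" using part[of n] by simp
  moreover have "continuous_map X euclideanreal s"
    unfolding s_def
    by (intro continuous_map_real_mult continuous_map_real_pow u continuous_map_norm
        C_mat_carrierD(3)[OF gc pq]) simp
  moreover have "1 < s x" using u nz by (simp add: s_def c_def)
  moreover have "0 \<le> s y" for y using c by (simp add: s_def)
  ultimately show ?thesis by blast
qed

lemma scalar_sum:
  assumes "finite S" "\<And>i. i \<in> S \<Longrightarrow> scalar (s i) \<in> K"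
  shows "scalar (\<lambda>x. \<Sum>i\<in>S. s i x) \<in> K"
  using assms
proof (induction S)
  case empty
  have "scalar (\<lambda>x. 0) = czero (C_mat X n)"
    by (auto simp: scalar_def C_mat_simps intro!: restrict_ext eq_matI)
  then show ?case using K_zero by simp
next
  case (insert i S)
  have "scalar (\<lambda>x. \<Sum>i\<in>insert i S. s i x) = cadd (C_mat X n) (scalar (s i)) (scalar (\<lambda>x. \<Sum>i\<in>S. s i x))"
    using insert by (auto simp: scalar_def C_mat_simps intro!: restrict_ext eq_matI)
  then show ?case using insert K_add by simp
qed

text \<open>On the compact set where the entry sum of \<open>f\<close> is at least \<open>e\<close>, some element of \<open>K\<close> is nonzero at
each point. By compactness, a sum of finitely many scalar functions in \<open>K\<close> is a scalar function \<open>t\<close> in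
\<open>K\<close> with \<open>t \<ge> 1\<close> on that set. Then \<open>f t / max(t, 1)\<close> lies in \<open>K\<close>. It equals \<open>f\<close> on the set; elsewhere the
difference is a multiple of \<open>f\<close> by a factor between \<open>0\<close> and \<open>1\<close>, and \<open>f\<close> is small there.\<close>

theorem vanishing_imp_approximable:
  assumes f: "f \<in> carrier (C_mat X n)" and fT: "\<And>x. x \<in> T \<Longrightarrow> f x = 0\<^sub>m n n"
    and fK: "\<And>x. x \<in> topspace X \<Longrightarrow> (\<And>g. g \<in> K \<Longrightarrow> g x = 0\<^sub>m n n) \<Longrightarrow> f x = 0\<^sub>m n n"
    and e: "0 < e"
  shows "\<exists>g\<in>K. cdist (C_mat X n) f g \<le> e"
proof -
  let ?C = "C_mat X n"
  define F where "F x = entry_sum (f x)" for x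
  have Fc: "continuous_map X euclideanreal F"
    unfolding F_def by (rule continuous_map_entry_sum[OF f])
  define S where "S = {x \<in> topspace X. F x \<in> {e..}}"
  have "closedin X S"
    unfolding S_def by (rule closedin_continuous_map_preimage[OF Fc]) simp
  then have S: "compactin X S"
    using X closedin_compact_space by blast
  have "\<exists>s. continuous_map X euclideanreal s \<and> (\<forall>y\<in>topspace X. 0 \<le> s y) \<and> 1 < s x \<and> scalar s \<in> K"
    if x: "x \<in> S" for x
  proof -
    have xX: "x \<in> topspace X" and nz: "f x \<noteq> 0\<^sub>m n n"
      using x e by (auto simp: S_def F_def entry_sum_def)
    obtain g where g: "g \<in> K" "g x \<noteq> 0\<^sub>m n n"
      using fK[OF xX] nz by blast
    have gx: "g x \<in> carrier_mat n n"
      by (rule C_mat_carrierD(2)[OF subsetD[OF K_carrier g(1)] xX])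
    have "\<exists>p<n. \<exists>q<n. index_mat (g x) (p, q) \<noteq> 0"
    proof (rule ccontr)
      assume "\<not> ?thesis"
      then have "g x = 0\<^sub>m n n" using gx by (intro eq_matI) auto
      then show False using g(2) by simp
    qed
    then obtain p q where "p < n" "q < n" "index_mat (g x) (p, q) \<noteq> 0"
      by blast
    then show ?thesis
      using scalar_of_nonzero_entry[OF g(1) xX] fT nz by blast
  qed
  then obtain s where s: "\<And>x. x \<in> S \<Longrightarrow> continuous_map X euclideanreal (s x)"
    "\<And>x y. x \<in> S \<Longrightarrow> y \<in> topspace X \<Longrightarrow> 0 \<le> s x y" "\<And>x. x \<in> S \<Longrightarrow> 1 < s x x"
    "\<And>x. x \<in> S \<Longrightarrow> scalar (s x) \<in> K"
    by metis
  define U where "U x = {y \<in> topspace X. s x y \<in> {1<..}}" for x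
  have "openin X (U x)" if "x \<in> S" for x
    unfolding U_def by (rule openin_continuous_map_preimage[OF s(1)[OF that]]) simp
  moreover have "S \<subseteq> \<Union>(U ` S)"
    using s(3) by (auto simp: U_def S_def)
  ultimately obtain \<F> where "finite \<F>" "\<F> \<subseteq> U ` S" "S \<subseteq> \<Union>\<F>"
    using compactinD[OF S, of "U ` S"] by auto
  then obtain P where P: "finite P" "P \<subseteq> S" "S \<subseteq> \<Union>(U ` P)"
    by (metis finite_subset_image)
  define t where "t y = (\<Sum>x\<in>P. s x y)" for y
  have tK: "scalar t \<in> K"
    unfolding t_def using P s(4) by (intro scalar_sum) auto
  have tc: "continuous_map X euclideanreal t"
    unfolding t_def using P s(1) by (intro continuous_map_sum) auto
  have t0: "0 \<le> t y" if "y \<in> topspace X" for y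
    unfolding t_def using P s(2) that by (intro sum_nonneg) auto
  have t1: "1 \<le> t y" if y: "y \<in> S" for y
  proof -
    obtain x where x: "x \<in> P" "y \<in> U x" using P y by blast
    then have "s x y \<le> t y"
      unfolding t_def using P s(2) by (intro member_le_sum) (auto simp: U_def)
    then show ?thesis using x by (simp add: U_def)
  qed
  define h where "h = (\<lambda>y\<in>topspace X. complex_of_real (1 / max (t y) 1) \<cdot>\<^sub>m f y)"
  have "continuous_map X euclideanreal (\<lambda>y. 1 / max (t y) 1)"
    by (intro continuous_map_real_divide continuous_map_real_max tc) auto
  then have h: "h \<in> carrier ?C" 
    unfolding h_def by (intro C_mat_smult_fun continuous_map_of_real f)
  have hT: "h y = 0\<^sub>m n n" if "y \<in> T" for y
    using that fT[OF that] closedin_subset[OF T] by (auto simp: h_def)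
  define g where "g = cmult ?C h (scalar t)"
  have g: "g \<in> K" unfolding g_def using h hT tK by (rule K_left)
  have gy: "g y = complex_of_real (t y / max (t y) 1) \<cdot>\<^sub>m f y" if y: "y \<in> topspace X" for y
  proof -
    have "g y = (complex_of_real (1 / max (t y) 1) \<cdot>\<^sub>m f y) * (complex_of_real (t y) \<cdot>\<^sub>m 1\<^sub>m n)"
      using y by (simp add: g_def C_mat_apply h_def scalar_def)
    also have "\<dots> = complex_of_real (t y) \<cdot>\<^sub>m ((complex_of_real (1 / max (t y) 1) \<cdot>\<^sub>m f y) * 1\<^sub>m n)"
      using C_mat_carrierD(2)[OF f y] by (intro mult_smult_distrib[of _ n n _ n]) auto
    also have "\<dots> = complex_of_real (t y / max (t y) 1) \<cdot>\<^sub>m f y"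
      using C_mat_carrierD(2)[OF f y] by (intro eq_matI) auto
    finally show ?thesis .
  qed
  have "cdist ?C f g \<le> e"
    unfolding cdist_def
  proof (rule cnorm_C_mat_le)
    fix y assume y: "y \<in> topspace X"
    note fy = C_mat_carrierD(2)[OF f y]
    define a where "a = 1 - t y / max (t y) 1"
    have a: "0 \<le> a" "a \<le> 1" using t0[OF y] by (auto simp: a_def max_def)
    have "cadd ?C f (cscale ?C (-1) g) y = complex_of_real a \<cdot>\<^sub>m f y"
      using y fy by (intro eq_matI) (auto simp: C_mat_apply gy a_def algebra_simps)
    then have "op_norm (cadd ?C f (cscale ?C (-1) g) y) \<le> a * op_norm (f y)"
      using op_norm_smult_le[OF fy, of "complex_of_real a"] a by simp
    also have "\<dots> \<le> e"
    proof (cases "y \<in> S")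
      case True
      then show ?thesis using t1[OF True] e by (simp add: a_def)
    next
      case False
      then have "op_norm (f y) \<le> e"
        using op_norm_le_entry_sum[OF fy] y by (simp add: S_def F_def)
      then show ?thesis
        using a op_norm_nonneg[OF fy] mult_left_le_one_le[of "op_norm (f y)" a] by linarith
    qed
    finally show "op_norm (cadd ?C f (cscale ?C (-1) g) y) \<le> e" .
  qed (use e in simp)
  then show ?thesis using g by blast
qed

end

section \<open>Closed ideals of a recursive subhomogeneous algebra\<close>

lemma stage_nth:
  assumes "r \<in> carrier (rsh_stage D k)" "s \<in> carrier (rsh_stage D k)" "i \<le> k"
  shows "cadd (rsh_stage D k) r s ! i = cadd (block D i) (r ! i) (s ! i)"
    "cmult (rsh_stage D k) r s ! i = cmult (block D i) (r ! i) (s ! i)"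
    "cscale (rsh_stage D k) c r ! i = cscale (block D i) c (r ! i)"
    "cstar (rsh_stage D k) r ! i = cstar (block D i) (r ! i)"
    "czero (rsh_stage D k) ! i = czero (block D i)"
  using assms by (simp_all add: stage_ops[of r D k s] stage_zero nth_append del: upt_Suc)

lemma carrier_stage_nth: "r \<in> carrier (rsh_stage D k) \<Longrightarrow> i \<le> k \<Longrightarrow> r ! i \<in> carrier (block D i)"
  by (simp add: carrier_stage_iff)

lemma carrier_stage_take:
  assumes "r \<in> carrier (rsh_stage D k)" "j \<le> k"
  shows "take (Suc j) r \<in> carrier (rsh_stage D j)"
  using assms by (auto simp: carrier_stage_iff min_def)

lemma carrier_stage_glue:
  "r \<in> carrier (rsh_stage D k) \<Longrightarrow> Suc j \<le> k \<Longrightarrow>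
    glue D (Suc j) (take (Suc j) r) = restrict (r ! Suc j) (bdry D (Suc j))"
  by (simp add: carrier_stage_iff)

definition zeros :: "'x rsh_decomp \<Rightarrow> nat \<Rightarrow> ('x \<Rightarrow> complex Matrix.mat) list" where
  "zeros D k = map (\<lambda>i. czero (block D i)) [0..<k]"

text \<open>The set \<open>X\<^sub>k\<^sup>(\<^sup>0\<^sup>)\<close>. Taking it to be empty for \<open>k = 0\<close>, where nothing is glued, allows the first space
to be treated like the others.\<close>

definition base :: "'x rsh_decomp \<Rightarrow> nat \<Rightarrow> 'x set" where
  "base D k = (if k = 0 then {} else bdry D k)"

locale valid_rsh =
  fixes D :: "'x rsh_decomp"
  assumes valid: "valid_rsh_decomp D"
begin

lemma closedin_base: "k \<le> top_index D \<Longrightarrow> closedin (rsh_space D k) (base D k)"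
  using valid_rsh_decompD(4)[OF valid, of k] by (auto simp: base_def)

lemma cstar_block: "k \<le> top_index D \<Longrightarrow> cstar_algebra (block D k)"
  by (intro cstar_algebra_C_mat valid_rsh_decompD[OF valid])

lemma cstar_stage: "k \<le> top_index D \<Longrightarrow> cstar_algebra (rsh_stage D k)"
  by (rule cstar_algebra_stage[OF valid])

lemma cstar_bdry:
  assumes "Suc j \<le> top_index D"
  shows "cstar_algebra (bdry_block D (Suc j))"
  using valid_rsh_decompD[OF valid assms]
  by (intro cstar_algebra_C_mat) (simp add: closedin_compact_space compact_space_subtopology)

lemma glue_hom:
  assumes "Suc j \<le> top_index D"
  shows "unital_star_hom (rsh_stage D j)
    (bdry_block D (Suc j)) (glue D (Suc j))"
  using valid_rsh_decompD(5)[OF valid assms] by simp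

lemma glue_closed:
  assumes "Suc j \<le> top_index D" "a \<in> carrier (rsh_stage D j)"
  shows "glue D (Suc j) a
    \<in> carrier (bdry_block D (Suc j))"
  using glue_hom[OF assms(1)] assms(2) by (simp add: unital_star_hom_def star_hom_def)

lemma topspace_bdry:
  assumes "Suc j \<le> top_index D"
  shows "topspace (subtopology (rsh_space D (Suc j)) (bdry D (Suc j))) = bdry D (Suc j)"
  using valid_rsh_decompD(4)[OF valid assms] closedin_subset by fastforce

lemma cdist_stage_le:
  assumes k: "k \<le> top_index D" and r: "r \<in> carrier (rsh_stage D k)" and s: "s \<in> carrier (rsh_stage D k)"
  shows "cdist (rsh_stage D k) r s \<le> b \<longleftrightarrow> (\<forall>i\<le>k. cdist (block D i) (r ! i) (s ! i) \<le> b)"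
proof -
  interpret cstar_algebra "rsh_stage D k" by (rule cstar_stage[OF k])
  let ?s = "cscale (rsh_stage D k) (-1) s"
  have s': "?s \<in> carrier (rsh_stage D k)" using s by (rule scale_closed)
  have "cadd (rsh_stage D k) r ?s \<in> carrier (rsh_stage D k)" using r s' by (rule add_closed)
  note n = stage_ops(5)[OF this this]
  show ?thesis
    unfolding cdist_def n by (simp add: stage_nth[OF r s'] stage_nth[OF s s])
qed

text \<open>This step is used with \<open>Z\<close> empty to lift elements along truncations, and with the zero set of an ideal
to stay within the ideal.\<close>

lemma extend_one_stage:
  assumes j: "Suc j \<le> top_index D" and a: "a \<in> carrier (rsh_stage D j)"
    and Z: "closedin (rsh_space D (Suc j)) Z"
    and zero: "\<And>x. x \<in> bdry D (Suc j) \<Longrightarrow> x \<in> Z \<Longrightarrow> glue D (Suc j) a x = 0\<^sub>m (msize D (Suc j)) (msize D (Suc j))"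
  obtains f where "a @ [f] \<in> carrier (rsh_stage D (Suc j))"
    "\<And>x. x \<in> Z \<Longrightarrow> f x = 0\<^sub>m (msize D (Suc j)) (msize D (Suc j))"
proof -
  note v = valid_rsh_decompD[OF valid j]
  have g: "glue D (Suc j) a
      \<in> carrier (bdry_block D (Suc j))"
    by (rule glue_closed[OF j a])
  have T: "closedin (rsh_space D (Suc j)) (bdry D (Suc j))" using v(4) by simp
  obtain f where "f \<in> carrier (block D (Suc j))" "restrict f (bdry D (Suc j)) = glue D (Suc j) a"
    "\<And>x. x \<in> Z \<Longrightarrow> f x = 0\<^sub>m (msize D (Suc j)) (msize D (Suc j))"
    using C_mat_extend_vanishing[OF v(1,2) T Z g] zero by blast
  then show thesis
    using a by (intro that[of f]) (simp_all only: mem_carrier_stage_Suc simp_thms)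
qed

lemma truncation_surjective:
  assumes "k \<le> j" "j \<le> top_index D" "a \<in> carrier (rsh_stage D k)"
  shows "\<exists>r\<in>carrier (rsh_stage D j). take (Suc k) r = a"
  using assms
proof (induction j rule: dec_induct)
  case base
  then show ?case using carrier_stage_length[of a] by (intro bexI[of _ a]) auto
next
  case (step j)
  then obtain r where r: "r \<in> carrier (rsh_stage D j)" "take (Suc k) r = a" by auto
  obtain f where "r @ [f] \<in> carrier (rsh_stage D (Suc j))"
    using extend_one_stage[OF step.prems(1) r(1), of "{}"] by auto
  moreover have "take (Suc k) (r @ [f]) = a"
    using r carrier_stage_length[OF r(1)] step by simp
  ultimately show ?case by blast
qed

lemma zeros_append_mem:
  assumes k: "k \<le> top_index D" and f: "f \<in> carrier (block D k)"
    and zero: "\<And>x. x \<in> base D k \<Longrightarrow> f x = 0\<^sub>m (msize D k) (msize D k)"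
  shows "zeros D k @ [f] \<in> carrier (rsh_stage D k)"
proof (cases k)
  case 0
  then show ?thesis using f by (simp add: zeros_def transport_simps[OF inj_singleton])
next
  case (Suc j)
  let ?S = "bdry_block D k"
  have z: "zeros D (Suc j) = czero (rsh_stage D j)"
    by (simp add: zeros_def stage_zero del: upt_Suc)
  have j: "Suc j \<le> top_index D" "j \<le> top_index D" using k Suc by auto
  have "glue D (Suc j) (czero (rsh_stage D j)) = czero ?S"
    using glue_hom[OF j(1)] cstar_bdry[OF j(1)] unfolding Suc
    by (intro star_hom_zero[OF cstar_stage[OF j(2)]]) (auto simp: unital_star_hom_def)
  also have "\<dots> = restrict f (bdry D (Suc j))"
    using zero topspace_bdry[OF j(1)] by (auto simp: C_mat_simps base_def Suc fun_eq_iff)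
  finally show ?thesis
    using f cstar_algebra.zero_closed[OF cstar_stage[OF j(2)]]
    unfolding Suc z mem_carrier_stage_Suc by blast
qed

lemma lift_from_block:
  assumes k: "k \<le> top_index D" and f: "f \<in> carrier (block D k)"
    and zero: "\<And>x. x \<in> base D k \<Longrightarrow> f x = 0\<^sub>m (msize D k) (msize D k)"
  shows "\<exists>r\<in>carrier (rsh_stage D (top_index D)). take k r = zeros D k \<and> r ! k = f"
proof -
  obtain r where r: "r \<in> carrier (rsh_stage D (top_index D))" "take (Suc k) r = zeros D k @ [f]"
    using truncation_surjective[OF k order_refl zeros_append_mem[OF assms]] by blast
  have "length r = Suc (top_index D)" using r(1) by (rule carrier_stage_length)
  then have "take k r @ [r ! k] = zeros D k @ [f]"
    using r(2) k by (simp add: take_Suc_conv_app_nth)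
  then show ?thesis using r by auto
qed

end

text \<open>A closed two-sided ideal of the last stage. That its truncations to earlier stages are closed as well is
true but not evident, which is why earlier stages are treated by approximation.\<close>

locale rsh_closed_ideal = valid_rsh D for D :: "'x rsh_decomp" +
  fixes I :: "('x \<Rightarrow> complex Matrix.mat) list set"
  assumes I_carrier: "I \<subseteq> carrier (rsh_stage D (top_index D))"
    and I_zero: "czero (rsh_stage D (top_index D)) \<in> I"
    and I_add: "q \<in> I \<Longrightarrow> r \<in> I \<Longrightarrow> cadd (rsh_stage D (top_index D)) q r \<in> I"
    and I_left: "r \<in> carrier (rsh_stage D (top_index D)) \<Longrightarrow> q \<in> I \<Longrightarrow>
      cmult (rsh_stage D (top_index D)) r q \<in> I"
    and I_right: "r \<in> carrier (rsh_stage D (top_index D)) \<Longrightarrow> q \<in> I \<Longrightarrow>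
      cmult (rsh_stage D (top_index D)) q r \<in> I"
    and I_closed: "r \<in> carrier (rsh_stage D (top_index D)) \<Longrightarrow>
      (\<And>e. 0 < e \<Longrightarrow> \<exists>q\<in>I. cdist (rsh_stage D (top_index D)) r q \<le> e) \<Longrightarrow> r \<in> I"
begin

abbreviation "R \<equiv> rsh_stage D (top_index D)"
abbreviation "zero_block k \<equiv> 0\<^sub>m (msize D k) (msize D k)"

definition Z :: "nat \<Rightarrow> 'x set" where
  "Z k = {x \<in> topspace (rsh_space D k). \<forall>q\<in>I. (q ! k) x = zero_block k}"

definition K :: "nat \<Rightarrow> ('x \<Rightarrow> complex Matrix.mat) set" where
  "K k = {q ! k | q. q \<in> I \<and> take k q = zeros D k}"

lemma I_nth: "q \<in> I \<Longrightarrow> k \<le> top_index D \<Longrightarrow> q ! k \<in> carrier (block D k)"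
  using I_carrier carrier_stage_nth by blast

lemma closedin_Z:
  assumes k: "k \<le> top_index D"
  shows "closedin (rsh_space D k) (Z k)"
proof -
  have "Z k = \<Inter>((\<lambda>q. {x \<in> topspace (rsh_space D k). (q ! k) x = zero_block k}) ` I)"
    using I_zero by (auto simp: Z_def)
  then show ?thesis
    using I_zero closedin_C_mat_zero_set[OF I_nth[OF _ k]] by (simp, intro closedin_Inter) auto
qed

lemma take_eq_zeros_iff:
  assumes q: "q \<in> carrier R" and k: "k \<le> top_index D"
  shows "take k q = zeros D k \<longleftrightarrow> (\<forall>i<k. q ! i = czero (block D i))"
proof -
  have "length q = Suc (top_index D)" using q by (rule carrier_stage_length)
  then show ?thesis using k by (auto simp: zeros_def list_eq_iff_nth_eq)
qed

text \<open>The multiples of a \<open>k\<close>-th component by functions that vanish on \<open>X\<^sub>k\<^sup>(\<^sup>0\<^sup>)\<close> are again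
\<open>k\<close>-th components of elements of \<open>I\<close> that start with zeros, because such functions lift to the
whole algebra.\<close>

lemma ideal_K:
  assumes k: "k \<le> top_index D"
  shows "ideal_of_C_mat (rsh_space D k) (msize D k) (base D k) (K k)"
proof -
  interpret R: cstar_algebra R by (rule cstar_stage[OF order_refl])
  have B: "cstar_algebra (block D i)" if "i < k" for i
    using cstar_block that k by simp
  have lt: "i < k \<Longrightarrow> i \<le> top_index D" for i using k by simp
  have KI: "g \<in> K k \<longleftrightarrow> (\<exists>q\<in>I. g = q ! k \<and> (\<forall>i<k. q ! i = czero (block D i)))" for g
    using take_eq_zeros_iff[OF _ k] I_carrier unfolding K_def by blast
  show ?thesis
  proof
    show "compact_space (rsh_space D k)" "Hausdorff_space (rsh_space D k)"
      by (rule valid_rsh_decompD[OF valid k])+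
    show "closedin (rsh_space D k) (base D k)" by (rule closedin_base[OF k])
    show "K k \<subseteq> carrier (block D k)" using I_nth k by (auto simp: KI)
    show "czero (block D k) \<in> K k"
      unfolding KI using I_zero k
      by (intro bexI[of _ "czero R"]) (auto simp: stage_nth(5)[OF R.zero_closed R.zero_closed])
  next
    fix f g assume "f \<in> K k" "g \<in> K k"
    then obtain p q where pq: "p \<in> I" "q \<in> I" "f = p ! k" "g = q ! k"
      "\<forall>i<k. p ! i = czero (block D i)" "\<forall>i<k. q ! i = czero (block D i)"
      by (auto simp: KI)
    have c: "p \<in> carrier R" "q \<in> carrier R" using pq I_carrier by auto
    show "cadd (block D k) f g \<in> K k"
      unfolding KI using I_add[OF pq(1,2)] pq
      by (intro bexI[of _ "cadd R p q"])
         (auto simp: stage_nth(1)[OF c] k lt cstar_algebra.add_zero[OF B] cstar_algebra.zero_closed[OF B])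
  next
    fix f g assume f: "f \<in> carrier (block D k)" "\<And>x. x \<in> base D k \<Longrightarrow> f x = zero_block k" and "g \<in> K k"
    then obtain q where q: "q \<in> I" "g = q ! k" "\<forall>i<k. q ! i = czero (block D i)"
      by (auto simp: KI)
    obtain r where r: "r \<in> carrier R" "r ! k = f"
      using lift_from_block[OF k f] by blast
    have c: "q \<in> carrier R" using q I_carrier by auto
    show "cmult (block D k) f g \<in> K k"
      unfolding KI using I_left[OF r(1) q(1)] q r
      by (intro bexI[of _ "cmult R r q"])
         (auto simp: stage_nth(2)[OF r(1) c] k lt cstar_algebra.mult_zero[OF B] carrier_stage_nth)
    show "cmult (block D k) g f \<in> K k"
      unfolding KI using I_right[OF r(1) q(1)] q r
      by (intro bexI[of _ "cmult R q r"])
         (auto simp: stage_nth(2)[OF c r(1)] k lt cstar_algebra.zero_mult[OF B] carrier_stage_nth)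
  qed
qed

text \<open>A common zero of \<open>K k\<close> outside \<open>X\<^sub>k\<^sup>(\<^sup>0\<^sup>)\<close> lies in \<open>Z k\<close>: an element of \<open>I\<close> can be multiplied by a lift of a
scalar function that vanishes on \<open>X\<^sub>k\<^sup>(\<^sup>0\<^sup>)\<close> and is \<open>1\<close> at the given point, which turns its \<open>k\<close>-th
component into an element of \<open>K k\<close> with the same value there.\<close>

lemma block_approximation:
  assumes k: "k \<le> top_index D" and f: "f \<in> carrier (block D k)"
    and fb: "\<And>x. x \<in> base D k \<Longrightarrow> f x = zero_block k" and fZ: "\<And>x. x \<in> Z k \<Longrightarrow> f x = zero_block k"
    and e: "0 < e"
  shows "\<exists>q\<in>I. take k q = zeros D k \<and> cdist (block D k) f (q ! k) \<le> e"
proof -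
  interpret K: ideal_of_C_mat "rsh_space D k" "msize D k" "base D k" "K k"
    by (rule ideal_K[OF k])
  have "f x = zero_block k" if x: "x \<in> topspace (rsh_space D k)" and Kx: "\<And>g. g \<in> K k \<Longrightarrow> g x = zero_block k" for x
  proof (cases "x \<in> base D k")
    case False
    have "closedin (rsh_space D k) {x}"
      using K.X x by (simp add: closedin_Hausdorff_singleton)
    moreover have "disjnt (base D k) {x}" using False by (simp add: disjnt_def)
    ultimately obtain u where u: "continuous_map (rsh_space D k) euclideanreal u"
      and u': "u ` base D k \<subseteq> {0}" "u ` {x} \<subseteq> {1}"
      using Urysohn_lemma_alt[OF compact_Hausdorff_normal[OF K.X] K.T] by metis
    have "(q ! k) x = zero_block k" if q: "q \<in> I" for q
    proof -
      define g where "g = (\<lambda>y\<in>topspace (rsh_space D k). complex_of_real (u y) \<cdot>\<^sub>m 1\<^sub>m (msize D k))"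
      have "C_one (rsh_space D k) (msize D k) \<in> carrier (block D k)"
        using C_one_identity[of "rsh_space D k" "msize D k"] unfolding is_identity_def by blast
      from C_mat_smult_fun[OF continuous_map_of_real[OF u] this]
      have g: "g \<in> carrier (block D k)"
        by (simp add: g_def C_one_def cong: restrict_cong)
      have g0: "g y = zero_block k" if "y \<in> base D k" for y
        using that u' closedin_subset[OF K.T] by (auto simp: g_def image_subset_iff intro!: eq_matI)
      obtain r where r: "r \<in> carrier R" "take k r = zeros D k" "r ! k = g"
        using lift_from_block[OF k g g0] by blast
      have c: "q \<in> carrier R" using q I_carrier by auto
      have "cmult R r q \<in> I" using I_left[OF r(1) q] .
      moreover have "take k (cmult R r q) = zeros D k"
      proof -
        have *: "\<forall>i<k. r ! i = czero (block D i)" using r take_eq_zeros_iff[OF r(1) k] by simp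
        have "cmult R r q \<in> carrier R" using \<open>cmult R r q \<in> I\<close> I_carrier by auto
        then show ?thesis
          using * k take_eq_zeros_iff cstar_algebra.zero_mult[OF cstar_block]
          by (auto simp: stage_nth(2)[OF r(1) c] carrier_stage_nth[OF c])
      qed
      ultimately have "cmult R r q ! k \<in> K k" unfolding K_def by blast
      then have "(cmult (block D k) g (q ! k)) x = zero_block k"
        using Kx by (simp add: stage_nth(2)[OF r(1) c k] r)
      moreover have "(cmult (block D k) g (q ! k)) x = (q ! k) x"
        using x u' C_mat_carrierD(2)[OF I_nth[OF q k] x] by (simp add: C_mat_apply g_def) (intro eq_matI, auto)
      ultimately show ?thesis by simp
    qed
    then show ?thesis using fZ x by (simp add: Z_def)
  qed (use fb in blast)
  from K.vanishing_imp_approximable[OF f fb this e] show ?thesis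
    unfolding K_def by blast
qed

text \<open>Induction on the stage. Let \<open>q\<close> in \<open>I\<close> approximate the components of \<open>r\<close> before the last one. The last
component \<open>w\<close> of \<open>r - q\<close> vanishes on the zero set of \<open>I\<close>, and it is small on the subset along which it is
glued, because there it is the image of the truncation of \<open>r - q\<close>, which is small, under a contractive map. So
cutting off small values changes \<open>w\<close> little and produces a function that vanishes on both sets. This
function is approximated by an element of \<open>I\<close> without earlier components, which is added to \<open>q\<close>.\<close>

theorem hull_kernel_approximation:
  assumes "j \<le> top_index D" "r \<in> carrier (rsh_stage D j)"
    and "\<And>i x. i \<le> j \<Longrightarrow> x \<in> Z i \<Longrightarrow> (r ! i) x = zero_block i" and "0 < e"
  shows "\<exists>q\<in>I. \<forall>i\<le>j. cdist (block D i) (r ! i) (q ! i) \<le> e"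
  using assms
proof (induction j arbitrary: r e)
  case 0
  have "r ! 0 \<in> carrier (block D 0)" using carrier_stage_nth[OF 0(2)] by simp
  then show ?case
    using block_approximation[of 0 "r ! 0" e] 0 by (auto simp: base_def)
next
  case (Suc j)
  let ?k = "Suc j" and ?B = "block D (Suc j)"
  let ?S = "bdry_block D ?k"
  have j: "j \<le> top_index D" using Suc.prems by simp
  interpret R: cstar_algebra R by (rule cstar_stage[OF order_refl])
  interpret B: cstar_algebra ?B by (rule cstar_block[OF Suc.prems(1)])
  note X = valid_rsh_decompD[OF valid Suc.prems(1)]
  have T: "bdry D ?k \<subseteq> topspace (rsh_space D ?k)" using X(4) closedin_subset by auto
  define N where "N = real (msize D ?k * msize D ?k)"
  have N: "N > 0" using X(3) by (simp add: N_def)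
  \<comment> \<open>Cutting off costs \<open>N * e'\<close>, since the entry sum is at most \<open>N\<close> times the operator norm, and the
    approximation after it costs another \<open>e'\<close>.\<close>
  define e' where "e' = e / (N + 1)"
  have e': "0 < e'" using Suc.prems N by (simp add: e'_def)
  have rj: "take ?k r \<in> carrier (rsh_stage D j)"
    using carrier_stage_take[OF Suc.prems(2), of j] by simp
  obtain q where q: "q \<in> I" and qd: "\<And>i. i \<le> j \<Longrightarrow> cdist (block D i) (r ! i) (q ! i) \<le> e'"
    using Suc.IH[OF j rj _ e'] Suc.prems(3) by auto
  have qc: "q \<in> carrier R" using q I_carrier by auto
  have qj: "take ?k q \<in> carrier (rsh_stage D j)" using carrier_stage_take[OF qc j] .
  define f where "f = r ! ?k"
  have f: "f \<in> carrier ?B" using carrier_stage_nth[OF Suc.prems(2)] by (simp add: f_def)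
  have qk: "q ! ?k \<in> carrier ?B" by (rule I_nth[OF q Suc.prems(1)])
  define w where "w = cadd ?B f (cscale ?B (-1) (q ! ?k))"
  have w: "w \<in> carrier ?B" unfolding w_def by (intro B.add_closed B.scale_closed f qk)
  have w_bdry: "op_norm (w x) \<le> e'" if x: "x \<in> bdry D ?k" for x
  proof -
    have "cdist ?S (glue D ?k (take ?k r)) (glue D ?k (take ?k q)) \<le> cdist (rsh_stage D j) (take ?k r) (take ?k q)"
      by (rule unital_star_hom_cdist_le[OF cstar_stage[OF j] cstar_bdry[OF Suc.prems(1)]
            glue_hom[OF Suc.prems(1)] rj qj])
    also have "\<dots> \<le> e'"
      unfolding cdist_stage_le[OF j rj qj] using qd by simp
    also have "cdist ?S (glue D ?k (take ?k r)) (glue D ?k (take ?k q))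
        = cdist ?S (restrict f (bdry D ?k)) (restrict (q ! ?k) (bdry D ?k))"
      using carrier_stage_glue[OF Suc.prems(2), of j] carrier_stage_glue[OF qc Suc.prems(1)]
      by (simp add: f_def)
    also have "\<dots> = cnorm ?S (restrict w (bdry D ?k))"
      using star_hom_diff[OF cstar_block[OF Suc.prems(1)], of ?S "\<lambda>f. restrict f (bdry D ?k)" f "q ! ?k"]
        unital_star_hom_restrict[OF T] f qk
      by (simp add: cdist_def w_def unital_star_hom_def)
    finally have "cnorm ?S (restrict w (bdry D ?k)) \<le> e'" .
    moreover have "op_norm (restrict w (bdry D ?k) x) \<le> cnorm ?S (restrict w (bdry D ?k))"
      using x topspace_bdry[OF Suc.prems(1)] X(1,4)
      by (intro op_norm_le_cnorm_C_mat C_mat_subtopology_restrict[OF w T])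
         (simp_all add: closedin_compact_space compact_space_subtopology)
    ultimately show ?thesis using x by simp
  qed
  obtain g where g: "g \<in> carrier ?B" "cdist ?B w g \<le> N * e'"
    and g0: "\<And>x. x \<in> topspace (rsh_space D ?k) \<Longrightarrow> entry_sum (w x) \<le> N * e' \<Longrightarrow> g x = zero_block ?k"
    using cutoff[OF X(1) w, of "N * e'"] N e' by auto
  have gb: "g x = zero_block ?k" if x: "x \<in> base D ?k" for x
  proof -
    have x': "x \<in> bdry D ?k" "x \<in> topspace (rsh_space D ?k)" using x T by (auto simp: base_def)
    have "entry_sum (w x) \<le> N * op_norm (w x)"
      unfolding N_def by (rule entry_sum_le_op_norm[OF C_mat_carrierD(2)[OF w x'(2)]])
    also have "\<dots> \<le> N * e'" using w_bdry[OF x'(1)] N by (intro mult_left_mono) auto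
    finally show ?thesis using g0[OF x'(2)] by simp
  qed
  have gZ: "g x = zero_block ?k" if x: "x \<in> Z ?k" for x
  proof -
    have xX: "x \<in> topspace (rsh_space D ?k)" using x by (simp add: Z_def)
    have "f x = zero_block ?k" "(q ! ?k) x = zero_block ?k"
      using Suc.prems(3)[of ?k x] x q by (auto simp: Z_def f_def)
    then have "w x = zero_block ?k" using xX by (auto simp: w_def C_mat_apply intro!: eq_matI)
    then have "entry_sum (w x) = 0" by (simp add: entry_sum_def)
    then show ?thesis using g0[OF xX] N e' by simp
  qed
  obtain p where p: "p \<in> I" "take ?k p = zeros D ?k" "cdist ?B g (p ! ?k) \<le> e'"
    using block_approximation[OF Suc.prems(1) g(1) gb gZ e'] by blast
  have pc: "p \<in> carrier R" using p I_carrier by auto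
  have pk: "p ! ?k \<in> carrier ?B" by (rule I_nth[OF p(1) Suc.prems(1)])
  have "cdist (block D i) (r ! i) (cadd R q p ! i) \<le> e" if i: "i \<le> ?k" for i
  proof (cases "i = ?k")
    case True
    have sum: "cadd R q p ! ?k = cadd ?B (q ! ?k) (p ! ?k)"
      by (rule stage_nth(1)[OF qc pc Suc.prems(1)])
    have "cadd ?B f (cscale ?B (-1) (cadd ?B (q ! ?k) (p ! ?k))) = cadd ?B w (cscale ?B (-1) (p ! ?k))"
      using f qk pk by (simp add: w_def B.scale_add_right B.add_assoc B.closed)
    then have "cdist ?B f (cadd R q p ! ?k) = cdist ?B w (p ! ?k)"
      by (simp add: cdist_def sum)
    also have "\<dots> \<le> N * e' + e'"
      using B.cdist_triangle[OF w g(1) pk] g(2) p(3) by simp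
    also have "\<dots> = e' * (N + 1)" by (simp add: algebra_simps)
    also have "\<dots> = e" using N by (simp add: e'_def)
    finally show ?thesis using True by (simp add: f_def)
  next
    case False
    then have i': "i \<le> j" "i \<le> top_index D" using i j by auto
    have "p ! i = czero (block D i)"
      using p(2) take_eq_zeros_iff[OF pc Suc.prems(1)] i' by simp
    then have "cadd R q p ! i = q ! i"
      using stage_nth(1)[OF qc pc i'(2)] cstar_algebra.add_zero[OF cstar_block[OF i'(2)] I_nth[OF q i'(2)]]
      by simp
    moreover have "e' \<le> e" using Suc.prems(4) N by (simp add: e'_def field_simps)
    ultimately show ?thesis using qd[OF i'(1)] by simp
  qed
  then show ?case using I_add[OF q p(1)] by blast
qed

corollary mem_ideal_iff:
  assumes r: "r \<in> carrier R"
  shows "r \<in> I \<longleftrightarrow> (\<forall>i\<le>top_index D. \<forall>x\<in>Z i. (r ! i) x = zero_block i)"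
proof
  assume v: "\<forall>i\<le>top_index D. \<forall>x\<in>Z i. (r ! i) x = zero_block i"
  show "r \<in> I"
  proof (rule I_closed[OF r])
    fix e :: real assume "0 < e"
    then obtain q where q: "q \<in> I" "\<forall>i\<le>top_index D. cdist (block D i) (r ! i) (q ! i) \<le> e"
      using hull_kernel_approximation[OF order_refl r] v by blast
    then show "\<exists>q\<in>I. cdist R r q \<le> e"
      using cdist_stage_le[OF order_refl r] I_carrier by blast
  qed
qed (auto simp: Z_def)

text \<open>The components after the \<open>k\<close>-th are chosen one at a time. The gluing map sends what has been
chosen so far to a limit of restrictions of components of elements of \<open>I\<close>, by
\<open>hull_kernel_approximation\<close>; so its value vanishes on the zero set of \<open>I\<close>, and extends to a function that vanishes
there.\<close>

lemma extend_in_ideal: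
  assumes k: "k \<le> j" "j \<le> top_index D" and f: "f \<in> carrier (block D k)"
    and fb: "\<And>x. x \<in> base D k \<Longrightarrow> f x = zero_block k" and fZ: "\<And>x. x \<in> Z k \<Longrightarrow> f x = zero_block k"
  shows "\<exists>r\<in>carrier (rsh_stage D j). take (Suc k) r = zeros D k @ [f] \<and>
    (\<forall>i\<le>j. \<forall>x\<in>Z i. (r ! i) x = zero_block i)"
  using k
proof (induction j rule: dec_induct)
  case base
  have "zeros D k @ [f] \<in> carrier (rsh_stage D k)"
    by (rule zeros_append_mem[OF base f fb])
  moreover have "((zeros D k @ [f]) ! i) x = zero_block i" if "i \<le> k" "x \<in> Z i" for i x
    using that fZ by (cases "i = k") (auto simp: zeros_def nth_append C_mat_simps Z_def)
  ultimately show ?case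
    by (intro bexI[of _ "zeros D k @ [f]"]) (auto simp: zeros_def)
next
  case (step j)
  let ?k = "Suc j"
  let ?S = "bdry_block D ?k"
  have j: "j \<le> top_index D" using step.prems by simp
  obtain r where r: "r \<in> carrier (rsh_stage D j)" "take (Suc k) r = zeros D k @ [f]"
    and rZ: "\<And>i x. i \<le> j \<Longrightarrow> x \<in> Z i \<Longrightarrow> (r ! i) x = zero_block i"
    using step by auto
  have gc: "glue D ?k a \<in> carrier ?S" if "a \<in> carrier (rsh_stage D j)" for a
    by (rule glue_closed[OF step.prems that])
  have top: "topspace (subtopology (rsh_space D ?k) (bdry D ?k)) = bdry D ?k"
    by (rule topspace_bdry[OF step.prems])
  have "glue D ?k r x = zero_block ?k" if x: "x \<in> bdry D ?k" "x \<in> Z ?k" for x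
  proof -
    have gx: "glue D ?k r x \<in> carrier_mat (msize D ?k) (msize D ?k)"
      by (rule C_mat_carrierD(2)[OF gc[OF r(1)]]) (use x top in simp)
    have "op_norm (glue D ?k r x) \<le> 0 + e" if e: "0 < e" for e
    proof -
      obtain q where q: "q \<in> I" and qd: "\<forall>i\<le>j. cdist (block D i) (r ! i) (q ! i) \<le> e"
        using hull_kernel_approximation[OF j r(1) rZ e] by blast
      have qc: "q \<in> carrier R" using q I_carrier by auto
      have qj: "take ?k q \<in> carrier (rsh_stage D j)" using carrier_stage_take[OF qc j] .
      let ?d = "cadd ?S (glue D ?k r) (cscale ?S (-1) (glue D ?k (take ?k q)))"
      interpret S: cstar_algebra ?S by (rule cstar_bdry[OF step.prems])
      have "op_norm (?d x) \<le> cnorm ?S ?d"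
        using valid_rsh_decompD(1,4)[OF valid step.prems] x top
        by (intro op_norm_le_cnorm_C_mat S.add_closed S.scale_closed gc r qj)
           (simp_all add: closedin_compact_space compact_space_subtopology)
      also have "\<dots> \<le> cdist (rsh_stage D j) r (take ?k q)"
        using unital_star_hom_cdist_le[OF cstar_stage[OF j] cstar_bdry[OF step.prems]
            glue_hom[OF step.prems] r(1) qj] by (simp add: cdist_def)
      also have "\<dots> \<le> e"
        unfolding cdist_stage_le[OF j r(1) qj] using qd by simp
      also have "?d x = glue D ?k r x"
      proof -
        have "glue D ?k (take ?k q) x = zero_block ?k"
          using carrier_stage_glue[OF qc step.prems] x q by (simp add: Z_def)
        then show ?thesis
          using x top gx by (intro eq_matI) (auto simp: C_mat_simps)
      qed
      finally show ?thesis by simp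
    qed
    then have "op_norm (glue D ?k r x) \<le> 0" by (rule field_le_epsilon)
    then show ?thesis using op_norm_eq_0[OF gx] op_norm_nonneg[OF gx] by simp
  qed
  then obtain g where g: "r @ [g] \<in> carrier (rsh_stage D ?k)" "\<And>x. x \<in> Z ?k \<Longrightarrow> g x = zero_block ?k"
    using extend_one_stage[OF step.prems r(1) closedin_Z[OF step.prems]] by blast
  have len: "length r = Suc j" using r(1) by (rule carrier_stage_length)
  have "((r @ [g]) ! i) x = zero_block i" if "i \<le> ?k" "x \<in> Z i" for i x
    using that rZ g(2) len by (cases "i = ?k") (auto simp: nth_append)
  moreover have "take (Suc k) (r @ [g]) = zeros D k @ [f]"
    using r(2) len step by simp
  ultimately show ?case using g(1) by blast
qed

theorem ideal_extension:
  assumes k: "k \<le> top_index D" and f: "f \<in> carrier (block D k)"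
    and f0: "\<And>x. x \<in> base D k \<union> Z k \<Longrightarrow> f x = zero_block k"
  shows "\<exists>q\<in>I. take k q = zeros D k \<and> q ! k = f"
proof -
  obtain r where r: "r \<in> carrier R" "take (Suc k) r = zeros D k @ [f]"
    and rZ: "\<forall>i\<le>top_index D. \<forall>x\<in>Z i. (r ! i) x = zero_block i"
    using extend_in_ideal[OF k order_refl f] f0 by blast
  have "length r = Suc (top_index D)" using r(1) by (rule carrier_stage_length)
  then have "take k r @ [r ! k] = zeros D k @ [f]"
    using r(2) k by (simp add: take_Suc_conv_app_nth)
  then show ?thesis using mem_ideal_iff[OF r(1)] rZ by auto
qed

text \<open>The converse of \<open>ideal_extension\<close>; on \<open>X\<^sub>k\<^sup>(\<^sup>0\<^sup>)\<close> the function is the image of \<open>0\<close> under gluing.\<close>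

lemma ideal_vanishes:
  assumes k: "k \<le> top_index D" and q: "q \<in> I" "take k q = zeros D k" and x: "x \<in> base D k \<union> Z k"
  shows "(q ! k) x = zero_block k"
proof (cases "x \<in> Z k")
  case False
  then have "x \<in> base D k" using x by simp
  then obtain j where j: "k = Suc j" and xb: "x \<in> bdry D k" by (cases k) (auto simp: base_def)
  have qc: "q \<in> carrier R" using q I_carrier by auto
  let ?S = "bdry_block D k"
  have j': "Suc j \<le> top_index D" "j \<le> top_index D" using k j by auto
  have "restrict (q ! k) (bdry D k) = glue D k (zeros D k)"
    using carrier_stage_glue[OF qc j'(1)] q(2) j by simp
  also have "\<dots> = czero ?S"
    using star_hom_zero[OF cstar_stage[OF j'(2)] cstar_bdry[OF j'(1)]]
      glue_hom[OF j'(1)] by (simp add: zeros_def stage_zero j unital_star_hom_def del: upt_Suc)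
  finally have "restrict (q ! k) (bdry D k) x = czero ?S x" by simp
  moreover have "x \<in> topspace (subtopology (rsh_space D k) (bdry D k))"
    using xb topspace_bdry[OF j'(1)] unfolding j by blast
  ultimately show ?thesis
    using xb by (simp only: C_mat_apply(2) restrict_apply if_True)
qed (use q in \<open>simp add: Z_def\<close>)

end

section \<open>Pullbacks of decompositions over the same type of points\<close>

text \<open>The algebras \<open>A\<close> and \<open>B\<close> are here identified with the last stages of their decompositions.\<close>

locale rsh_pullback =
  fixes DA DB :: "'z rsh_decomp" and C :: "'c cstar_alg"
    and \<phi> \<rho> :: "('z \<Rightarrow> complex Matrix.mat) list \<Rightarrow> 'c"
  assumes validA: "valid_rsh_decomp DA" and validB: "valid_rsh_decomp DB" and C: "cstar_algebra C"
    and \<phi>: "unital_star_hom (rsh_stage DA (top_index DA)) C \<phi>"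
    and \<rho>: "star_hom (rsh_stage DB (top_index DB)) C \<rho>"
    and \<rho>_surj: "\<rho> ` carrier (rsh_stage DB (top_index DB)) = carrier C"
begin

abbreviation (input) "a \<equiv> top_index DA"
abbreviation (input) "b \<equiv> top_index DB"
abbreviation "RA \<equiv> rsh_stage DA (top_index DA)"
abbreviation "RB \<equiv> rsh_stage DB (top_index DB)"

lemma cstar_RA: "cstar_algebra RA" and cstar_RB: "cstar_algebra RB"
  by (rule cstar_algebra_stage[OF validA order_refl] cstar_algebra_stage[OF validB order_refl])+

lemma \<rho>_unital: "unital_star_hom RB C \<rho>"
  using stage_one_identity[OF validB order_refl] surjective_star_hom_identity[OF \<rho> \<rho>_surj] \<rho>
  unfolding unital_star_hom_def by blast

definition kernel :: "('z \<Rightarrow> complex Matrix.mat) list set" where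
  "kernel = {r \<in> carrier RB. \<rho> r = czero C}"

sublocale kernel: rsh_closed_ideal DB kernel
proof
  interpret C: cstar_algebra C by (rule C)
  interpret RB: cstar_algebra RB by (rule cstar_RB)
  note h = star_homD[OF \<rho>] star_hom_zero[OF cstar_RB C \<rho>]
  show "valid_rsh_decomp DB" by (rule validB)
  show "kernel \<subseteq> carrier RB" by (auto simp: kernel_def)
  show "czero RB \<in> kernel" by (simp add: kernel_def h RB.closed)
  show "cadd RB q r \<in> kernel" if "q \<in> kernel" "r \<in> kernel" for q r
    using that by (simp add: kernel_def h RB.closed C.add_zero C.zero_closed)
  show "cmult RB r q \<in> kernel" "cmult RB q r \<in> kernel" if "r \<in> carrier RB" "q \<in> kernel" for q r
    using that by (simp_all add: kernel_def h RB.closed C.mult_zero C.zero_mult)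
  fix r assume r: "r \<in> carrier RB" and lim: "\<And>e. 0 < e \<Longrightarrow> \<exists>q\<in>kernel. cdist RB r q \<le> e"
  have "cnorm C (\<rho> r) \<le> 0 + e" if e: "0 < e" for e
  proof -
    obtain q where q: "q \<in> carrier RB" "\<rho> q = czero C" "cdist RB r q \<le> e"
      using lim[OF e] by (auto simp: kernel_def)
    have "cdist C (\<rho> r) (\<rho> q) \<le> cdist RB r q"
      by (rule unital_star_hom_cdist_le[OF cstar_RB C \<rho>_unital r q(1)])
    moreover have "cdist C (\<rho> r) (\<rho> q) = cnorm C (\<rho> r)"
      using r by (simp add: cdist_def q C.scale_zero C.add_zero h)
    ultimately show ?thesis using q by simp
  qed
  then have "cnorm C (\<rho> r) \<le> 0" by (rule field_le_epsilon)
  then show "r \<in> kernel"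
    using r C.norm_eq_zero[of "\<rho> r"] C.norm_nonneg[of "\<rho> r"] h(1) by (simp add: kernel_def)
qed

definition Y :: "nat \<Rightarrow> 'z set" where
  "Y m = base DB m \<union> kernel.Z m"

lemma closedin_Y: "m \<le> b \<Longrightarrow> closedin (rsh_space DB m) (Y m)"
  unfolding Y_def by (intro closedin_Un kernel.closedin_base kernel.closedin_Z)

lemma Y_subset: "m \<le> b \<Longrightarrow> Y m \<subseteq> topspace (rsh_space DB m)"
  using closedin_Y closedin_subset by blast

text \<open>The choice of \<open>r\<close> is immaterial: two choices agree on \<open>Y m\<close>, by \<open>fibre_agrees_on_Y\<close> below.\<close>

definition glueY :: "nat \<Rightarrow> ('z \<Rightarrow> complex Matrix.mat) list \<Rightarrow> 'z \<Rightarrow> complex Matrix.mat" where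
  "glueY m s = restrict ((SOME r. r \<in> carrier RB \<and> take m r = drop (Suc a) s \<and>
     \<phi> (take (Suc a) s) = \<rho> r) ! m) (Y m)"

text \<open>The spaces of \<open>DA\<close> followed by those of \<open>DB\<close>; the \<open>m\<close>-th space of \<open>DB\<close> gets the index
\<open>top_index DA + 1 + m\<close>.\<close>

definition D :: "'z rsh_decomp" where
  "D = \<lparr>top_index = Suc (a + b),
     rsh_space = (\<lambda>i. if i \<le> a then rsh_space DA i else rsh_space DB (i - Suc a)),
     msize = (\<lambda>i. if i \<le> a then msize DA i else msize DB (i - Suc a)),
     bdry = (\<lambda>i. if i \<le> a then bdry DA i else Y (i - Suc a)),
     glue = (\<lambda>i. if i \<le> a then glue DA i else glueY (i - Suc a))\<rparr>"

lemma D_low: "i \<le> a \<Longrightarrow> rsh_space D i = rsh_space DA i" "i \<le> a \<Longrightarrow> msize D i = msize DA i"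
  "i \<le> a \<Longrightarrow> bdry D i = bdry DA i" "i \<le> a \<Longrightarrow> glue D i = glue DA i"
  by (simp_all add: D_def)

lemma D_high: "rsh_space D (Suc (a + m)) = rsh_space DB m" "msize D (Suc (a + m)) = msize DB m"
  "bdry D (Suc (a + m)) = Y m" "glue D (Suc (a + m)) = glueY m"
  by (simp_all add: D_def)

lemma stage_low: "i \<le> a \<Longrightarrow> rsh_stage D i = rsh_stage DA i"
  by (induction i) (simp_all add: D_low)

text \<open>The difference of \<open>r\<close> and \<open>r'\<close> lies in the kernel, and its first \<open>m\<close> components are zero.\<close>

lemma fibre_agrees_on_Y:
  assumes m: "m \<le> b" and r: "r \<in> carrier RB" and r': "r' \<in> carrier RB"
    and eq: "take m r = take m r'" "\<rho> r = \<rho> r'"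
  shows "restrict (r ! m) (Y m) = restrict (r' ! m) (Y m)"
proof (rule restrict_ext)
  interpret RB: cstar_algebra RB by (rule cstar_RB)
  interpret C: cstar_algebra C by (rule C)
  let ?n = "cscale RB (-1) r'"
  have n: "?n \<in> carrier RB" using r' by (rule RB.scale_closed)
  let ?d = "cadd RB r ?n"
  have d: "?d \<in> carrier RB" using r n by (rule RB.add_closed)
  have dn: "?d ! i = cadd (block DB i) (r ! i) (cscale (block DB i) (-1) (r' ! i))" if "i \<le> b" for i
    using stage_nth(1)[OF r n that] stage_nth(3)[OF r' r' that] by simp
  have "?d \<in> kernel"
    using d star_hom_diff[OF cstar_RB \<rho> r r'] eq(2) C.add_inverse[of "\<rho> r'"] star_homD(1)[OF \<rho> r']
    by (simp add: kernel_def)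
  moreover have "take m ?d = zeros DB m"
  proof -
    have "?d ! i = czero (block DB i)" if i: "i < m" for i
    proof -
      have "r ! i = r' ! i" using eq(1) i by (metis nth_take)
      then show ?thesis
        using dn[of i] i m carrier_stage_nth[OF r', of i]
          cstar_algebra.add_inverse[OF kernel.cstar_block] by simp
    qed
    then show ?thesis using kernel.take_eq_zeros_iff[OF d m] by simp
  qed
  ultimately have zero: "(?d ! m) x = 0\<^sub>m (msize DB m) (msize DB m)" if "x \<in> Y m" for x
    using kernel.ideal_vanishes[OF m] that by (simp add: Y_def)
  fix x assume x: "x \<in> Y m"
  then have xX: "x \<in> topspace (rsh_space DB m)" using Y_subset[OF m] by auto
  have c: "(r ! m) x \<in> carrier_mat (msize DB m) (msize DB m)" "(r' ! m) x \<in> carrier_mat (msize DB m) (msize DB m)"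
    using C_mat_carrierD(2)[OF carrier_stage_nth[OF r m] xX]
      C_mat_carrierD(2)[OF carrier_stage_nth[OF r' m] xX] by auto
  have "(r ! m) x + (-1) \<cdot>\<^sub>m (r' ! m) x = 0\<^sub>m (msize DB m) (msize DB m)"
    using zero[OF x] dn[OF m] xX by (simp add: C_mat_apply)
  then have "index_mat ((r ! m) x + (-1) \<cdot>\<^sub>m (r' ! m) x) (i, j) = 0" if "i < msize DB m" "j < msize DB m" for i j
    using that by simp
  then show "(r ! m) x = (r' ! m) x"
    using c by (intro eq_matI) auto
qed

lemma glueY_eq:
  assumes m: "m \<le> b" and p: "p \<in> carrier RA" and r: "r \<in> carrier RB" and eq: "\<phi> p = \<rho> r"
  shows "glueY m (p @ take m r) = restrict (r ! m) (Y m)"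
proof -
  have len: "length p = Suc a" using p by (rule carrier_stage_length)
  define r' where "r' = (SOME r'. r' \<in> carrier RB \<and> take m r' = take m r \<and> \<phi> p = \<rho> r')"
  have r': "r' \<in> carrier RB \<and> take m r' = take m r \<and> \<phi> p = \<rho> r'"
    unfolding r'_def by (rule someI[of _ r]) (use r eq in simp)
  have "glueY m (p @ take m r) = restrict (r' ! m) (Y m)"
    using len by (simp add: glueY_def r'_def)
  also have "\<dots> = restrict (r ! m) (Y m)"
    using r' r eq by (intro fibre_agrees_on_Y[OF m]) auto
  finally show ?thesis .
qed

text \<open>The function \<open>f - r\<^sub>m\<close> vanishes on \<open>Y m\<close>, so it is the \<open>m\<close>-th component of an element of the kernel
whose earlier components are zero. That element is added to \<open>r\<close>.\<close>

lemma fibre_extension: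
  assumes m: "m \<le> b" and r: "r \<in> carrier RB" and f: "f \<in> carrier (block DB m)"
    and eq: "restrict (r ! m) (Y m) = restrict f (Y m)"
  shows "\<exists>r'\<in>carrier RB. take m r' = take m r \<and> r' ! m = f \<and> \<rho> r' = \<rho> r"
proof -
  interpret RB: cstar_algebra RB by (rule cstar_RB)
  interpret C: cstar_algebra C by (rule C)
  interpret B: cstar_algebra "block DB m" by (rule kernel.cstar_block[OF m])
  have rm: "r ! m \<in> carrier (block DB m)" by (rule carrier_stage_nth[OF r m])
  let ?g = "cadd (block DB m) f (cscale (block DB m) (-1) (r ! m))"
  have g: "?g \<in> carrier (block DB m)" by (intro B.closed f rm)
  have g0: "?g x = 0\<^sub>m (msize DB m) (msize DB m)" if x: "x \<in> Y m" for x
  proof -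
    have xX: "x \<in> topspace (rsh_space DB m)" using Y_subset[OF m] x by auto
    have "(r ! m) x = f x" using eq x by (metis restrict_apply')
    then show ?thesis
      using xX C_mat_carrierD(2)[OF f xX] by (auto simp: C_mat_apply intro!: eq_matI)
  qed
  obtain q where q: "q \<in> kernel" "take m q = zeros DB m" "q ! m = ?g"
    using kernel.ideal_extension[OF m g] g0 by (auto simp: Y_def)
  have qc: "q \<in> carrier RB" "\<rho> q = czero C" using q by (auto simp: kernel_def)
  let ?r = "cadd RB r q"
  have rc: "?r \<in> carrier RB" by (intro RB.add_closed r qc)
  have "?r ! m = f"
    using stage_nth(1)[OF r qc(1) m] f rm
    by (simp add: q(3) B.add_commute[of "r ! m"] B.closed B.add_neg_cancel)
  moreover have "take m ?r = take m r"
  proof (rule nth_equalityI)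
    fix i assume "i < length (take m ?r)"
    then have i: "i < m" "i \<le> b" using m by auto
    have "q ! i = czero (block DB i)" using q(2) kernel.take_eq_zeros_iff[OF qc(1) m] i by simp
    then show "take m ?r ! i = take m r ! i"
      using i stage_nth(1)[OF r qc(1) i(2)] carrier_stage_nth[OF r i(2)]
        cstar_algebra.add_zero[OF kernel.cstar_block[OF i(2)]] by simp
  qed (simp add: carrier_stage_length[OF r] carrier_stage_length[OF rc])
  moreover have "\<rho> ?r = \<rho> r"
    using r qc star_homD(1,2)[OF \<rho>] by (simp add: C.add_zero)
  ultimately show ?thesis using rc by blast
qed

lemma carrier_stage_D:
  assumes "m \<le> Suc b"
  shows "carrier (rsh_stage D (a + m))
    = {p @ take m r | p r. p \<in> carrier RA \<and> r \<in> carrier RB \<and> \<phi> p = \<rho> r}"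
  using assms
proof (induction m)
  case 0
  have "\<exists>r\<in>carrier RB. \<phi> p = \<rho> r" if "p \<in> carrier RA" for p
    using that \<phi> \<rho>_surj by (auto simp: unital_star_hom_def star_hom_def)
  then show ?case by (auto simp: stage_low)
next
  case (Suc m)
  have m: "m \<le> b" using Suc.prems by simp
  have IH: "s \<in> carrier (rsh_stage D (a + m)) \<longleftrightarrow>
      (\<exists>p r. s = p @ take m r \<and> p \<in> carrier RA \<and> r \<in> carrier RB \<and> \<phi> p = \<rho> r)" for s
    using Suc by auto
  show ?case
  proof (intro equalityI subsetI)
    fix s assume "s \<in> carrier (rsh_stage D (a + Suc m))"
    then have "s \<in> carrier (rsh_stage D (Suc (a + m)))" by (simp only: add_Suc_right)
    then obtain t f where s: "s = t @ [f]" and t: "t \<in> carrier (rsh_stage D (a + m))"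
      and f: "f \<in> carrier (block D (Suc (a + m)))"
      and gl: "glue D (Suc (a + m)) t = restrict f (bdry D (Suc (a + m)))"
      by (rule carrier_stage_cases)
    obtain p r where p: "t = p @ take m r" "p \<in> carrier RA" "r \<in> carrier RB" "\<phi> p = \<rho> r"
      using t IH by blast
    have "restrict (r ! m) (Y m) = restrict f (Y m)"
      using gl glueY_eq[OF m p(2-4)] by (simp add: D_high p(1))
    then obtain r' where r': "r' \<in> carrier RB" "take m r' = take m r" "r' ! m = f" "\<rho> r' = \<rho> r"
      using fibre_extension[OF m p(3)] f by (auto simp: D_high)
    have "take (Suc m) r' = take m r @ [f]"
      using r' carrier_stage_length[OF r'(1)] m by (simp add: take_Suc_conv_app_nth)
    then show "s \<in> {p @ take (Suc m) r | p r. p \<in> carrier RA \<and> r \<in> carrier RB \<and> \<phi> p = \<rho> r}"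
      using s p r' by (intro CollectI exI[of _ p] exI[of _ r']) simp
  next
    fix s assume "s \<in> {p @ take (Suc m) r | p r. p \<in> carrier RA \<and> r \<in> carrier RB \<and> \<phi> p = \<rho> r}"
    then obtain p r where s: "s = p @ take (Suc m) r"
      and p: "p \<in> carrier RA" "r \<in> carrier RB" "\<phi> p = \<rho> r" by blast
    have s': "s = (p @ take m r) @ [r ! m]"
      using s carrier_stage_length[OF p(2)] m by (simp add: take_Suc_conv_app_nth)
    have "s \<in> carrier (rsh_stage D (Suc (a + m)))"
      unfolding s' mem_carrier_stage_Suc D_high glueY_eq[OF m p]
      using IH p carrier_stage_nth[OF p(2) m] by blast
    then show "s \<in> carrier (rsh_stage D (a + Suc m))" by (simp only: add_Suc_right)
  qed
qed

lemma nth_append_take: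
  assumes "p \<in> carrier RA" "r \<in> carrier RB" "m \<le> Suc b"
  shows "i \<le> a \<Longrightarrow> (p @ take m r) ! i = p ! i"
    "i < m \<Longrightarrow> (p @ take m r) ! (Suc (a + i)) = r ! i"
    "length (p @ take m r) = Suc (a + m)"
  using carrier_stage_length[OF assms(1)] carrier_stage_length[OF assms(2)] assms(3)
  by (simp_all add: nth_append)

lemma list_eq_append_take:
  assumes p: "p \<in> carrier RA" and r: "r \<in> carrier RB" and m: "m \<le> Suc b"
    and len: "length s = Suc (a + m)"
    and low: "\<And>i. i \<le> a \<Longrightarrow> s ! i = p ! i" and high: "\<And>i. i < m \<Longrightarrow> s ! (Suc (a + i)) = r ! i"
  shows "s = p @ take m r"
proof (rule nth_equalityI)
  fix i assume "i < length s"
  then have i: "i < Suc (a + m)" using len by simp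
  show "s ! i = (p @ take m r) ! i"
  proof (cases "i \<le> a")
    case False
    then obtain k where k: "i = Suc (a + k)" "k < m"
      using i by (metis add_less_cancel_left less_iff_Suc_add not_le_imp_less Suc_less_eq)
    then show ?thesis using high nth_append_take(2)[OF p r m] by simp
  qed (use low nth_append_take(1)[OF p r m] in simp)
qed (use len nth_append_take(3)[OF p r m] in simp)

lemma stage_D_ops:
  assumes m: "m \<le> Suc b" and p: "p \<in> carrier RA" "r \<in> carrier RB" "\<phi> p = \<rho> r"
    and q: "q \<in> carrier RA" "s \<in> carrier RB" "\<phi> q = \<rho> s"
  shows "cadd (rsh_stage D (a + m)) (p @ take m r) (q @ take m s) = cadd RA p q @ take m (cadd RB r s)"
    "cmult (rsh_stage D (a + m)) (p @ take m r) (q @ take m s) = cmult RA p q @ take m (cmult RB r s)"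
    "cscale (rsh_stage D (a + m)) c (p @ take m r) = cscale RA c p @ take m (cscale RB c r)"
    "cstar (rsh_stage D (a + m)) (p @ take m r) = cstar RA p @ take m (cstar RB r)"
proof -
  interpret RA: cstar_algebra RA by (rule cstar_RA)
  interpret RB: cstar_algebra RB by (rule cstar_RB)
  have c: "p @ take m r \<in> carrier (rsh_stage D (a + m))" "q @ take m s \<in> carrier (rsh_stage D (a + m))"
    using carrier_stage_D[OF m] p q by auto
  have le: "i \<le> a \<Longrightarrow> i \<le> a + m" "i < m \<Longrightarrow> Suc (a + i) \<le> a + m" "i < m \<Longrightarrow> i \<le> b" for i
    using m by auto
  note nth = stage_nth(1-4)[OF c] stage_nth(1-4)[OF p(1) q(1)] stage_nth(1-4)[OF p(2) q(2)]
    nth_append_take[OF p(1,2) m] nth_append_take[OF q(1,2) m] D_low D_high le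
  note len = stage_ops(1-4)[OF c]
  show "cadd (rsh_stage D (a + m)) (p @ take m r) (q @ take m s) = cadd RA p q @ take m (cadd RB r s)"
    by (rule list_eq_append_take[OF _ _ m]; (simp add: nth RA.closed RB.closed p q; fail)?)
       (simp add: len)
  show "cmult (rsh_stage D (a + m)) (p @ take m r) (q @ take m s) = cmult RA p q @ take m (cmult RB r s)"
    by (rule list_eq_append_take[OF _ _ m]; (simp add: nth RA.closed RB.closed p q; fail)?)
       (simp add: len)
  show "cscale (rsh_stage D (a + m)) c (p @ take m r) = cscale RA c p @ take m (cscale RB c r)"
    by (rule list_eq_append_take[OF _ _ m]; (simp add: nth RA.closed RB.closed p q; fail)?)
       (simp add: len)
  show "cstar (rsh_stage D (a + m)) (p @ take m r) = cstar RA p @ take m (cstar RB r)"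
    by (rule list_eq_append_take[OF _ _ m]; (simp add: nth RA.closed RB.closed p q; fail)?)
       (simp add: len)
qed

lemma glueY_unital_star_hom:
  assumes m: "m \<le> b"
  shows "unital_star_hom (rsh_stage D (a + m))
    (C_mat (subtopology (rsh_space DB m) (Y m)) (msize DB m)) (glueY m)"
proof -
  let ?S = "C_mat (subtopology (rsh_space DB m) (Y m)) (msize DB m)"
  have m': "m \<le> Suc b" using m by simp
  interpret RA: cstar_algebra RA by (rule cstar_RA)
  interpret RB: cstar_algebra RB by (rule cstar_RB)
  have \<phi>hom: "star_hom RA C \<phi>" using \<phi> by (simp add: unital_star_hom_def)
  note h = star_homD[OF \<phi>hom] star_homD[OF \<rho>]
  have res: "unital_star_hom (block DB m) ?S (\<lambda>f. restrict f (Y m))"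
    by (rule unital_star_hom_restrict[OF Y_subset[OF m]])
  then have res_hom: "star_hom (block DB m) ?S (\<lambda>f. restrict f (Y m))"
    by (simp add: unital_star_hom_def)
  note rh = star_homD[OF res_hom]
  have dec: "\<exists>p r. x = p @ take m r \<and> p \<in> carrier RA \<and> r \<in> carrier RB \<and> \<phi> p = \<rho> r"
    if "x \<in> carrier (rsh_stage D (a + m))" for x
    using that carrier_stage_D[OF m'] by blast
  have hom: "star_hom (rsh_stage D (a + m)) ?S (glueY m)"
    unfolding star_hom_def
  proof (intro conjI ballI allI)
    fix x y assume x: "x \<in> carrier (rsh_stage D (a + m))" and y: "y \<in> carrier (rsh_stage D (a + m))"
    obtain p r where p: "x = p @ take m r" "p \<in> carrier RA" "r \<in> carrier RB" "\<phi> p = \<rho> r"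
      using dec[OF x] by blast
    obtain q s where q: "y = q @ take m s" "q \<in> carrier RA" "s \<in> carrier RB" "\<phi> q = \<rho> s"
      using dec[OF y] by blast
    note n = stage_nth[OF p(3) q(3) m] carrier_stage_nth[OF p(3) m] carrier_stage_nth[OF q(3) m]
    note ops = stage_D_ops[OF m' p(2-4) q(2-4)]
    show "glueY m (cadd (rsh_stage D (a + m)) x y) = cadd ?S (glueY m x) (glueY m y)"
      unfolding p(1) q(1) ops
      by (subst (1 2 3) glueY_eq[OF m]) (simp_all add: p(2-4) q(2-4) h RA.closed RB.closed n rh)
    show "glueY m (cmult (rsh_stage D (a + m)) x y) = cmult ?S (glueY m x) (glueY m y)"
      unfolding p(1) q(1) ops
      by (subst (1 2 3) glueY_eq[OF m]) (simp_all add: p(2-4) q(2-4) h RA.closed RB.closed n rh)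
  next
    fix x assume x: "x \<in> carrier (rsh_stage D (a + m))"
    obtain p r where p: "x = p @ take m r" "p \<in> carrier RA" "r \<in> carrier RB" "\<phi> p = \<rho> r"
      using dec[OF x] by blast
    note n = stage_nth[OF p(3) p(3) m] carrier_stage_nth[OF p(3) m]
    note ops = stage_D_ops[OF m' p(2-4) p(2-4)]
    show "glueY m x \<in> carrier ?S"
      unfolding p(1) by (subst glueY_eq[OF m]) (simp_all only: p(2-4) n rh)
    show "glueY m (cscale (rsh_stage D (a + m)) c x) = cscale ?S c (glueY m x)" for c
      unfolding p(1) ops
      by (subst (1 2) glueY_eq[OF m]) (simp_all add: p(2-4) h RA.closed RB.closed n rh)
    show "glueY m (cstar (rsh_stage D (a + m)) x) = cstar ?S (glueY m x)"
      unfolding p(1) ops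
      by (subst (1 2) glueY_eq[OF m]) (simp_all add: p(2-4) h RA.closed RB.closed n rh)
  qed
  let ?p = "stage_one DA a" and ?r = "stage_one DB b"
  have ip: "is_identity RA ?p" and ir: "is_identity RB ?r"
    using stage_one_identity validA validB by blast+
  have e: "\<phi> ?p = \<rho> ?r"
    by (rule identity_unique[OF unital_star_hom_identity[OF \<phi> ip] unital_star_hom_identity[OF \<rho>_unital ir]])
  have pc: "?p \<in> carrier RA" and rc: "?r \<in> carrier RB"
    using ip ir by (auto simp: is_identity_def)
  have "is_identity (rsh_stage D (a + m)) (?p @ take m ?r)"
    unfolding is_identity_def
  proof (intro conjI ballI)
    show "?p @ take m ?r \<in> carrier (rsh_stage D (a + m))"
      using carrier_stage_D[OF m'] pc rc e by blast
    fix x assume x: "x \<in> carrier (rsh_stage D (a + m))"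
    obtain p r where p: "x = p @ take m r" "p \<in> carrier RA" "r \<in> carrier RB" "\<phi> p = \<rho> r"
      using dec[OF x] by blast
    show "cmult (rsh_stage D (a + m)) (?p @ take m ?r) x = x"
      "cmult (rsh_stage D (a + m)) x (?p @ take m ?r) = x"
      unfolding p(1) stage_D_ops(2)[OF m' pc rc e p(2-4)] stage_D_ops(2)[OF m' p(2-4) pc rc e]
      using ip ir p by (simp_all add: is_identity_def)
  qed
  moreover have "is_identity ?S (glueY m (?p @ take m ?r))"
  proof -
    have "?r ! m = C_one (rsh_space DB m) (msize DB m)"
      using m by (simp add: stage_one_def nth_append del: upt_Suc)
    then show ?thesis
      using glueY_eq[OF m pc rc e] unital_star_hom_identity[OF res C_one_identity] by simp
  qed
  ultimately show ?thesis
    using hom unfolding unital_star_hom_def by blast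
qed

lemma valid_D: "valid_rsh_decomp D"
  unfolding valid_rsh_decomp_def
proof (intro conjI allI impI)
  have top: "top_index D = Suc (a + b)" by (simp add: D_def)
  have high: "\<exists>m. i = Suc (a + m) \<and> m \<le> b" if "i \<le> top_index D" "\<not> i \<le> a" for i
    using that top by (intro exI[of _ "i - Suc a"]) auto
  fix i assume i: "i \<le> top_index D"
  show "compact_space (rsh_space D i)" "Hausdorff_space (rsh_space D i)" "1 \<le> msize D i"
    using valid_rsh_decompD(1-3)[OF validA] valid_rsh_decompD(1-3)[OF validB] high[OF i]
    by (cases "i \<le> a"; auto simp: D_low D_high)+
next
  have top: "top_index D = Suc (a + b)" by (simp add: D_def)
  fix i assume "1 \<le> i \<and> i \<le> top_index D"
  then have i: "1 \<le> i" "i \<le> top_index D" by auto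
  show "closedin (rsh_space D i) (bdry D i)" "unital_star_hom (rsh_stage D (i - 1))
      (C_mat (subtopology (rsh_space D i) (bdry D i)) (msize D i)) (glue D i)"
  proof (atomize (full), cases "i \<le> a")
    case True
    then show "closedin (rsh_space D i) (bdry D i) \<and> unital_star_hom (rsh_stage D (i - 1))
      (C_mat (subtopology (rsh_space D i) (bdry D i)) (msize D i)) (glue D i)"
      using valid_rsh_decompD(4,5)[OF validA True i(1)] by (simp add: D_low stage_low)
  next
    case False
    then obtain m where m: "i = Suc (a + m)" "m \<le> b"
      using i top by (intro that[of "i - Suc a"]) auto
    then show "closedin (rsh_space D i) (bdry D i) \<and> unital_star_hom (rsh_stage D (i - 1))
      (C_mat (subtopology (rsh_space D i) (bdry D i)) (msize D i)) (glue D i)"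
      using closedin_Y[OF m(2)] glueY_unital_star_hom[OF m(2)] by (simp add: D_high)
  qed
qed

end

text \<open>The isomorphism of the pullback with the last stage of the new decomposition appends the
list that represents an element of \<open>B\<close> to the one that represents an element of \<open>A\<close>.\<close>

theorem rsh_pullback_common_type:
  fixes DA DB :: "'z rsh_decomp"
  assumes A: "rsh_decomposition_of A DA" and B: "rsh_decomposition_of B DB" and C: "cstar_algebra C"
    and \<phi>: "unital_star_hom A C \<phi>" and \<rho>: "star_hom B C \<rho>" and surj: "\<rho> ` carrier B = carrier C"
  obtains D :: "'z rsh_decomp" where "rsh_decomposition_of (pullback A \<phi> B \<rho>) D"
    "top_index D = Suc (top_index DA + top_index DB)"
    "\<And>i. i \<le> top_index DA \<Longrightarrow> rsh_space D i = rsh_space DA i \<and> msize D i = msize DA i"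
    "\<And>i. rsh_space D (Suc (top_index DA + i)) = rsh_space DB i \<and>
       msize D (Suc (top_index DA + i)) = msize DB i"
proof -
  let ?a = "top_index DA" and ?b = "top_index DB"
  let ?RA = "rsh_stage DA ?a" and ?RB = "rsh_stage DB ?b"
  obtain h k where h: "star_iso A ?RA h" and k: "star_iso B ?RB k"
    and cA: "cstar_algebra A" and cB: "cstar_algebra B"
    and vA: "valid_rsh_decomp DA" and vB: "valid_rsh_decomp DB"
    using A B by (auto simp: rsh_decomposition_of_def)
  interpret A: cstar_algebra A by (rule cA)
  interpret B: cstar_algebra B by (rule cB)
  have hh: "star_hom A ?RA h" "bij_betw h (carrier A) (carrier ?RA)"
    and kk: "star_hom B ?RB k" "bij_betw k (carrier B) (carrier ?RB)"
    using h k by (auto simp: star_iso_def)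
  define h' k' where "h' = inv_into (carrier A) h" and "k' = inv_into (carrier B) k"
  note h' = star_iso_inverse[OF cA h, folded h'_def] and k' = star_iso_inverse[OF cB k, folded k'_def]
  have h'h: "h' (h x) = x" if "x \<in> carrier A" for x
    using that hh(2) by (simp add: h'_def bij_betw_def inv_into_f_f)
  have k'k: "k' (k x) = x" if "x \<in> carrier B" for x
    using that kk(2) by (simp add: k'_def bij_betw_def inv_into_f_f)
  have iA: "is_identity A (h' (stage_one DA ?a))"
    by (rule surjective_star_hom_identity[OF h' stage_one_identity[OF vA order_refl]])
  have iB: "is_identity B (k' (stage_one DB ?b))"
    by (rule surjective_star_hom_identity[OF k' stage_one_identity[OF vB order_refl]])
  have \<rho>_unital: "unital_star_hom B C \<rho>"
    using \<rho> iB surjective_star_hom_identity[OF \<rho> surj iB] unfolding unital_star_hom_def by blast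
  have \<phi>hom: "star_hom A C \<phi>" using \<phi> by (simp add: unital_star_hom_def)
  interpret P: rsh_pullback DA DB C "\<lambda>x. \<phi> (h' x)" "\<lambda>x. \<rho> (k' x)"
  proof (rule rsh_pullback.intro[OF vA vB C])
    show "unital_star_hom ?RA C (\<lambda>x. \<phi> (h' x))"
      unfolding unital_star_hom_def
      using star_hom_compose[OF h'(1) \<phi>hom] stage_one_identity[OF vA order_refl]
        unital_star_hom_identity[OF \<phi> iA] by blast
    show "star_hom ?RB C (\<lambda>x. \<rho> (k' x))" by (rule star_hom_compose[OF k'(1) \<rho>])
    show "(\<lambda>x. \<rho> (k' x)) ` carrier ?RB = carrier C"
      using k'(2) surj by (metis image_image)
  qed
  let ?D = P.D and ?P = "pullback A \<phi> B \<rho>"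
  have top: "top_index ?D = ?a + Suc ?b" by (simp add: P.D_def)
  let ?j = "\<lambda>(x, y). h x @ k y"
  define S where "S = rsh_stage ?D (?a + Suc ?b)"
  have takeB: "take (Suc ?b) (k y) = k y" if "y \<in> carrier B" for y
    using carrier_stage_length[OF star_homD(1)[OF kk(1) that]] by simp
  have elem: "h x \<in> carrier ?RA" "k y \<in> carrier ?RB" "\<phi> (h' (h x)) = \<rho> (k' (k y))"
    "take (Suc ?b) (k y) = k y"
    if "(x, y) \<in> carrier ?P" for x y
    using that star_homD(1)[OF hh(1)] star_homD(1)[OF kk(1)]
    by (auto simp: pullback_simps h'h k'k takeB)
  have "star_iso ?P S ?j"
    unfolding star_iso_def
  proof
    show "star_hom ?P S ?j"
      unfolding star_hom_def
    proof (intro conjI ballI allI)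
      fix u v assume uv: "u \<in> carrier ?P" "v \<in> carrier ?P"
      obtain x y x' y' where u: "u = (x, y)" and v: "v = (x', y')" by (cases u, cases v)
      note e = elem[OF uv(1)[unfolded u]] and e' = elem[OF uv(2)[unfolded v]]
      have c: "x \<in> carrier A" "y \<in> carrier B" "x' \<in> carrier A" "y' \<in> carrier B"
        using uv by (auto simp: u v pullback_simps)
      note ops = P.stage_D_ops[OF order_refl e(1-3) e'(1-3), unfolded e(4) e'(4), folded S_def]
      show "?j (cadd ?P u v) = cadd S (?j u) (?j v)"
        using c by (simp add: u v pullback_simps ops star_homD(2)[OF hh(1), symmetric]
            star_homD(2)[OF kk(1), symmetric] takeB B.closed)
      show "?j (cmult ?P u v) = cmult S (?j u) (?j v)"
        using c by (simp add: u v pullback_simps ops star_homD(4)[OF hh(1), symmetric]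
            star_homD(4)[OF kk(1), symmetric] takeB B.closed)
    next
      fix u assume uc: "u \<in> carrier ?P"
      obtain x y where u: "u = (x, y)" by (cases u)
      note e = elem[OF uc[unfolded u]]
      have c: "x \<in> carrier A" "y \<in> carrier B" using uc by (auto simp: u pullback_simps)
      note ops = P.stage_D_ops[OF order_refl e(1-3) e(1-3), unfolded e(4), folded S_def]
      show "?j u \<in> carrier S"
        unfolding P.carrier_stage_D[OF order_refl, folded S_def] u using e by (intro CollectI exI[of _ "h x"] exI[of _ "k y"]) auto
      show "?j (cscale ?P c u) = cscale S c (?j u)" for c
        using c by (simp add: u pullback_simps ops star_homD(3)[OF hh(1), symmetric]
            star_homD(3)[OF kk(1), symmetric] takeB B.closed)
      show "?j (cstar ?P u) = cstar S (?j u)"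
        using c by (simp add: u pullback_simps ops star_homD(5)[OF hh(1), symmetric]
            star_homD(5)[OF kk(1), symmetric] takeB B.closed)
    qed
    show "bij_betw ?j (carrier ?P) (carrier S)"
      unfolding bij_betw_def
    proof
      show "inj_on ?j (carrier ?P)"
      proof (rule inj_onI)
        fix u v assume uv: "u \<in> carrier ?P" "v \<in> carrier ?P" "?j u = ?j v"
        obtain x y x' y' where u: "u = (x, y)" and v: "v = (x', y')" by (cases u, cases v)
        note e = elem[OF uv(1)[unfolded u]] and e' = elem[OF uv(2)[unfolded v]]
        have "h x = h x'" "k y = k y'"
          using uv(3) carrier_stage_length[OF e(1)] carrier_stage_length[OF e'(1)] by (auto simp: u v)
        then show "u = v"
          using uv h'h k'k by (metis u v pullback_simps(1))
      qed
      show "?j ` carrier ?P = carrier S"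
      proof (intro equalityI subsetI)
        fix s assume "s \<in> ?j ` carrier ?P"
        then obtain x y where "s = h x @ k y" "(x, y) \<in> carrier ?P" by auto
        then show "s \<in> carrier S"
          unfolding P.carrier_stage_D[OF order_refl, folded S_def] using elem by (intro CollectI exI[of _ "h x"] exI[of _ "k y"]) auto
      next
        fix s assume "s \<in> carrier S"
        then obtain p r where s: "s = p @ take (Suc ?b) r" and p: "p \<in> carrier ?RA" "r \<in> carrier ?RB"
          "\<phi> (h' p) = \<rho> (k' r)"
          unfolding P.carrier_stage_D[OF order_refl, folded S_def] by blast
        obtain x y where "x \<in> carrier A" "p = h x" "y \<in> carrier B" "r = k y"
          using p(1,2) bij_betw_imp_surj_on[OF hh(2)] bij_betw_imp_surj_on[OF kk(2)] by blast
        then show "s \<in> ?j ` carrier ?P"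
          using s p(3) takeB by (intro image_eqI[of _ _ "(x, y)"]) (auto simp: pullback_simps h'h k'k)
      qed
    qed
  qed
  then have "rsh_decomposition_of ?P ?D"
    unfolding rsh_decomposition_of_def top S_def
    using cstar_algebra_pullback[OF cA cB C \<phi> \<rho>_unital] P.valid_D by blast
  then show thesis
    using top by (intro that[of ?D]) (simp_all add: P.D_low P.D_high)
qed

section \<open>Relabelling the points of the spaces\<close>

text \<open>For injective \<open>e\<close>, the image of the topology under \<open>e\<close>.\<close>

definition relabel_space :: "('x \<Rightarrow> 'z) \<Rightarrow> 'x topology \<Rightarrow> 'z topology" where
  "relabel_space e X = pullback_topology (range e) (inv_into UNIV e) X"

lemma openin_relabel_space:
  assumes "inj e"
  shows "openin (relabel_space e X) S \<longleftrightarrow> (\<exists>U. openin X U \<and> S = e ` U)"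
proof -
  have "inv_into UNIV e -` U \<inter> range e = e ` U" for U
    using assms by (auto simp: image_iff)
  then show ?thesis by (simp add: relabel_space_def openin_pullback_topology)
qed

lemma topspace_relabel_space:
  assumes "inj e"
  shows "topspace (relabel_space e X) = e ` topspace X"
proof -
  have "inv_into UNIV e -` topspace X \<inter> range e = e ` topspace X"
    using assms by (auto simp: image_iff)
  then show ?thesis by (simp add: relabel_space_def topspace_pullback_topology)
qed

lemma subtopology_relabel_space:
  assumes "inj e"
  shows "subtopology (relabel_space e X) (e ` T) = relabel_space e (subtopology X T)"
  unfolding topology_eq openin_subtopology openin_relabel_space[OF assms]
proof (intro allI iffI; elim exE conjE)
  fix S W U assume "S = W \<inter> e ` T" "openin X U" "W = e ` U"
  then show "\<exists>U. (\<exists>V. openin X V \<and> U = V \<inter> T) \<and> S = e ` U"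
    by (intro exI[of _ "U \<inter> T"]) (auto simp: image_Int[OF assms])
next
  fix S U V assume "S = e ` U" "openin X V" "U = V \<inter> T"
  then show "\<exists>W. (\<exists>U. openin X U \<and> W = e ` U) \<and> S = W \<inter> e ` T"
    by (intro exI[of _ "e ` V"]) (auto simp: image_Int[OF assms])
qed

lemma homeomorphic_map_relabel_space:
  assumes e: "inj e"
  shows "homeomorphic_map X (relabel_space e X) e"
  unfolding homeomorphic_eq_everything_map
proof (intro conjI)
  show "continuous_map X (relabel_space e X) e"
    unfolding continuous_map topspace_relabel_space[OF e] openin_relabel_space[OF e]
  proof (intro conjI allI impI)
    fix S assume "\<exists>U. openin X U \<and> S = e ` U"
    then obtain U where U: "openin X U" "S = e ` U" by blast
    have "{x \<in> topspace X. e x \<in> S} = U"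
      using U e openin_subset[OF U(1)] by (auto simp: inj_image_mem_iff)
    then show "openin X {x \<in> topspace X. e x \<in> S}" using U by simp
  qed auto
  show "open_map X (relabel_space e X) e"
    unfolding open_map_def openin_relabel_space[OF e] by blast
  then show "closed_map X (relabel_space e X) e"
    using e by (intro bijective_open_imp_closed_map)
               (auto simp: topspace_relabel_space[OF e] intro: inj_on_subset)
  show "e ` topspace X = topspace (relabel_space e X)"
    by (simp add: topspace_relabel_space[OF e])
  show "inj_on e (topspace X)" using e by (rule inj_on_subset) simp
qed

lemma covering_dim_le_homeomorphic_map:
  assumes f: "homeomorphic_map X Y f" and X: "covering_dim_le X d"
  shows "covering_dim_le Y d"
  unfolding covering_dim_le_def
proof (intro allI impI, elim conjE)
  fix \<U> assume \<U>: "finite \<U>" "\<forall>U\<in>\<U>. openin Y U" "\<Union>\<U> = topspace Y"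
  have cont: "continuous_map X Y f" and surj: "f ` topspace X = topspace Y" and inj: "inj_on f (topspace X)"
    and op: "open_map X Y f"
    using f by (auto simp: homeomorphic_eq_everything_map)
  let ?pre = "\<lambda>U. {x \<in> topspace X. f x \<in> U}"
  have "f x \<in> \<Union>\<U>" if "x \<in> topspace X" for x
    using that surj \<U>(3) by blast
  then have cover: "finite (?pre ` \<U>) \<and> (\<forall>U\<in>?pre ` \<U>. openin X U) \<and> \<Union>(?pre ` \<U>) = topspace X"
    using \<U>(1,2) openin_continuous_map_preimage[OF cont] by auto
  from mp[OF spec[OF X[unfolded covering_dim_le_def]] cover]
  obtain \<V> where \<V>: "finite \<V>" "\<forall>V\<in>\<V>. openin X V" "\<Union>\<V> = topspace X"
    "\<forall>V\<in>\<V>. \<exists>U\<in>?pre ` \<U>. V \<subseteq> U" "\<forall>x\<in>topspace X. int (card {V\<in>\<V>. x \<in> V}) \<le> d + 1"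
    by (elim exE conjE) (rule that)
  have sub: "V \<subseteq> topspace X" if "V \<in> \<V>" for V using that \<V> openin_subset by blast
  show "\<exists>\<V>. finite \<V> \<and> (\<forall>V\<in>\<V>. openin Y V) \<and> \<Union>\<V> = topspace Y \<and>
      (\<forall>V\<in>\<V>. \<exists>U\<in>\<U>. V \<subseteq> U) \<and> (\<forall>x\<in>topspace Y. int (card {V\<in>\<V>. x \<in> V}) \<le> d + 1)"
  proof (intro exI[of _ "(`) f ` \<V>"] conjI ballI)
    show "\<Union>((`) f ` \<V>) = topspace Y"
      using \<V>(3) surj by (simp add: image_Union[symmetric])
    fix y assume "y \<in> topspace Y"
    then obtain x where x: "x \<in> topspace X" "y = f x" unfolding surj[symmetric] by (rule imageE)
    have "{V \<in> (`) f ` \<V>. y \<in> V} \<subseteq> (`) f ` {V\<in>\<V>. x \<in> V}"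
    proof (rule subsetI)
      fix W assume "W \<in> {V \<in> (`) f ` \<V>. y \<in> V}"
      then obtain V where W: "W = f ` V" and V: "V \<in> \<V>" "y \<in> f ` V" by auto
      from V(2)[unfolded x(2)] obtain x' where x': "x' \<in> V" "f x = f x'" by (rule imageE)
      have "x = x'" by (rule inj_onD[OF inj x'(2) x(1) subsetD[OF sub[OF V(1)] x'(1)]])
      with V x' show "W \<in> (`) f ` {V\<in>\<V>. x \<in> V}" unfolding W by simp
    qed
    then have "card {V \<in> (`) f ` \<V>. y \<in> V} \<le> card {V\<in>\<V>. x \<in> V}"
      using \<V>(1) by (intro order_trans[OF card_mono card_image_le]) auto
    then show "int (card {V \<in> (`) f ` \<V>. y \<in> V}) \<le> d + 1"
      using bspec[OF \<V>(5) x(1)] by linarith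
  next
    fix W assume "W \<in> (`) f ` \<V>"
    then obtain V where W: "W = f ` V" and V: "V \<in> \<V>" by auto
    show "openin Y W" using op \<V>(2) V unfolding W open_map_def by simp
    obtain U where "U \<in> \<U>" "V \<subseteq> ?pre U" using \<V>(4) V by auto
    then show "\<exists>U\<in>\<U>. W \<subseteq> U" unfolding W by (intro bexI[of _ U]) auto
  qed (simp add: \<V>(1))
qed

lemma covering_dim_relabel_space:
  assumes e: "inj e"
  shows "covering_dim (relabel_space e X) = covering_dim X"
proof -
  note h = homeomorphic_map_relabel_space[OF e, of X]
  obtain g where "homeomorphic_maps X (relabel_space e X) e g"
    using h homeomorphic_map_maps by blast
  then have g: "homeomorphic_map (relabel_space e X) X g"
    using homeomorphic_maps_sym homeomorphic_maps_map by blast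
  have "covering_dim_le (relabel_space e X) d = covering_dim_le X d" for d
    using covering_dim_le_homeomorphic_map[OF h, of d] covering_dim_le_homeomorphic_map[OF g, of d] by blast
  then show ?thesis by (simp add: covering_dim_def)
qed

text \<open>Off the range of \<open>e\<close> the value is \<open>undefined\<close>, so that functions that are extensional on a space go to
functions that are extensional on its image, whatever the space. Composition with \<open>e\<close> is the
inverse, again independently of the space; this allows lists of functions on different spaces to be relabelled by
a single map.\<close>

definition relabel_fun :: "('x \<Rightarrow> 'z) \<Rightarrow> ('x \<Rightarrow> 'm) \<Rightarrow> 'z \<Rightarrow> 'm" where
  "relabel_fun e f = (\<lambda>z\<in>range e. f (inv_into UNIV e z))"

lemma relabel_fun_apply: "inj e \<Longrightarrow> relabel_fun e f (e x) = f x"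
  by (simp add: relabel_fun_def)

lemma relabel_fun_comp: "inj e \<Longrightarrow> relabel_fun e f \<circ> e = f"
  by (auto simp: relabel_fun_apply)

lemma relabel_fun_inject: "inj e \<Longrightarrow> relabel_fun e f = relabel_fun e g \<longleftrightarrow> f = g"
  by (metis relabel_fun_comp)

lemma relabel_fun_restrict:
  assumes "inj e"
  shows "relabel_fun e (\<lambda>x\<in>T. f x) = (\<lambda>z\<in>e ` T. f (inv_into UNIV e z))"
  using assms by (auto simp: relabel_fun_def restrict_def fun_eq_iff)

lemma relabel_fun_eq_restrict:
  assumes e: "inj e" and f: "f \<in> extensional T"
  shows "relabel_fun e f = (\<lambda>z\<in>e ` T. f (inv_into UNIV e z))"
  using relabel_fun_restrict[OF e, of f T] f by (simp add: extensional_restrict)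

lemma restrict_relabel_fun:
  assumes "inj e"
  shows "restrict (relabel_fun e f) (e ` T) = relabel_fun e (restrict f T)"
proof -
  have "range e \<inter> e ` T = e ` T" by auto
  then show ?thesis
    unfolding relabel_fun_restrict[OF assms] by (simp add: relabel_fun_def)
qed

lemma comp_in_C_mat:
  assumes e: "inj e" and g: "g \<in> carrier (C_mat (relabel_space e X) n)"
  shows "g \<circ> e \<in> carrier (C_mat X n)" "relabel_fun e (g \<circ> e) = g"
proof -
  note top = topspace_relabel_space[OF e]
  have cont: "continuous_map X (relabel_space e X) e"
    using homeomorphic_map_relabel_space[OF e] by (auto simp: homeomorphic_eq_everything_map)
  have ext: "g z = undefined" if "z \<notin> e ` topspace X" for z
    using C_mat_carrierD(1)[OF g] that by (simp add: top extensional_def)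
  have "(g \<circ> e) \<in> extensional (topspace X)"
    using ext e by (auto simp: extensional_def inj_image_mem_iff)
  moreover have "continuous_map X euclidean (\<lambda>x. index_mat ((g \<circ> e) x) (i, j))" if "i < n" "j < n" for i j
    using continuous_map_compose[OF cont C_mat_carrierD(3)[OF g that]] by (simp add: o_def)
  moreover have "(g \<circ> e) x \<in> carrier_mat n n" if "x \<in> topspace X" for x
    using C_mat_carrierD(2)[OF g, of "e x"] that by (simp add: top)
  ultimately show "g \<circ> e \<in> carrier (C_mat X n)" by (simp add: C_mat_def)
  show "relabel_fun e (g \<circ> e) = g"
  proof
    fix z show "relabel_fun e (g \<circ> e) z = g z"
    proof (cases "z \<in> range e")
      case False
      then have "z \<notin> e ` topspace X" by auto
      then show ?thesis using False ext by (simp add: relabel_fun_def)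
    qed (auto simp: relabel_fun_apply[OF e])
  qed
qed

lemma relabel_fun_in_C_mat:
  assumes e: "inj e" and f: "f \<in> carrier (C_mat X n)"
  shows "relabel_fun e f \<in> carrier (C_mat (relabel_space e X) n)"
proof -
  note top = topspace_relabel_space[OF e, of X]
  obtain g where g: "homeomorphic_maps X (relabel_space e X) e g"
    using homeomorphic_map_relabel_space[OF e] homeomorphic_map_maps by blast
  then have cont: "continuous_map (relabel_space e X) X g"
    and ge: "\<And>x. x \<in> topspace X \<Longrightarrow> g (e x) = x"
    by (auto simp: homeomorphic_maps_def)
  have ge': "relabel_fun e f z = f (g z)" if "z \<in> topspace (relabel_space e X)" for z
    using that ge by (auto simp: top relabel_fun_apply[OF e])
  have "continuous_map (relabel_space e X) euclidean (\<lambda>z. index_mat (relabel_fun e f z) (i, j))"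
    if "i < n" "j < n" for i j
    using continuous_map_compose[OF cont C_mat_carrierD(3)[OF f that]]
    by (rule continuous_map_eq) (simp add: ge')
  moreover have "relabel_fun e f z \<in> carrier_mat n n" if "z \<in> topspace (relabel_space e X)" for z
    using that C_mat_carrierD(2)[OF f] by (auto simp: top relabel_fun_apply[OF e])
  moreover have "relabel_fun e f \<in> extensional (topspace (relabel_space e X))"
    using relabel_fun_eq_restrict[OF e C_mat_carrierD(1)[OF f]] top by simp
  ultimately show ?thesis by (simp add: C_mat_def)
qed

lemma relabel_fun_unital_star_hom:
  assumes e: "inj e"
  shows "unital_star_hom (C_mat X n) (C_mat (relabel_space e X) n) (relabel_fun e)"
proof -
  have "star_hom (C_mat X n) (C_mat (relabel_space e X) n) (relabel_fun e)"
    unfolding star_hom_def C_mat_simps topspace_relabel_space[OF e] relabel_fun_restrict[OF e]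
    using relabel_fun_in_C_mat[OF e, of _ X n]
    by (auto simp: relabel_fun_apply[OF e] e intro!: restrict_ext)
  moreover have "relabel_fun e (C_one X n) = C_one (relabel_space e X) n"
    by (simp add: C_one_def relabel_fun_restrict[OF e] topspace_relabel_space[OF e])
  then have "is_identity (C_mat (relabel_space e X) n) (relabel_fun e (C_one X n))"
    by (simp add: C_one_identity)
  ultimately show ?thesis
    unfolding unital_star_hom_def using C_one_identity by blast
qed

definition relabel_decomp :: "('x \<Rightarrow> 'z) \<Rightarrow> 'x rsh_decomp \<Rightarrow> 'z rsh_decomp" where
  "relabel_decomp e D = \<lparr>top_index = top_index D,
     rsh_space = (\<lambda>k. relabel_space e (rsh_space D k)), msize = msize D,
     bdry = (\<lambda>k. e ` bdry D k),
     glue = (\<lambda>k r. relabel_fun e (glue D k (map (\<lambda>g. g \<circ> e) r)))\<rparr>"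

lemma relabel_decomp_simps:
  "top_index (relabel_decomp e D) = top_index D"
  "rsh_space (relabel_decomp e D) k = relabel_space e (rsh_space D k)"
  "msize (relabel_decomp e D) = msize D"
  "bdry (relabel_decomp e D) k = e ` bdry D k"
  by (simp_all add: relabel_decomp_def)

lemma glue_relabel_decomp:
  assumes "inj e"
  shows "glue (relabel_decomp e D) k (map (relabel_fun e) r) = relabel_fun e (glue D k r)"
  by (simp add: relabel_decomp_def o_def relabel_fun_apply[OF assms])

lemma map_relabel_mem_stage:
  assumes e: "inj e"
  shows "map (relabel_fun e) r \<in> carrier (rsh_stage (relabel_decomp e D) k) \<longleftrightarrow>
    r \<in> carrier (rsh_stage D k)"
proof -
  have block: "relabel_fun e f \<in> carrier (C_mat (relabel_space e X) n) \<longleftrightarrow> f \<in> carrier (C_mat X n)"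
    for f :: "'a \<Rightarrow> complex Matrix.mat" and X n
    using relabel_fun_in_C_mat[OF e, of f X n] comp_in_C_mat(1)[OF e, of "relabel_fun e f" X n]
    by (auto simp: relabel_fun_comp[OF e])
  show ?thesis
    unfolding carrier_stage_iff
    by (auto simp: block take_map glue_relabel_decomp[OF e] relabel_decomp_simps
        restrict_relabel_fun[OF e] relabel_fun_inject[OF e])
qed

lemma star_iso_relabel_stage:
  assumes e: "inj e"
  shows "star_iso (rsh_stage D k) (rsh_stage (relabel_decomp e D) k) (map (relabel_fun e))"
proof -
  let ?E = "map (relabel_fun e)" and ?D = "relabel_decomp e D"
  note mem = map_relabel_mem_stage[OF e, of _ D k]
  have block: "star_hom (block D i) (block ?D i) (relabel_fun e)" for i
    using relabel_fun_unital_star_hom[OF e] by (simp add: relabel_decomp_simps unital_star_hom_def)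
  have nth: "i \<le> k \<Longrightarrow> i < length r" if "r \<in> carrier (rsh_stage D k)" for i r
    using carrier_stage_length[OF that] by simp
  have "star_hom (rsh_stage D k) (rsh_stage ?D k) ?E"
    unfolding star_hom_def
  proof (intro conjI ballI allI)
    fix r s assume r: "r \<in> carrier (rsh_stage D k)" and s: "s \<in> carrier (rsh_stage D k)"
    note E = mem[THEN iffD2, OF r] mem[THEN iffD2, OF s]
    show "?E (cadd (rsh_stage D k) r s) = cadd (rsh_stage ?D k) (?E r) (?E s)"
      unfolding stage_ops(1)[OF r s] stage_ops(1)[OF E]
      using nth[OF r] nth[OF s] star_homD(2)[OF block] carrier_stage_nth[OF r] carrier_stage_nth[OF s]
      by (simp del: upt_Suc)
    show "?E (cmult (rsh_stage D k) r s) = cmult (rsh_stage ?D k) (?E r) (?E s)"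
      unfolding stage_ops(2)[OF r s] stage_ops(2)[OF E]
      using nth[OF r] nth[OF s] star_homD(4)[OF block] carrier_stage_nth[OF r] carrier_stage_nth[OF s]
      by (simp del: upt_Suc)
  next
    fix r assume r: "r \<in> carrier (rsh_stage D k)"
    note E = mem[THEN iffD2, OF r]
    show "?E r \<in> carrier (rsh_stage ?D k)" by (rule E)
    show "?E (cscale (rsh_stage D k) c r) = cscale (rsh_stage ?D k) c (?E r)" for c
      unfolding stage_ops(3)[OF r r] stage_ops(3)[OF E E]
      using nth[OF r] star_homD(3)[OF block] carrier_stage_nth[OF r] by (simp del: upt_Suc)
    show "?E (cstar (rsh_stage D k) r) = cstar (rsh_stage ?D k) (?E r)"
      unfolding stage_ops(4)[OF r r] stage_ops(4)[OF E E]
      using nth[OF r] star_homD(5)[OF block] carrier_stage_nth[OF r] by (simp del: upt_Suc)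
  qed
  moreover have "bij_betw ?E (carrier (rsh_stage D k)) (carrier (rsh_stage ?D k))"
    unfolding bij_betw_def
  proof
    have "inj ?E" by (rule inj_mapI) (simp add: inj_def relabel_fun_inject[OF e])
    then show "inj_on ?E (carrier (rsh_stage D k))" by (rule inj_on_subset) simp
    show "?E ` carrier (rsh_stage D k) = carrier (rsh_stage ?D k)"
    proof (intro equalityI subsetI)
      fix s assume s: "s \<in> carrier (rsh_stage ?D k)"
      have "?E (map (\<lambda>g. g \<circ> e) s) = s"
      proof (rule nth_equalityI)
        fix i assume "i < length (?E (map (\<lambda>g. g \<circ> e) s))"
        then show "?E (map (\<lambda>g. g \<circ> e) s) ! i = s ! i"
          using carrier_stage_length[OF s] carrier_stage_nth[OF s, of i] comp_in_C_mat(2)[OF e]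
          by (simp add: relabel_decomp_simps)
      qed simp
      then show "s \<in> ?E ` carrier (rsh_stage D k)"
        using s mem by (metis image_eqI)
    qed (use mem in auto)
  qed
  ultimately show ?thesis by (simp add: star_iso_def)
qed

lemma unital_star_hom_conjugate:
  assumes A: "cstar_algebra A" and h: "star_iso A A' h" and g: "unital_star_hom A B g"
    and k: "unital_star_hom B B' k" and g': "\<And>x. x \<in> carrier A \<Longrightarrow> g' (h x) = k (g x)"
  shows "unital_star_hom A' B' g'"
proof -
  interpret cstar_algebra A by (rule A)
  have hom: "star_hom A A' h" "star_hom A B g" "star_hom B B' k"
    and surj: "h ` carrier A = carrier A'"
    using h g k by (auto simp: star_iso_def unital_star_hom_def bij_betw_def)
  note hD = star_homD[OF hom(1)] and gD = star_homD[OF hom(2)] and kD = star_homD[OF hom(3)]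
  have "star_hom A' B' g'"
    unfolding star_hom_def surj[symmetric]
    by (auto simp: hD(2-5)[symmetric] g' gD kD closed)
  moreover obtain u where u: "is_identity A u" using g by (auto simp: unital_star_hom_def)
  then have "is_identity A' (h u)" "is_identity B' (g' (h u))"
    using surjective_star_hom_identity[OF hom(1) surj] unital_star_hom_identity[OF k]
      unital_star_hom_identity[OF g] g' by (auto simp: is_identity_def)
  ultimately show ?thesis unfolding unital_star_hom_def by blast
qed

lemma valid_relabel_decomp:
  assumes e: "inj e" and D: "valid_rsh_decomp D"
  shows "valid_rsh_decomp (relabel_decomp e D)"
  unfolding valid_rsh_decomp_def relabel_decomp_simps
proof (intro conjI allI impI)
  fix k assume k: "k \<le> top_index D"
  have "rsh_space D k homeomorphic_space relabel_space e (rsh_space D k)"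
    using homeomorphic_map_relabel_space[OF e] homeomorphic_map_imp_homeomorphic_space by blast
  then show "compact_space (relabel_space e (rsh_space D k))" "Hausdorff_space (relabel_space e (rsh_space D k))"
    using valid_rsh_decompD(1,2)[OF D k] homeomorphic_compact_space homeomorphic_Hausdorff_space by blast+
  show "1 \<le> msize D k" by (rule valid_rsh_decompD(3)[OF D k])
next
  fix k assume k: "1 \<le> k \<and> k \<le> top_index D"
  then have k': "k \<le> top_index D" "1 \<le> k" "k - 1 \<le> top_index D" by auto
  note v = valid_rsh_decompD(4,5)[OF D k'(1,2)]
  have "closed_map (rsh_space D k) (relabel_space e (rsh_space D k)) e"
    using homeomorphic_map_relabel_space[OF e] by (auto simp: homeomorphic_eq_everything_map)
  then show "closedin (relabel_space e (rsh_space D k)) (e ` bdry D k)"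
    using v(1) by (simp add: closed_map_def)
  show "unital_star_hom (rsh_stage (relabel_decomp e D) (k - 1))
      (C_mat (subtopology (relabel_space e (rsh_space D k)) (e ` bdry D k)) (msize D k))
      (glue (relabel_decomp e D) k)"
    unfolding subtopology_relabel_space[OF e]
    by (rule unital_star_hom_conjugate[OF cstar_algebra_stage[OF D k'(3)] star_iso_relabel_stage[OF e]
          v(2) relabel_fun_unital_star_hom[OF e]])
       (rule glue_relabel_decomp[OF e])
qed

theorem rsh_decomposition_of_relabel:
  assumes e: "inj e" and A: "rsh_decomposition_of A D"
  shows "rsh_decomposition_of A (relabel_decomp e D)"
proof -
  obtain h where h: "star_iso A (rsh_stage D (top_index D)) h"
    using A by (auto simp: rsh_decomposition_of_def)
  have "star_iso A (rsh_stage (relabel_decomp e D) (top_index D)) (\<lambda>x. map (relabel_fun e) (h x))"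
    using h star_iso_relabel_stage[OF e, of D "top_index D"]
      star_hom_compose[of A "rsh_stage D (top_index D)" h]
      bij_betw_trans[of h "carrier A" "carrier (rsh_stage D (top_index D))"]
    unfolding star_iso_def by (auto simp: o_def)
  then show ?thesis
    using A valid_relabel_decomp[OF e] unfolding rsh_decomposition_of_def relabel_decomp_simps by blast
qed

lemma relabel_decomp_dims:
  assumes "inj e"
  shows "topological_dim (relabel_decomp e D) = topological_dim D"
    "max_matrix_size (relabel_decomp e D) = max_matrix_size D"
  by (simp_all add: topological_dim_def max_matrix_size_def relabel_decomp_simps
      covering_dim_relabel_space[OF assms])

section \<open>The pullback and its decomposition\<close>

theorem proposition3p2:
  fixes A :: "'a cstar_alg" and B :: "'b cstar_alg" and C :: "'c cstar_alg"
    and DA :: "'x rsh_decomp" and DB :: "'y rsh_decomp"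
    and \<phi> :: "'a \<Rightarrow> 'c" and \<rho> :: "'b \<Rightarrow> 'c"
  assumes "rsh_decomposition_of A DA" and "separable_cstar A"
    and "rsh_decomposition_of B DB" and "separable_cstar B"
    and "cstar_algebra C"
    and "unital_star_hom A C \<phi>"
    and "star_hom B C \<rho>" and "\<rho> ` carrier B = carrier C"
  shows "\<exists>D :: ('x + 'y) rsh_decomp.
    rsh_decomposition_of (pullback A \<phi> B \<rho>) D \<and>
    topological_dim D \<le> max (topological_dim DA) (topological_dim DB) \<and>
    max_matrix_size D \<le> max (max_matrix_size DA) (max_matrix_size DB)"
proof -
  have inj: "inj (Inl :: 'x \<Rightarrow> 'x + 'y)" "inj (Inr :: 'y \<Rightarrow> 'x + 'y)" by auto
  let ?DA = "relabel_decomp Inl DA :: ('x + 'y) rsh_decomp"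
  let ?DB = "relabel_decomp Inr DB :: ('x + 'y) rsh_decomp"
  obtain D where D: "rsh_decomposition_of (pullback A \<phi> B \<rho>) D"
    and top: "top_index D = Suc (top_index ?DA + top_index ?DB)"
    and low: "\<And>i. i \<le> top_index ?DA \<Longrightarrow> rsh_space D i = rsh_space ?DA i \<and> msize D i = msize ?DA i"
    and high: "\<And>i. rsh_space D (Suc (top_index ?DA + i)) = rsh_space ?DB i \<and>
       msize D (Suc (top_index ?DA + i)) = msize ?DB i"
    using rsh_pullback_common_type[OF rsh_decomposition_of_relabel[OF inj(1) assms(1)]
        rsh_decomposition_of_relabel[OF inj(2) assms(3)] assms(5-8)] by blast
  have split: "i \<le> top_index ?DA \<or> (\<exists>j\<le>top_index ?DB. i = Suc (top_index ?DA + j))"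
    if "i \<le> top_index D" for i
    using that top by (cases "i \<le> top_index ?DA") (auto intro!: exI[of _ "i - Suc (top_index ?DA)"])
  have "covering_dim (rsh_space D i) \<le> max (topological_dim ?DA) (topological_dim ?DB)"
    if "i \<le> top_index D" for i
    using split[OF that] low high
    by (auto simp: topological_dim_def le_max_iff_disj intro!: Max_ge)
  then have "topological_dim D \<le> max (topological_dim ?DA) (topological_dim ?DB)"
    unfolding topological_dim_def[of D] by (subst Max_le_iff) auto
  moreover have "msize D i \<le> max (max_matrix_size ?DA) (max_matrix_size ?DB)"
    if "i \<le> top_index D" for i
    using split[OF that] low high
    by (auto simp: max_matrix_size_def le_max_iff_disj intro!: Max_ge)
  then have "max_matrix_size D \<le> max (max_matrix_size ?DA) (max_matrix_size ?DB)"
    unfolding max_matrix_size_def[of D] by (subst Max_le_iff) auto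
  ultimately show ?thesis
    using D unfolding relabel_decomp_dims[OF inj(1)] relabel_decomp_dims[OF inj(2)] by blast
qed

end
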